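(* Let $d \geq 1$ and $q \geq 0$ be integers. Let $\gamma_d^{(q)}$ be the pushforward of the Haar probability measure on the unitary group $\mathbb{U}_{d+q}$ under the map sending a $(d+q)\times(d+q)$ matrix to its upper-left $d \times d$ principal submatrix; it is a Borel probability measure on $\mathbb{B}_d=\{P \in \mathbb{M}_d(\mathbb{C}) : \|P\| \leq 1\}$ (operator norm). Let $H_{d\times q}=\prod_{i=0}^{d-1}\frac{(q+i)!}{i!}$ and define $$G_d(x;q)=\frac{x^{dq}}{H_{d\times q}}\int_{\mathbb{B}_d} e^{x\operatorname{Tr}(P+P^* )}\,\gamma_d^{(q)}(dP).$$ Then $$G_d(x;q)=\sum_{N\geq 0} Z_d(N;q)\frac{x^N}{N!},$$ where $Z_d(N;q)$ is the number of $N$-step walks in Fisher's random-turns vicious walker model (defined in the context) from the configuration $\rho=(d,d-1,\dots,1)$ to the configuration $\rho+(q,q,\dots,q)=(d+q,d+q-1,\dots,1+q)$.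
   Context: Fisher's random-turns vicious walker model with $d$ particles: the configuration space is $\mathcal{W}_d=\{(\lambda_1,\dots,\lambda_d)\in\mathbb{Z}^d : \lambda_1>\lambda_2>\dots>\lambda_d\}$ (positions of $d$ particles on $\mathbb{Z}$, listed in decreasing order). At each time step exactly one particle moves one unit left or right, subject to the constraint that no two particles ever occupy the same site; equivalently, a step is a move between two configurations in $\mathcal{W}_d$ at Euclidean distance $1$. A walk of length $N$ is a sequence of $N$ such steps. Configurations with all particles on adjacent sites, $(a+d-1,\dots,a+1,a)$, are called ground states; $Z_d(N;q)$ counts the walks of length $N$ between ground states $q$ sites apart, namely from $(d,\dots,1)$ to $(d+q,\dots,1+q)$. *)

theory Defs
  imports "HOL-Probability.Probability"
begin

type_synonym cmat = "nat \<times> nat \<Rightarrow> complex"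

definition idx :: "nat \<Rightarrow> (nat \<times> nat) set" where
  "idx n = {..<n} \<times> {..<n}"

definition mat_space :: "nat \<Rightarrow> cmat measure" where
  "mat_space n = PiM (idx n) (\<lambda>_. borel)"

definition mmult :: "nat \<Rightarrow> cmat \<Rightarrow> cmat \<Rightarrow> cmat" where
  "mmult n A B = restrict (\<lambda>(i,j). \<Sum>k<n. A (i,k) * B (k,j)) (idx n)"

definition madj :: "nat \<Rightarrow> cmat \<Rightarrow> cmat" where
  "madj n A = restrict (\<lambda>(i,j). cnj (A (j,i))) (idx n)"

definition mone :: "nat \<Rightarrow> cmat" where
  "mone n = restrict (\<lambda>(i,j). if i = j then 1 else 0) (idx n)"

definition mtrace :: "nat \<Rightarrow> cmat \<Rightarrow> complex" where
  "mtrace n A = (\<Sum>i<n. A (i,i))"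

definition unitary :: "nat \<Rightarrow> cmat \<Rightarrow> bool" where
  "unitary n A \<longleftrightarrow> A \<in> space (mat_space n) \<and> mmult n (madj n A) A = mone n"

text \<open>Haar probability measure on the unitary group U(n): a probability measure on the
  n x n complex matrices, concentrated on U(n) and invariant under left multiplication by
  unitary matrices (this characterizes the Haar measure uniquely).\<close>
definition is_haar_unitary :: "nat \<Rightarrow> cmat measure \<Rightarrow> bool" where
  "is_haar_unitary n \<mu> \<longleftrightarrow>
     prob_space \<mu> \<and> sets \<mu> = sets (mat_space n) \<and>
     (AE A in \<mu>. unitary n A) \<and>
     (\<forall>V. unitary n V \<longrightarrow> distr \<mu> (mat_space n) (\<lambda>A. mmult n V A) = \<mu>)"

definition submat :: "nat \<Rightarrow> cmat \<Rightarrow> cmat" where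
  "submat d A = restrict A (idx d)"

text \<open>gamma_d^(q): pushforward of the Haar measure of U(d+q) under the submatrix map.\<close>
definition gamma :: "nat \<Rightarrow> cmat measure \<Rightarrow> cmat measure" where
  "gamma d \<mu> = distr \<mu> (mat_space d) (submat d)"

definition Hdq :: "nat \<Rightarrow> nat \<Rightarrow> complex" where
  "Hdq d q = (\<Prod>i<d. fact (q + i) / fact i)"

definition G :: "nat \<Rightarrow> nat \<Rightarrow> cmat measure \<Rightarrow> real \<Rightarrow> complex" where
  "G d q \<mu> x = (of_real x) ^ (d * q) / Hdq d q *
     integral\<^sup>L (gamma d \<mu>) (\<lambda>P. exp (of_real x * mtrace d (\<lambda>ij. P ij + madj d P ij)))"

definition in_W :: "nat \<Rightarrow> int list \<Rightarrow> bool" where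
  "in_W d c \<longleftrightarrow> length c = d \<and> sorted_wrt (>) c"

definition step :: "int list \<Rightarrow> int list \<Rightarrow> bool" where
  "step c c' \<longleftrightarrow> length c = length c' \<and> (\<Sum>i<length c. (c ! i - c' ! i)^2) = 1"

definition walks :: "nat \<Rightarrow> nat \<Rightarrow> int list \<Rightarrow> int list \<Rightarrow> int list list set" where
  "walks d N a b = {w. length w = N + 1 \<and> w ! 0 = a \<and> w ! N = b \<and>
      (\<forall>c\<in>set w. in_W d c) \<and> (\<forall>i<N. step (w ! i) (w ! (i + 1)))}"

definition rho :: "nat \<Rightarrow> int list" where
  "rho d = map int (rev [1..<d+1])"

definition Z :: "nat \<Rightarrow> nat \<Rightarrow> nat \<Rightarrow> nat" where
  "Z d N q = card (walks d N (rho d) (map (\<lambda>a. a + int q) (rho d)))"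

end

theory Submission
  imports Defs "Jordan_Normal_Form.Determinant"
begin

text \<open>
  Put \<open>n = d + q\<close> and consider the moments \<open>c(k) = E \<Prod>\<^sub>i |U\<^sub>i\<^sub>i|\<^sup>2\<^sup>k\<^sub>i\<close> for \<open>i < d\<close>. The Haar measure is invariant
  under adjoints, and its invariance under infinitesimal rotations of two rows yields Schwinger--Dyson
  equations. Together with \<open>\<Sum>\<^sub>j |U\<^sub>j\<^sub>i|\<^sup>2 = 1\<close> they show that the generating function
  \<open>\<Phi>(t) = \<Sum>\<^sub>k c(k) t\<^sup>k / (k!)\<^sup>2\<close> satisfies Muirhead's differential system. Multiplication by the Vandermonde
  determinant \<open>V\<close> turns the sum of these equations into a recurrence that is diagonal on monomials, and its
  only antisymmetric solution, up to a constant, is \<open>det (h\<^bsub>q-j\<^esub>(t\<^sub>i))\<close> with \<open>h\<^sub>k(t) = \<Sum>\<^sub>m t\<^sup>m / (m! (m+k)!)\<close>.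
  Letting all \<open>t\<^sub>i\<close> tend to \<open>x\<^sup>2\<close> gives \<open>\<Phi> = H det (h\<^bsub>q+i-j\<^esub>(x\<^sup>2))\<close>. On the other side, the reflection
  principle expresses the exponential generating function of the vicious walks as \<open>det (I\<^bsub>q+i-j\<^esub>(2x))\<close>
  with the Bessel functions \<open>I\<^sub>k(2x) = x\<^sup>k h\<^sub>k(x\<^sup>2)\<close>.
\<close>

section \<open>Alternating sums over permutations\<close>

text \<open>Only the moments \<open>c(k)\<close> occur because left multiplication by diagonal
  phases annihilates every monomial in the \<open>U_ii\<close> and their conjugates with unequal
  exponents. The Schwinger--Dyson equations alone do not close: besides moments with one extra
  factor \<open>|U_ij|^2\<close> they contain cross terms with the conjugates of \<open>U_ij\<close>
  and \<open>U_ji\<close>. These are symmetric in \<open>i\<close> and \<open>j\<close>, so a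
  suitable difference of the equations for \<open>(i, j)\<close> and \<open>(j, i)\<close> removes
  them; the adjoint identifies the moments with \<open>|U_ij|^2\<close> and \<open>|U_ji|^2\<close>.
  In the normalisation of a column, the \<open>q\<close> rows below the block produce the parameter
  \<open>q\<close>. Muirhead's equations have singular coefficients
  \<open>t_i / (t_i - t_j)\<close>, which disappear only after summation and multiplication by
  \<open>V\<close>. The price is paid on the diagonal, where \<open>V\<close> vanishes; there the
  quotient is read off from a weighted sum of coefficients instead of an analytic limit.\<close>

definition alt :: "nat \<Rightarrow> ((nat \<Rightarrow> nat) \<Rightarrow> 'a) \<Rightarrow> 'a::comm_ring_1" where
  "alt d F = (\<Sum>\<sigma> | \<sigma> permutes {..<d}. of_int (sign \<sigma>) * F \<sigma>)"

lemma permutes_less_nat: "\<sigma> permutes {..<d} \<Longrightarrow> \<sigma> i < d \<longleftrightarrow> i < (d::nat)"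
  using permutes_in_image[of \<sigma> "{..<d}" i] by simp

lemma alt_cong: "(\<And>\<sigma>. \<sigma> permutes {..<d} \<Longrightarrow> F \<sigma> = F' \<sigma>) \<Longrightarrow> alt d F = alt d F'"
  by (simp add: alt_def)

lemma alt_add: "alt d (\<lambda>\<sigma>. F \<sigma> + F' \<sigma>) = alt d F + alt d F'"
  by (simp add: alt_def algebra_simps sum.distrib)

lemma alt_diff: "alt d (\<lambda>\<sigma>. F \<sigma> - F' \<sigma>) = alt d F - alt d F'"
  by (simp add: alt_def algebra_simps sum_subtractf)

lemma alt_mult: "alt d (\<lambda>\<sigma>. c * F \<sigma>) = c * alt d F"
  by (simp add: alt_def sum_distrib_left algebra_simps)

lemma alt_mult_right: "alt d (\<lambda>\<sigma>. F \<sigma> * c) = alt d F * c"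
  by (simp add: alt_def sum_distrib_right mult.assoc)

lemma alt_sum: "alt d (\<lambda>\<sigma>. \<Sum>i\<in>A. F i \<sigma>) = (\<Sum>i\<in>A. alt d (F i))"
  unfolding alt_def sum_distrib_left by (rule sum.swap)

lemma alt_compose_right:
  assumes "\<pi> permutes {..<d}"
  shows "alt d (\<lambda>\<sigma>. F (\<sigma> \<circ> \<pi>)) = of_int (sign \<pi>) * alt d F"
proof -
  have "alt d F = (\<Sum>\<sigma> | \<sigma> permutes {..<d}. of_int (sign (\<sigma> \<circ> \<pi>)) * F (\<sigma> \<circ> \<pi>))"
    unfolding alt_def by (rule sum_permutations_compose_right[OF assms])
  also have "\<dots> = (\<Sum>\<sigma> | \<sigma> permutes {..<d}. of_int (sign \<pi>) * (of_int (sign \<sigma>) * F (\<sigma> \<circ> \<pi>)))"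
    using assms by (intro sum.cong refl) (auto simp: sign_compose permutes_imp_permutation[OF finite_lessThan] algebra_simps)
  finally have "alt d F = of_int (sign \<pi>) * alt d (\<lambda>\<sigma>. F (\<sigma> \<circ> \<pi>))"
    by (simp add: alt_def sum_distrib_left)
  moreover have "of_int (sign \<pi>) * (of_int (sign \<pi>) :: 'a) = 1"
    by (metis of_int_1 of_int_mult sign_idempotent)
  ultimately show ?thesis by (metis mult.assoc mult_1)
qed

lemma alt_compose_left:
  assumes "\<pi> permutes {..<d}"
  shows "alt d (\<lambda>\<sigma>. F (\<pi> \<circ> \<sigma>)) = of_int (sign \<pi>) * alt d F"
proof -
  have "alt d F = (\<Sum>\<sigma> | \<sigma> permutes {..<d}. of_int (sign (\<pi> \<circ> \<sigma>)) * F (\<pi> \<circ> \<sigma>))"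
    unfolding alt_def by (rule setum_permutations_compose_left[OF assms])
  also have "\<dots> = (\<Sum>\<sigma> | \<sigma> permutes {..<d}. of_int (sign \<pi>) * (of_int (sign \<sigma>) * F (\<pi> \<circ> \<sigma>)))"
    using assms by (intro sum.cong refl) (auto simp: sign_compose permutes_imp_permutation[OF finite_lessThan] algebra_simps)
  finally have "alt d F = of_int (sign \<pi>) * alt d (\<lambda>\<sigma>. F (\<pi> \<circ> \<sigma>))"
    by (simp add: alt_def sum_distrib_left)
  moreover have "of_int (sign \<pi>) * (of_int (sign \<pi>) :: 'a) = 1"
    by (metis of_int_1 of_int_mult sign_idempotent)
  ultimately show ?thesis by (metis mult.assoc mult_1)
qed

text \<open>Left composition with a transposition exchanges two values of \<open>\<sigma>\<close>,
  and invariance under it gives \<open>alt d F = - alt d F\<close>. The companion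
  \<open>alt_eq_0_right\<close> exchanges two positions, as when two rows of a determinant
  agree.\<close>

lemma alt_eq_0_left:
  fixes F :: "(nat \<Rightarrow> nat) \<Rightarrow> 'a::{idom, ring_char_0}"
  assumes "a < d" "b < d" "a \<noteq> b"
    and "\<And>\<sigma>. \<sigma> permutes {..<d} \<Longrightarrow> F (Transposition.transpose a b \<circ> \<sigma>) = F \<sigma>"
  shows "alt d F = 0"
proof -
  have "alt d F = alt d (\<lambda>\<sigma>. F (Transposition.transpose a b \<circ> \<sigma>))"
    by (rule alt_cong) (simp add: assms(4))
  also have "\<dots> = - alt d F"
    using assms by (subst alt_compose_left) (auto simp: sign_swap_id permutes_swap_id)
  finally show ?thesis by (simp add: eq_neg_iff_add_eq_0 flip: mult_2)
qed

lemma alt_eq_0_right: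
  fixes F :: "(nat \<Rightarrow> nat) \<Rightarrow> 'a::{idom, ring_char_0}"
  assumes "a < d" "b < d" "a \<noteq> b"
    and "\<And>\<sigma>. \<sigma> permutes {..<d} \<Longrightarrow> F (\<sigma> \<circ> Transposition.transpose a b) = F \<sigma>"
  shows "alt d F = 0"
proof -
  have "alt d F = alt d (\<lambda>\<sigma>. F (\<sigma> \<circ> Transposition.transpose a b))"
    by (rule alt_cong) (simp add: assms(4))
  also have "\<dots> = - alt d F"
    using assms by (subst alt_compose_right) (auto simp: sign_swap_id permutes_swap_id)
  finally show ?thesis by (simp add: eq_neg_iff_add_eq_0 flip: mult_2)
qed

lemma alt_single:
  assumes "\<And>\<sigma>. \<sigma> permutes {..<d} \<Longrightarrow> \<sigma> \<noteq> id \<Longrightarrow> F \<sigma> = 0"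
  shows "alt d F = F id"
proof -
  have "alt d F = (\<Sum>\<sigma>\<in>{id}. of_int (sign \<sigma>) * F \<sigma>)"
    unfolding alt_def by (rule sum.mono_neutral_right) (auto simp: assms permutes_id finite_permutations)
  thus ?thesis by simp
qed

lemma alt_prod_eq_det:
  "alt d (\<lambda>\<sigma>. \<Prod>i<d. M i (\<sigma> i)) = det (mat d d (\<lambda>(i,j). M i j))"
proof -
  have "det (mat d d (\<lambda>(i,j). M i j)) =
    (\<Sum>\<sigma> | \<sigma> permutes {0..<d}. signof \<sigma> * (\<Prod>i = 0..<d. mat d d (\<lambda>(i,j). M i j) $$ (i, \<sigma> i)))"
    by (rule det_def') simp
  also have "\<dots> = alt d (\<lambda>\<sigma>. \<Prod>i<d. M i (\<sigma> i))"
    unfolding alt_def atLeast0LessThan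
    by (intro sum.cong refl arg_cong2[of _ _ _ _ "(*)"] prod.cong)
       (auto simp: permutes_less_nat atLeast0LessThan)
  finally show ?thesis by simp
qed

lemma alt_prod_transpose:
  "alt d (\<lambda>\<sigma>. \<Prod>i<d. M (\<sigma> i) i) = alt d (\<lambda>\<sigma>. \<Prod>i<d. M i (\<sigma> i))"
proof -
  have "alt d (\<lambda>\<sigma>. \<Prod>i<d. M (\<sigma> i) i) = det (mat d d (\<lambda>(i,j). M j i))"
    by (rule alt_prod_eq_det)
  also have "mat d d (\<lambda>(i,j). M j i) = transpose_mat (mat d d (\<lambda>(i,j). M i j))"
    by (intro eq_matI) auto
  also have "det \<dots> = det (mat d d (\<lambda>(i,j). M i j))"
    by (rule det_transpose[of _ d]) simp
  finally show ?thesis by (simp add: alt_prod_eq_det)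
qed

text \<open>The matrix is a product of a lower and an upper unitriangular one by Vandermonde's
  convolution. The free parameters \<open>k i\<close> allow it to be inserted as a factor 1 for
  every exponent vector in \<open>diagonal_sum\<close>.\<close>

lemma alt_gbinomial:
  fixes k :: "nat \<Rightarrow> complex"
  shows "alt d (\<lambda>\<sigma>. \<Prod>i<d. (k i + of_nat (\<sigma> i)) gchoose i) = 1"
proof -
  define A where "A = mat d d (\<lambda>(i,s). if s \<le> i then k i gchoose (i - s) else 0)"
  define B where "B = mat d d (\<lambda>(s,j). (of_nat j :: complex) gchoose s)"
  have AB: "mat d d (\<lambda>(i,j). (k i + of_nat j) gchoose i) = A * B"
  proof (intro eq_matI)
    fix i j assume "i < dim_row (A * B)" "j < dim_col (A * B)"
    hence ij: "i < d" "j < d" by (auto simp: A_def B_def)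
    have "(A * B) $$ (i,j) = (\<Sum>s = 0..<d. (if s \<le> i then k i gchoose (i - s) else 0) * ((of_nat j :: complex) gchoose s))"
      using ij by (simp add: A_def B_def scalar_prod_def)
    also have "\<dots> = (\<Sum>s = 0..i. (k i gchoose (i - s)) * ((of_nat j :: complex) gchoose s))"
      using ij by (intro sum.mono_neutral_cong_right) auto
    also have "\<dots> = (\<Sum>s = 0..i. ((of_nat j :: complex) gchoose s) * (k i gchoose (i - s)))"
      by (simp add: mult.commute)
    also have "\<dots> = (k i + of_nat j) gchoose i"
      by (simp add: gbinomial_Vandermonde add.commute)
    finally show "mat d d (\<lambda>(i,j). (k i + of_nat j) gchoose i) $$ (i,j) = (A * B) $$ (i,j)"
      using ij by simp
  qed (auto simp: A_def B_def)
  have "det A = 1"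
    by (subst det_lower_triangular[of d])
       (auto simp: A_def prod_list_diag_prod intro!: prod.neutral)
  moreover have "det B = 1"
    by (subst det_upper_triangular[of _ d])
       (auto simp: B_def prod_list_diag_prod binomial_gbinomial[symmetric] intro!: prod.neutral)
  ultimately show ?thesis
    by (subst alt_prod_eq_det) (simp add: AB det_mult[of _ d] A_def B_def)
qed

text \<open>The reciprocal factorial, extended by zero to the negative integers (where \<open>1 / \<Gamma>\<close> vanishes).\<close>
definition rfact :: "int \<Rightarrow> complex" where
  "rfact z = (if z < 0 then 0 else 1 / fact (nat z))"

lemma rfact_neg [simp]: "z < 0 \<Longrightarrow> rfact z = 0"
  by (simp add: rfact_def)

lemma rfact_of_nat [simp]: "rfact (int n) = 1 / fact n"
  by (simp add: rfact_def)

lemma rfact_0 [simp]: "rfact 0 = 1"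
  by (simp add: rfact_def)

text \<open>Valid at every integer, since both sides vanish for \<open>z \<le> 0\<close>; lowering
  an index in a recurrence therefore needs no boundary case.\<close>

lemma rfact_rec: "of_int z * rfact z = rfact (z - 1)"
proof (cases "z > 0")
  case True
  define n where "n = nat (z - 1)"
  have "nat z = Suc n" "nat (z - 1) = n" "of_int z = (of_nat (Suc n) :: complex)"
    using True by (auto simp: n_def)
  moreover have "(of_nat (Suc n) :: complex) \<noteq> 0"
    by (rule of_nat_neq_0)
  ultimately show ?thesis
    using True unfolding rfact_def by (simp del: of_nat_Suc)
qed (auto simp: rfact_def)

lemma rfact_gbinomial: "((of_nat n :: complex) gchoose j) * rfact (int n) = rfact (int j) * rfact (int n - int j)"
proof (cases "j \<le> n")
  case True
  hence "rfact (int n - int j) = 1 / fact (n - j)"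
    by (metis of_nat_diff rfact_of_nat)
  with True show ?thesis
    by (simp add: binomial_gbinomial[symmetric] binomial_fact)
next
  case False
  hence "(of_nat n :: complex) gchoose j = 0"
    by (simp add: binomial_gbinomial[symmetric] binomial_eq_0)
  with False show ?thesis by simp
qed

text \<open>Up to row and column factors the entries are the binomial coefficients
  \<open>(q + i) choose j\<close>, also where they vanish. The value is the reciprocal of
  \<open>Hdq d q\<close>.\<close>

lemma alt_rfact:
  "alt d (\<lambda>\<sigma>. \<Prod>i<d. rfact (int q + int i - int (\<sigma> i))) = (\<Prod>i<d. fact i / fact (q + i))"
proof -
  have "alt d (\<lambda>\<sigma>. \<Prod>i<d. rfact (int q + int i - int (\<sigma> i))) =
        alt d (\<lambda>\<sigma>. (\<Prod>i<d. fact i / fact (q + i)) * (\<Prod>i<d. (of_nat (q + i) :: complex) gchoose (\<sigma> i)))"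
  proof (rule alt_cong)
    fix \<sigma> assume s: "\<sigma> permutes {..<d}"
    have "(\<Prod>i<d. fact (\<sigma> i)) = (\<Prod>i<d. fact i :: complex)"
      using prod.permute[OF s, of "fact :: nat \<Rightarrow> complex"] by (simp add: o_def)
    moreover have "rfact (int q + int i - int (\<sigma> i)) =
        fact (\<sigma> i) * (((of_nat (q + i) :: complex) gchoose (\<sigma> i)) / fact (q + i))" for i
      using rfact_gbinomial[of "q + i" "\<sigma> i"] unfolding rfact_of_nat by (simp only: of_nat_add) simp
    ultimately show "(\<Prod>i<d. rfact (int q + int i - int (\<sigma> i))) =
       (\<Prod>i<d. fact i / fact (q + i)) * (\<Prod>i<d. (of_nat (q + i) :: complex) gchoose (\<sigma> i))"
      by (simp only: prod.distrib prod_dividef) simp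
  qed
  also have "\<dots> = (\<Prod>i<d. fact i / fact (q + i)) * alt d (\<lambda>\<sigma>. \<Prod>i<d. (of_nat (q + \<sigma> i) :: complex) gchoose i)"
    by (simp only: alt_mult alt_prod_transpose[where M = "\<lambda>i j. (of_nat (q + i) :: complex) gchoose j"])
  also have "alt d (\<lambda>\<sigma>. \<Prod>i<d. (of_nat (q + \<sigma> i) :: complex) gchoose i) = 1"
    using alt_gbinomial[of d "\<lambda>_. of_nat q"] by simp
  finally show ?thesis by simp
qed

section \<open>The Vandermonde determinant\<close>

lemma base_expansion_inj:
  fixes k l :: "nat \<Rightarrow> nat"
  assumes "\<And>i. i < d \<Longrightarrow> k i < B" "\<And>i. i < d \<Longrightarrow> l i < B"
    and "(\<Sum>i<d. k i * B ^ i) = (\<Sum>i<d. l i * B ^ i)" "i < d"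
  shows "k i = l i"
  using assms
proof (induction d arbitrary: k l i)
  case (Suc d)
  have split: "(\<Sum>i<Suc d. m i * B ^ i) = m 0 + B * (\<Sum>i<d. m (Suc i) * B ^ i)" for m :: "nat \<Rightarrow> nat"
    unfolding sum.lessThan_Suc_shift by (simp add: sum_distrib_left mult.left_commute)
  have eq: "k 0 + B * (\<Sum>i<d. k (Suc i) * B ^ i) = l 0 + B * (\<Sum>i<d. l (Suc i) * B ^ i)"
    using Suc.prems(3) unfolding split .
  have B: "k 0 < B" "l 0 < B" using Suc.prems(1,2) by auto
  have 0: "k 0 = l 0"
    using arg_cong[OF eq, of "\<lambda>x. x mod B"] B by simp
  with eq B have "(\<Sum>i<d. k (Suc i) * B ^ i) = (\<Sum>i<d. l (Suc i) * B ^ i)" by simp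
  from Suc.IH[OF _ _ this] Suc.prems(1,2) have "k (Suc i) = l (Suc i)" if "i < d" for i
    using that by simp
  with 0 Suc.prems(4) show ?case by (cases i) auto
qed simp

text \<open>Kronecker substitution \<open>t\<^sub>i = y\<^bsup>B\<^sup>i\<^esup>\<close> reduces the claim to polynomials in one variable.\<close>
lemma polynomial_identity:
  fixes c :: "nat multiset \<Rightarrow> complex"
  assumes "\<And>t. inj_on t {..<d} \<Longrightarrow> (\<Sum>X\<in>multisets_of_size {..<d} M. c X * (\<Prod>i<d. t i ^ count X i)) = 0"
    and "X \<in> multisets_of_size {..<d} M"
  shows "c X = 0"
proof -
  \<comment> \<open>All counts are at most \<open>M\<close>, so they are digits in base
    \<open>B\<close>; \<open>B \<ge> 2\<close> also makes the powers \<open>B ^ i\<close>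
    distinct.\<close>
  define B where "B = M + 2"
  define e where "e = (\<lambda>X. \<Sum>i<d. count X i * B ^ i)"
  define p where "p = (\<Sum>X\<in>multisets_of_size {..<d} M. Polynomial.monom (c X) (e X))"
  have fin: "finite (multisets_of_size {..<d} M)"
    by (rule finite_multisets_of_size) simp
  have cnt: "count Y i < B" if "Y \<in> multisets_of_size {..<d} M" for Y i
    using that count_le_size[of Y i] by (simp add: multisets_of_size_def B_def)
  have inj: "Y = Y'" if "Y \<in> multisets_of_size {..<d} M" "Y' \<in> multisets_of_size {..<d} M" "e Y = e Y'" for Y Y'
  proof (rule multiset_eqI)
    fix i show "count Y i = count Y' i"
    proof (cases "i < d")
      case True
      thus ?thesis using base_expansion_inj[of d "count Y" B "count Y'"] cnt that unfolding e_def by blast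
    next
      case False
      thus ?thesis using that by (auto simp: multisets_of_size_def) (metis count_inI lessThan_iff subsetD)
    qed
  qed
  \<comment> \<open>At an integer \<open>y \<ge> 2\<close> the substituted points are pairwise
    distinct, as the hypothesis demands, and there are infinitely many such
    \<open>y\<close>.\<close>
  have "poly p (of_nat (n + 2)) = 0" for n
  proof -
    have "inj_on (\<lambda>i. (of_nat (n + 2) :: complex) ^ (B ^ i)) {..<d}"
    proof (rule inj_onI)
      fix i j assume ij: "i \<in> {..<d}" "j \<in> {..<d}" "(of_nat (n + 2) :: complex) ^ (B ^ i) = of_nat (n + 2) ^ (B ^ j)"
      have "(n + 2) ^ (B ^ i) = (n + 2) ^ (B ^ j)"
        using ij(3) by (metis of_nat_power of_nat_eq_iff)
      hence Bij: "B ^ i = B ^ j" by simp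
      thus "i = j" by (simp add: B_def)
    qed
    from assms(1)[OF this] show ?thesis
      by (simp add: p_def poly_sum poly_monom e_def power_sum mult.commute flip: power_mult)
  qed
  hence "range (\<lambda>n. of_nat (n + 2) :: complex) \<subseteq> {x. poly p x = 0}" by auto
  moreover have "infinite (range (\<lambda>n. of_nat (n + 2) :: complex))"
    by (rule range_inj_infinite) (auto simp: inj_on_def)
  ultimately have "p = 0"
    using poly_roots_finite infinite_super by blast
  have "Polynomial.coeff p (e X) = (\<Sum>Y\<in>{X}. c Y)"
    unfolding p_def coeff_sum coeff_monom using fin assms(2) inj
    by (intro sum.mono_neutral_cong_right) auto
  with \<open>p = 0\<close> show ?thesis by simp
qed

lemma poly_eq_smult_prod_roots:
  fixes p :: "'a::field poly"
  assumes "finite A" "Polynomial.degree p \<le> card A" "\<And>a. a \<in> A \<Longrightarrow> poly p a = 0"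
  shows "\<exists>c. p = Polynomial.smult c (\<Prod>a\<in>A. [:-a, 1:])"
proof -
  let ?P = "\<Prod>a\<in>A. [:-a, 1:]"
  define c where "c = Polynomial.coeff p (card A)"
  have deg: "Polynomial.degree ?P = card A" by (subst degree_prod_eq_sum_degree) auto
  have lead: "Polynomial.coeff ?P (card A) = 1"
    using lead_coeff_prod[of "\<lambda>a. [:-a, 1:]" A] deg by simp
  have "p - Polynomial.smult c ?P = 0"
  proof (rule ccontr)
    assume nz: "p - Polynomial.smult c ?P \<noteq> 0"
    have "A \<subseteq> {x. poly (p - Polynomial.smult c ?P) x = 0}"
      using assms by (auto simp: poly_prod)
    hence "card A \<le> card {x. poly (p - Polynomial.smult c ?P) x = 0}"
      by (intro card_mono poly_roots_finite nz)
    also have "\<dots> \<le> Polynomial.degree (p - Polynomial.smult c ?P)"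
      by (rule card_poly_roots_bound[OF nz])
    finally have le: "card A \<le> Polynomial.degree (p - Polynomial.smult c ?P)" .
    have "Polynomial.degree (p - Polynomial.smult c ?P) \<le> card A"
      using assms(2) deg by (intro degree_diff_le) (auto intro: order_trans[OF degree_smult_le])
    with le have "Polynomial.degree (p - Polynomial.smult c ?P) = card A" by simp
    with nz have "Polynomial.coeff (p - Polynomial.smult c ?P) (card A) \<noteq> 0" by (metis leading_coeff_0_iff)
    thus False by (simp add: lead c_def)
  qed
  thus ?thesis by auto
qed

definition vand :: "nat \<Rightarrow> (nat \<Rightarrow> complex) \<Rightarrow> complex" where
  "vand d t = alt d (\<lambda>\<sigma>. \<Prod>i<d. t i ^ \<sigma> i)"

text \<open>The Euler derivative of \<open>vand d t\<close> with respect to the variable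
  \<open>t i\<close>.\<close>

definition dvand :: "nat \<Rightarrow> nat \<Rightarrow> (nat \<Rightarrow> complex) \<Rightarrow> complex" where
  "dvand d i t = alt d (\<lambda>\<sigma>. of_nat (\<sigma> i) * (\<Prod>i<d. t i ^ \<sigma> i))"

text \<open>As a polynomial in \<open>t i\<close> alone the determinant has degree at most
  \<open>d - 1\<close> and vanishes at the other \<open>d - 1\<close> points, so it is a constant
  times a product of linear factors. The claim is its logarithmic derivative.\<close>

lemma dvand_eq:
  assumes inj: "inj_on t {..<d}" and i: "i < d"
  shows "dvand d i t = vand d t * (\<Sum>j\<in>{..<d}-{i}. t i / (t i - t j))"
proof -
  define A where "A = t ` ({..<d} - {i})"
  have injA: "inj_on t ({..<d} - {i})" using inj by (rule inj_on_diff)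
  define p where "p = (\<Sum>\<sigma> | \<sigma> permutes {..<d}. Polynomial.monom (of_int (sign \<sigma>) * (\<Prod>s\<in>{..<d}-{i}. t s ^ \<sigma> s)) (\<sigma> i))"
  have split: "(\<Prod>s<d. t' s) = t' i * (\<Prod>s\<in>{..<d}-{i}. t' s)" for t' :: "nat \<Rightarrow> complex"
    using i by (subst prod.remove[of _ i]) auto
  have pv: "poly p y = vand d (t(i := y))" for y
  proof -
    have "(\<Prod>s\<in>{..<d}-{i}. (t(i := y)) s ^ \<sigma> s) = (\<Prod>s\<in>{..<d}-{i}. t s ^ \<sigma> s)" for \<sigma>
      by (intro prod.cong) auto
    thus ?thesis unfolding p_def vand_def alt_def split
      by (simp add: poly_sum poly_monom mult_ac)
  qed
  have zero: "poly p a = 0" if "a \<in> A" for a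
  proof -
    from that obtain j where j: "j < d" "j \<noteq> i" "a = t j" by (auto simp: A_def)
    have "vand d (t(i := a)) = 0"
      unfolding vand_def
    proof (rule alt_eq_0_right[of i d j])
      fix \<sigma> assume "\<sigma> permutes {..<d}"
      let ?\<tau> = "Transposition.transpose i j"
      have \<tau>: "?\<tau> permutes {..<d}" using i j by (intro permutes_swap_id) auto
      have "(\<Prod>s<d. (t(i := a)) s ^ \<sigma> s) = (\<Prod>s<d. (t(i := a)) (?\<tau> s) ^ \<sigma> (?\<tau> s))"
        using prod.permute[OF \<tau>, of "\<lambda>s. (t(i := a)) s ^ \<sigma> s"] by (simp add: o_def)
      also have "\<dots> = (\<Prod>s<d. (t(i := a)) s ^ \<sigma> (?\<tau> s))"
        using j by (intro prod.cong arg_cong2[of _ _ _ _ "(^)"]) (auto simp: Transposition.transpose_def)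
      finally show "(\<Prod>s<d. (t(i := a)) s ^ (\<sigma> \<circ> ?\<tau>) s) = (\<Prod>s<d. (t(i := a)) s ^ \<sigma> s)" by simp
    qed (use i j in auto)
    thus ?thesis by (simp add: pv)
  qed
  have "Polynomial.degree p \<le> d - 1"
    unfolding p_def
  proof (rule degree_sum_le)
    fix \<sigma> assume "\<sigma> \<in> {\<sigma>. \<sigma> permutes {..<d}}"
    hence "\<sigma> i < d" using i permutes_less_nat by auto
    thus "Polynomial.degree (Polynomial.monom (of_int (sign \<sigma>) * (\<Prod>s\<in>{..<d}-{i}. t s ^ \<sigma> s)) (\<sigma> i)) \<le> d - 1"
      by (intro order_trans[OF degree_monom_le]) auto
  qed (simp add: finite_permutations)
  moreover have "card A = d - 1"
    unfolding A_def using i by (subst card_image[OF injA]) simp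
  ultimately obtain c where c: "p = Polynomial.smult c (\<Prod>a\<in>A. [:-a, 1:])"
    using poly_eq_smult_prod_roots[of A p] zero by (auto simp: A_def)
  have ne: "t i \<noteq> t s" if "s \<in> {..<d}-{i}" for s
    using that inj i by (auto dest: inj_onD)
  have P: "p = Polynomial.smult c (\<Prod>s\<in>{..<d}-{i}. [:- t s, 1:])"
    unfolding c A_def by (subst prod.reindex[OF injA]) (simp add: o_def)
  have "dvand d i t = t i * poly (pderiv p) (t i)"
    unfolding dvand_def alt_def p_def higher_pderiv_sum[where n = 1, simplified] pderiv_monom poly_sum poly_monom split sum_distrib_left
    by (intro sum.cong refl) (auto simp: algebra_simps power_eq_if)
  also have "poly (pderiv p) (t i) = c * (\<Sum>j\<in>{..<d}-{i}. \<Prod>s\<in>{..<d}-{i}-{j}. t i - t s)"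
    unfolding P by (simp add: pderiv_smult pderiv_prod poly_sum poly_prod pderiv_pCons sum_distrib_left)
  also have "(\<Sum>j\<in>{..<d}-{i}. \<Prod>s\<in>{..<d}-{i}-{j}. t i - t s) =
      (\<Sum>j\<in>{..<d}-{i}. (\<Prod>s\<in>{..<d}-{i}. t i - t s) / (t i - t j))"
    using ne by (intro sum.cong refl) (simp add: prod.remove[where A = "{..<d}-{i}"])
  also have "t i * (c * \<dots>) = (c * (\<Prod>s\<in>{..<d}-{i}. t i - t s)) * (\<Sum>j\<in>{..<d}-{i}. t i / (t i - t j))"
    by (simp add: sum_distrib_left mult_ac)
  also have "c * (\<Prod>s\<in>{..<d}-{i}. t i - t s) = vand d t"
    using pv[of "t i"] unfolding P by (simp add: poly_prod)
  finally show ?thesis .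
qed

section \<open>Antisymmetric solutions of Muirhead's system\<close>

abbreviation cnt :: "nat multiset \<Rightarrow> nat \<Rightarrow> int" where
  "cnt X \<equiv> \<lambda>i. int (count X i)"

text \<open>The degree is an integer so that index sets of negative degree are empty.\<close>
definition MI :: "nat \<Rightarrow> int \<Rightarrow> nat multiset set" where
  "MI d z = {X. set_mset X \<subseteq> {..<d} \<and> int (size X) = z}"

lemma MI_of_nat: "MI d (int m) = multisets_of_size {..<d} m"
  by (auto simp: MI_def multisets_of_size_def)

lemma finite_MI [simp]: "finite (MI d z)"
proof (cases "z < 0")
  case False
  then obtain m where "z = int m" by (metis nonneg_int_cases not_less)
  thus ?thesis by (simp add: MI_of_nat finite_multisets_of_size)
qed (auto simp: MI_def)

text \<open>The exponent vector of the Vandermonde term of \<open>\<sigma>\<close>. It is 0 from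
  \<open>d\<close> on, so that it coincides with the count function of
  \<open>rkm d \<sigma>\<close>.\<close>

definition rk :: "nat \<Rightarrow> (nat \<Rightarrow> nat) \<Rightarrow> nat \<Rightarrow> int" where
  "rk d \<sigma> i = (if i < d then int (\<sigma> i) else 0)"

definition rkm :: "nat \<Rightarrow> (nat \<Rightarrow> nat) \<Rightarrow> nat multiset" where
  "rkm d \<sigma> = (\<Sum>i<d. replicate_mset (\<sigma> i) i)"

lemma count_rkm: "count (rkm d \<sigma>) i = (if i < d then \<sigma> i else 0)"
  by (simp add: rkm_def count_sum if_distrib cong: if_cong)

lemma cnt_rkm: "cnt (rkm d \<sigma>) = rk d \<sigma>"
  by (auto simp: count_rkm rk_def)

lemma set_rkm: "set_mset (rkm d \<sigma>) \<subseteq> {..<d}"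
  by (auto simp: set_mset_def count_rkm split: if_splits)

lemma size_multiset_sum: "size (\<Sum>a\<in>A. f a :: 'a multiset) = (\<Sum>a\<in>A. size (f a))"
  by (induction A rule: infinite_finite_induct) auto

lemma size_rkm: "\<sigma> permutes {..<d} \<Longrightarrow> size (rkm d \<sigma>) = (\<Sum>i<d. i)"
  using sum.permute[of \<sigma> "{..<d}" "\<lambda>i. i"] by (simp add: rkm_def size_multiset_sum o_def)

text \<open>Coefficient arrays are functions on all integer vectors, so that shifted indices always
  make sense; this predicate marks those of genuine power series.\<close>

definition vanishes_neg :: "nat \<Rightarrow> ((nat \<Rightarrow> int) \<Rightarrow> complex) \<Rightarrow> bool" where
  "vanishes_neg d g \<longleftrightarrow> (\<forall>K i. i < d \<longrightarrow> K i < 0 \<longrightarrow> g K = 0)"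

lemma vanishes_negD: "vanishes_neg d g \<Longrightarrow> i < d \<Longrightarrow> K i < 0 \<Longrightarrow> g K = 0"
  by (auto simp: vanishes_neg_def)

text \<open>Multiplication by a monomial, in terms of coefficients. A summand in which
  \<open>R\<close> is not contained in \<open>Y\<close> has a negative index below \<open>d\<close>
  and vanishes.\<close>

lemma sum_MI_shift:
  assumes g: "vanishes_neg d g" and R: "set_mset R \<subseteq> {..<d}"
  shows "(\<Sum>Y\<in>MI d z. g (\<lambda>i. cnt Y i - cnt R i) * w Y) = (\<Sum>X\<in>MI d (z - int (size R)). g (cnt X) * w (X + R))"
proof -
  have "(\<Sum>Y\<in>MI d z. g (\<lambda>i. cnt Y i - cnt R i) * w Y) =
        (\<Sum>Y\<in>{Y \<in> MI d z. R \<subseteq># Y}. g (\<lambda>i. cnt Y i - cnt R i) * w Y)"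
  proof (rule sum.mono_neutral_right)
    show "\<forall>Y\<in>MI d z - {Y \<in> MI d z. R \<subseteq># Y}. g (\<lambda>i. cnt Y i - cnt R i) * w Y = 0"
    proof
      fix Y assume "Y \<in> MI d z - {Y \<in> MI d z. R \<subseteq># Y}"
      then obtain i where i: "count Y i < count R i"
        by (auto simp: subseteq_mset_def not_le)
      hence "i < d" using R by (metis count_greater_zero_iff lessThan_iff less_nat_zero_code linorder_neqE_nat subsetD)
      with i have "g (\<lambda>i. cnt Y i - cnt R i) = 0"
        by (intro vanishes_negD[OF g, of i]) auto
      thus "g (\<lambda>i. cnt Y i - cnt R i) * w Y = 0" by simp
    qed
  qed auto
  also have "\<dots> = (\<Sum>X\<in>MI d (z - int (size R)). g (cnt X) * w (X + R))"
  proof (rule sum.reindex_bij_witness[of _ "\<lambda>X. X + R" "\<lambda>Y. Y - R"])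
    fix Y assume Y: "Y \<in> {Y \<in> MI d z. R \<subseteq># Y}"
    hence "(\<lambda>i. cnt Y i - cnt R i) = cnt (Y - R)"
      by (auto simp: fun_eq_iff of_nat_diff mset_subset_eq_count)
    with Y show "g (cnt (Y - R)) * w (Y - R + R) = g (\<lambda>i. cnt Y i - cnt R i) * w Y"
      by simp
    show "Y - R \<in> MI d (z - int (size R))"
      using Y by (auto simp: MI_def size_Diff_submset of_nat_diff size_mset_mono dest: in_diffD)
  qed (use R in \<open>auto simp: MI_def\<close>)
  finally show ?thesis .
qed

text \<open>The homogeneous part of degree \<open>z\<close> of the series with coefficients
  \<open>u\<close>, evaluated at \<open>t\<close>. Working degree by degree keeps all sums
  finite.\<close>

definition ev :: "nat \<Rightarrow> (nat \<Rightarrow> complex) \<Rightarrow> ((nat \<Rightarrow> int) \<Rightarrow> complex) \<Rightarrow> int \<Rightarrow> complex" where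
  "ev d t u z = (\<Sum>X\<in>MI d z. u (cnt X) * (\<Prod>i<d. t i ^ count X i))"

lemma ev_diff: "ev d t (\<lambda>K. u K - v K) z = ev d t u z - ev d t v z"
  by (simp add: ev_def algebra_simps sum_subtractf)

lemma ev_sum: "ev d t (\<lambda>K. \<Sum>i\<in>A. u i K) z = (\<Sum>i\<in>A. ev d t (u i) z)"
  unfolding ev_def sum_distrib_right by (rule sum.swap)

lemma ev_shift:
  assumes "vanishes_neg d u" "i < d"
  shows "ev d t (\<lambda>K. u (K(i := K i - 1))) z = t i * ev d t u (z - 1)"
proof -
  have "ev d t (\<lambda>K. u (K(i := K i - 1))) z = (\<Sum>Y\<in>MI d z. u (\<lambda>s. cnt Y s - cnt {#i#} s) * (\<Prod>i<d. t i ^ count Y i))"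
    unfolding ev_def by (intro sum.cong refl arg_cong2[of _ _ _ _ "(*)"] arg_cong[of _ _ u]) auto
  also have "\<dots> = (\<Sum>X\<in>MI d (z - 1). u (cnt X) * (\<Prod>s<d. t s ^ count (X + {#i#}) s))"
    using assms by (subst sum_MI_shift) auto
  also have "\<dots> = t i * ev d t u (z - 1)"
    using assms(2) unfolding ev_def sum_distrib_left
    by (intro sum.cong refl) (auto simp: prod.remove[of _ i] mult_ac)
  finally show ?thesis .
qed

text \<open>Convolution of coefficients is multiplication of series. The weights
  \<open>c \<sigma> = 1\<close> produce the factor \<open>vand d t\<close>, the weights
  \<open>c \<sigma> = \<sigma> i\<close> the factor \<open>dvand d i t\<close>.\<close>

lemma ev_alt:
  assumes "vanishes_neg d u"
  shows "ev d t (\<lambda>l. alt d (\<lambda>\<sigma>. c \<sigma> * u (\<lambda>i. l i - rk d \<sigma> i))) z =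
         alt d (\<lambda>\<sigma>. c \<sigma> * (\<Prod>i<d. t i ^ \<sigma> i)) * ev d t u (z - int (\<Sum>i<d. i))"
proof -
  have "ev d t (\<lambda>l. alt d (\<lambda>\<sigma>. c \<sigma> * u (\<lambda>i. l i - rk d \<sigma> i))) z =
        alt d (\<lambda>\<sigma>. c \<sigma> * (\<Sum>Y\<in>MI d z. u (\<lambda>i. cnt Y i - rk d \<sigma> i) * (\<Prod>i<d. t i ^ count Y i)))"
    by (simp only: ev_def alt_mult_right[symmetric] alt_sum[symmetric] sum_distrib_left mult.assoc)
  also have "\<dots> = alt d (\<lambda>\<sigma>. (c \<sigma> * (\<Prod>i<d. t i ^ \<sigma> i)) * ev d t u (z - int (\<Sum>i<d. i)))"
  proof (rule alt_cong)
    fix \<sigma> assume s: "\<sigma> permutes {..<d}"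
    have "(\<Sum>Y\<in>MI d z. u (\<lambda>i. cnt Y i - rk d \<sigma> i) * (\<Prod>i<d. t i ^ count Y i)) =
          (\<Sum>X\<in>MI d (z - int (\<Sum>i<d. i)). u (cnt X) * (\<Prod>i<d. t i ^ count (X + rkm d \<sigma>) i))"
      unfolding cnt_rkm[symmetric] size_rkm[OF s, symmetric] by (rule sum_MI_shift[OF assms set_rkm])
    also have "\<dots> = (\<Prod>i<d. t i ^ \<sigma> i) * ev d t u (z - int (\<Sum>i<d. i))"
      unfolding ev_def sum_distrib_left
      by (intro sum.cong refl) (simp add: count_rkm power_add prod.distrib mult_ac)
    finally show "c \<sigma> * (\<Sum>Y\<in>MI d z. u (\<lambda>i. cnt Y i - rk d \<sigma> i) * (\<Prod>i<d. t i ^ count Y i)) =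
      (c \<sigma> * (\<Prod>i<d. t i ^ \<sigma> i)) * ev d t u (z - int (\<Sum>i<d. i))" by simp
  qed
  finally show ?thesis by (simp add: alt_mult_right)
qed

text \<open>The eigenvalue on \<open>t^l\<close> of \<open>\<Sum>i. D_i^2 + (q - d + 1) D_i\<close>.
  Up to a constant, this is the operator that arises when the sum of Muirhead's equations is
  multiplied by the Vandermonde determinant.\<close>

definition eig :: "nat \<Rightarrow> nat \<Rightarrow> (nat \<Rightarrow> int) \<Rightarrow> int" where
  "eig d q l = (\<Sum>i<d. l i * l i + (int q - int d + 1) * l i)"

lemma eig_rk: 
  assumes "\<sigma> permutes {..<d}"
  shows "eig d q (rk d \<sigma>) = eig d q (rk d id)"
proof -
  let ?h = "\<lambda>n. int n * int n + (int q - int d + 1) * int n"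
  have "eig d q (rk d \<sigma>) = (\<Sum>i<d. ?h (\<sigma> i))"
    unfolding eig_def by (intro sum.cong) (auto simp: rk_def)
  also have "\<dots> = (\<Sum>i<d. ?h i)"
    using sum.permute[OF assms, of ?h] by (simp add: o_def)
  also have "\<dots> = eig d q (rk d id)"
    unfolding eig_def by (intro sum.cong) (auto simp: rk_def)
  finally show ?thesis .
qed

text \<open>If \<open>A\<close> is the set of entries of \<open>l\<close>, then replacing an element of \<open>{..<d} - A\<close> by one of
  \<open>A - {..<d}\<close> increases the eigenvalue.\<close>
lemma eig_eq_imp_image:
  assumes inj: "inj_on l {..<d}" and eq: "eig d q (\<lambda>i. int (l i)) = eig d q (rk d id)"
  shows "l ` {..<d} = {..<d}"
proof -
  define h where "h = (\<lambda>n. int n * int n + (int q - int d + 1) * int n)"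
  define A where "A = l ` {..<d}"
  have fin: "finite A" and card: "card A = d"
    unfolding A_def using card_image[OF inj] by auto
  have "sum h A = eig d q (\<lambda>i. int (l i))"
    unfolding A_def eig_def h_def by (simp add: sum.reindex[OF inj])
  also have "\<dots> = sum h {..<d}"
    unfolding eq by (auto simp: eig_def h_def rk_def intro!: sum.cong)
  finally have sums: "sum h (A - {..<d}) = sum h ({..<d} - A)"
    using sum.Int_Diff[of A h "{..<d}"] sum.Int_Diff[of "{..<d}" h A] fin by (simp add: Int_commute)
  have cards: "card (A - {..<d}) = card ({..<d} - A)"
    using card card_Diff_subset_Int[of A "{..<d}"] card_Diff_subset_Int[of "{..<d}" A] fin by (simp add: Int_commute)
  \<comment> \<open>Write \<open>h n = n (n - d + 1) + q n\<close>. The first summand is at least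
    \<open>d\<close> for \<open>n \<ge> d\<close> and at most 0 for \<open>n < d\<close>, so every
    exchanged element gains at least \<open>d\<close>.\<close>
  have big: "h n \<ge> int d + int q * int d" if "n \<in> A - {..<d}" for n
  proof -
    have "int n * (int n - int d + 1) \<ge> int d * 1" using that by (intro mult_mono) auto
    moreover have "int q * int n \<ge> int q * int d" using that by (intro mult_left_mono) auto
    ultimately show ?thesis by (simp add: h_def algebra_simps)
  qed
  have small: "h n \<le> int q * int d" if "n \<in> {..<d} - A" for n
  proof -
    have "int n * (int d - int n - 1) \<ge> 0" using that by (intro mult_nonneg_nonneg) auto
    moreover have "int q * int n \<le> int q * int d" using that by (intro mult_left_mono) auto
    ultimately show ?thesis by (simp add: h_def algebra_simps)
  qed
  have "int (card (A - {..<d})) * (int d + int q * int d) \<le> sum h (A - {..<d})"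
    using sum_bounded_below[of "A - {..<d}" "int d + int q * int d" h] big by simp
  also have "\<dots> \<le> int (card ({..<d} - A)) * (int q * int d)"
    unfolding sums using sum_bounded_above[of "{..<d} - A" h "int q * int d"] small by simp
  finally have "int (card (A - {..<d})) * int d \<le> 0"
    by (simp add: cards algebra_simps)
  hence "card (A - {..<d}) = 0 \<or> d = 0" by (auto simp: mult_le_0_iff)
  hence "A \<subseteq> {..<d}" using fin card by auto
  thus ?thesis using card_subset_eq[of "{..<d}" A] card by (simp add: A_def)
qed

text \<open>Induction on the degree. Antisymmetry disposes of exponent vectors with a repeated entry
  and reduces permutations of \<open>0, ..., d - 1\<close> to \<open>init\<close>. For all others
  the eigenvalue factor is nonzero while the left side of \<open>rec\<close> has lower
  degree.\<close>

lemma antisym_recurrence_zero: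
  fixes g :: "(nat \<Rightarrow> int) \<Rightarrow> complex"
  assumes neg: "vanishes_neg d g"
    and anti: "\<And>\<pi> l. \<pi> permutes {..<d} \<Longrightarrow> g (l \<circ> \<pi>) = of_int (sign \<pi>) * g l"
    and rec: "\<And>Y. set_mset Y \<subseteq> {..<d} \<Longrightarrow>
      (\<Sum>i<d. g ((cnt Y)(i := cnt Y i - 1))) = of_int (eig d q (cnt Y) - eig d q (rk d id)) * g (cnt Y)"
    and init: "g (rk d id) = 0"
    and Y: "set_mset Y \<subseteq> {..<d}"
  shows "g (cnt Y) = 0"
  using Y
proof (induction "size Y" arbitrary: Y rule: less_induct)
  case less
  consider "\<not> inj_on (count Y) {..<d}" | "inj_on (count Y) {..<d}" "count Y ` {..<d} = {..<d}"
    | "inj_on (count Y) {..<d}" "count Y ` {..<d} \<noteq> {..<d}" by blast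
  thus ?case
  proof cases
    case 1
    then obtain i j where ij: "i < d" "j < d" "i \<noteq> j" "count Y i = count Y j"
      by (auto simp: inj_on_def)
    let ?\<tau> = "Transposition.transpose i j"
    have "cnt Y \<circ> ?\<tau> = cnt Y" using ij by (auto simp: Transposition.transpose_def)
    moreover have "?\<tau> permutes {..<d}" using ij by (intro permutes_swap_id) auto
    ultimately have "g (cnt Y) = - g (cnt Y)"
      using anti[of ?\<tau> "cnt Y"] ij by (simp add: sign_swap_id)
    thus ?thesis by simp
  next
    case 2
    define \<pi> where "\<pi> = (\<lambda>i. if i < d then count Y i else i)"
    have "bij_betw \<pi> {..<d} {..<d}"
      using 2 by (auto simp: bij_betw_def \<pi>_def inj_on_def)
    hence \<pi>: "\<pi> permutes {..<d}"
      by (rule bij_imp_permutes) (simp add: \<pi>_def)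
    have "cnt Y = rk d id \<circ> \<pi>"
    proof
      fix i show "cnt Y i = (rk d id \<circ> \<pi>) i"
      proof (cases "i < d")
        case True
        with \<pi> have "\<pi> i < d" by (simp add: permutes_less_nat)
        with True show ?thesis by (simp add: rk_def \<pi>_def)
      next
        case False
        hence "i \<notin># Y" using less.prems by auto
        with False show ?thesis by (simp add: rk_def \<pi>_def not_in_iff)
      qed
    qed
    with anti[OF \<pi>] init show ?thesis by simp
  next
    case 3
    have "g ((cnt Y)(i := cnt Y i - 1)) = 0" if "i < d" for i
    proof (cases "i \<in># Y")
      case True
      have "(cnt Y)(i := cnt Y i - 1) = cnt (Y - {#i#})"
        using True by (auto simp: fun_eq_iff of_nat_diff Suc_le_eq)
      moreover have "g (cnt (Y - {#i#})) = 0"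
        using True less.prems by (intro less.hyps) (auto simp: size_Diff1_less dest: in_diffD)
      ultimately show ?thesis by simp
    next
      case False
      thus ?thesis using that by (intro vanishes_negD[OF neg, of i]) (auto simp: not_in_iff)
    qed
    hence "of_int (eig d q (cnt Y) - eig d q (rk d id)) * g (cnt Y) = 0"
      using rec[OF less.prems] by simp
    moreover have "eig d q (cnt Y) \<noteq> eig d q (rk d id)"
      using eig_eq_imp_image[of "count Y" d q] 3 by auto
    ultimately show ?thesis by simp
  qed
qed

text \<open>The coefficient of \<open>t^l\<close> in the determinant of the series
  \<open>h_(q-j)(t_i)\<close>.\<close>

definition FS :: "nat \<Rightarrow> nat \<Rightarrow> (nat \<Rightarrow> int) \<Rightarrow> complex" where
  "FS d q l = alt d (\<lambda>\<sigma>. \<Prod>i<d. rfact (l i) * rfact (l i + int q - int (\<sigma> i)))"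

lemma FS_neg: "vanishes_neg d (FS d q)"
  unfolding vanishes_neg_def FS_def
proof (intro allI impI)
  fix K :: "nat \<Rightarrow> int" and i assume i: "i < d" "K i < 0"
  have "(\<Prod>i<d. rfact (K i) * rfact (K i + int q - int (\<sigma> i))) = 0" for \<sigma>
    using i by (intro prod_zero bexI[of _ i]) auto
  thus "alt d (\<lambda>\<sigma>. \<Prod>i<d. rfact (K i) * rfact (K i + int q - int (\<sigma> i))) = 0"
    by (simp only: alt_def mult_zero_right sum.neutral_const)
qed

lemma FS_antisym:
  assumes "\<pi> permutes {..<d}"
  shows "FS d q (l \<circ> \<pi>) = of_int (sign \<pi>) * FS d q l"
proof -
  let ?f = "\<lambda>\<sigma> i. rfact (l i) * rfact (l i + int q - int (\<sigma> i))"
  have "FS d q (l \<circ> \<pi>) = alt d (\<lambda>\<sigma>. \<Prod>i<d. ?f (\<sigma> \<circ> inv_into UNIV \<pi>) i)"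
    unfolding FS_def
  proof (rule alt_cong)
    fix \<sigma>
    have "(\<Prod>i<d. ?f (\<sigma> \<circ> inv_into UNIV \<pi>) i) = (\<Prod>i<d. ?f (\<sigma> \<circ> inv_into UNIV \<pi>) (\<pi> i))"
      using prod.permute[OF assms, of "?f (\<sigma> \<circ> inv_into UNIV \<pi>)"] by (simp only: o_def)
    also have "\<dots> = (\<Prod>i<d. rfact ((l \<circ> \<pi>) i) * rfact ((l \<circ> \<pi>) i + int q - int (\<sigma> i)))"
      using permutes_inverses(2)[OF assms] by simp
    finally show "(\<Prod>i<d. rfact ((l \<circ> \<pi>) i) * rfact ((l \<circ> \<pi>) i + int q - int (\<sigma> i))) = (\<Prod>i<d. ?f (\<sigma> \<circ> inv_into UNIV \<pi>) i)" ..
  qed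
  also have "\<dots> = of_int (sign (inv_into UNIV \<pi>)) * FS d q l"
    unfolding FS_def by (rule alt_compose_right[OF permutes_inv[OF assms]])
  finally show ?thesis
    by (simp add: sign_inverse permutes_imp_permutation[OF finite_lessThan assms])
qed

text \<open>Comparison with the corresponding coefficient 1 of \<open>V \<Phi>\<close> fixes the
  constant in \<open>F_eq_FS\<close>.\<close>

lemma FS_rk_id: "FS d q (rk d id) = (\<Prod>i<d. 1 / fact (q + i))"
proof -
  have "FS d q (rk d id) = alt d (\<lambda>\<sigma>. (\<Prod>i<d. 1 / fact i) * (\<Prod>i<d. rfact (int q + int i - int (\<sigma> i))))"
    unfolding FS_def by (intro alt_cong) (simp add: rk_def prod.distrib[symmetric] add.commute)
  also have "\<dots> = (\<Prod>i<d. 1 / fact i) * (\<Prod>i<d. fact i / fact (q + i))"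
    by (simp only: alt_mult alt_rfact)
  also have "\<dots> = (\<Prod>i<d. 1 / fact (q + i))"
    unfolding prod.distrib[symmetric] by (intro prod.cong) auto
  finally show ?thesis .
qed

text \<open>Lowering \<open>l i\<close> multiplies the term of \<open>\<sigma>\<close> by
  \<open>l i * (l i + q - \<sigma> i)\<close>. Summed over \<open>i\<close>, these factors give the
  difference of eigenvalues plus the sum of
  \<open>(d - 1 - \<sigma> i) * (l i + q - \<sigma> i)\<close>. The second factor there amounts to
  raising \<open>\<sigma> i\<close> by one, and the alternating sum of these raised terms is
  zero.\<close>

lemma FS_rec:
  "(\<Sum>i<d. FS d q (l(i := l i - 1))) = of_int (eig d q l - eig d q (rk d id)) * FS d q l"
proof -
  \<comment> \<open>The argument \<open>v\<close> is an arbitrary integer function because raising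
    one value of a permutation leaves the permutations.\<close>
  define a where "a = (\<lambda>v. \<Prod>i<d. rfact (l i) * rfact (l i + int q - v i))"
  have FS: "FS d q l = alt d (\<lambda>\<sigma>. a (\<lambda>i. int (\<sigma> i)))" by (simp add: FS_def a_def)
  have prod_upd: "(\<Prod>s<d. F s) = F i * (\<Prod>s\<in>{..<d}-{i}. F s)" if "i < d" for F :: "nat \<Rightarrow> complex" and i
    using that by (subst prod.remove[of _ i]) auto
  have a_upd: "a (v(i := v i + 1)) = of_int (l i + int q - v i) * a v" if "i < d" for v i
  proof -
    have "(\<Prod>s\<in>{..<d}-{i}. rfact (l s) * rfact (l s + int q - (v(i := v i + 1)) s)) =
          (\<Prod>s\<in>{..<d}-{i}. rfact (l s) * rfact (l s + int q - v s))"
      by (intro prod.cong) auto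
    moreover have "rfact (l i + int q - (v(i := v i + 1)) i) = of_int (l i + int q - v i) * rfact (l i + int q - v i)"
      by (subst rfact_rec) (simp add: algebra_simps)
    ultimately show ?thesis
      unfolding a_def prod_upd[OF that] by (simp only: mult_ac)
  qed
  have l_upd: "FS d q (l(i := l i - 1)) = alt d (\<lambda>\<sigma>. of_int (l i * (l i + int q - int (\<sigma> i))) * a (\<lambda>i. int (\<sigma> i)))"
    if "i < d" for i
    unfolding FS_def
  proof (rule alt_cong)
    fix \<sigma>
    have "(\<Prod>s\<in>{..<d}-{i}. rfact ((l(i := l i - 1)) s) * rfact ((l(i := l i - 1)) s + int q - int (\<sigma> s))) =
          (\<Prod>s\<in>{..<d}-{i}. rfact (l s) * rfact (l s + int q - int (\<sigma> s)))"
      by (intro prod.cong) auto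
    moreover have "rfact ((l(i := l i - 1)) i) = of_int (l i) * rfact (l i)"
      "rfact ((l(i := l i - 1)) i + int q - int (\<sigma> i)) = of_int (l i + int q - int (\<sigma> i)) * rfact (l i + int q - int (\<sigma> i))"
      by (simp_all only: rfact_rec) (simp_all add: algebra_simps)
    ultimately show "(\<Prod>s<d. rfact ((l(i := l i - 1)) s) * rfact ((l(i := l i - 1)) s + int q - int (\<sigma> s))) =
      of_int (l i * (l i + int q - int (\<sigma> i))) * a (\<lambda>i. int (\<sigma> i))"
      unfolding a_def prod_upd[OF that] by (simp only: of_int_mult mult_ac)
  qed
  \<comment> \<open>Raising the value \<open>j < d - 1\<close> of \<open>\<sigma>\<close> by one makes it collide with the value \<open>j + 1\<close>.\<close>
  have collide: "alt d (\<lambda>\<sigma>. \<Sum>i<d. of_int (int d - 1 - int (\<sigma> i)) * a ((\<lambda>i. int (\<sigma> i))(i := int (\<sigma> i) + 1))) = 0"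
  proof -
    \<comment> \<open>Indexed by the value that is raised instead of its position, the modified term
      is visibly invariant under exchange of the values \<open>j\<close> and
      \<open>j + 1\<close>.\<close>
    define u where "u = (\<lambda>j (\<sigma> :: nat \<Rightarrow> nat) s. if \<sigma> s = j then int j + 1 else int (\<sigma> s))"
    have "alt d (\<lambda>\<sigma>. \<Sum>i<d. of_int (int d - 1 - int (\<sigma> i)) * a ((\<lambda>i. int (\<sigma> i))(i := int (\<sigma> i) + 1))) =
          alt d (\<lambda>\<sigma>. \<Sum>j<d. of_int (int d - 1 - int j) * a (u j \<sigma>))"
    proof (rule alt_cong)
      fix \<sigma> assume s: "\<sigma> permutes {..<d}"
      have "(\<Sum>j<d. of_int (int d - 1 - int j) * a (u j \<sigma>)) =
            (\<Sum>i<d. of_int (int d - 1 - int (\<sigma> i)) * a (u (\<sigma> i) \<sigma>))"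
        using sum.permute[OF s, of "\<lambda>j. of_int (int d - 1 - int j) * a (u j \<sigma>)"] by (simp only: o_def)
      moreover have "u (\<sigma> i) \<sigma> = (\<lambda>i. int (\<sigma> i))(i := int (\<sigma> i) + 1)" for i
        using permutes_inj[OF s] by (auto simp: u_def fun_eq_iff inj_def)
      ultimately show "(\<Sum>i<d. of_int (int d - 1 - int (\<sigma> i)) * a ((\<lambda>i. int (\<sigma> i))(i := int (\<sigma> i) + 1))) =
            (\<Sum>j<d. of_int (int d - 1 - int j) * a (u j \<sigma>))" by simp
    qed
    also have "\<dots> = (\<Sum>j<d. of_int (int d - 1 - int j) * alt d (\<lambda>\<sigma>. a (u j \<sigma>)))"
      by (simp only: alt_sum alt_mult)
    also have "\<dots> = 0"
    proof (rule sum.neutral, rule ballI)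
      fix j assume j: "j \<in> {..<d}"
      show "of_int (int d - 1 - int j) * alt d (\<lambda>\<sigma>. a (u j \<sigma>)) = 0"
      proof (cases "j + 1 < d")
        case True
        have "alt d (\<lambda>\<sigma>. a (u j \<sigma>)) = 0"
        proof (rule alt_eq_0_left[of j d "j + 1"])
          fix \<sigma> :: "nat \<Rightarrow> nat"
          have "u j (Transposition.transpose j (j + 1) \<circ> \<sigma>) = u j \<sigma>"
            by (auto simp: u_def fun_eq_iff Transposition.transpose_def)
          thus "a (u j (Transposition.transpose j (j + 1) \<circ> \<sigma>)) = a (u j \<sigma>)" by simp
        qed (use True in auto)
        thus ?thesis by simp
      next
        case False
        with j have "j = d - 1" "d > 0" by auto
        thus ?thesis by simp
      qed
    qed
    finally show ?thesis .
  qed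
  have "(\<Sum>i<d. FS d q (l(i := l i - 1))) =
        alt d (\<lambda>\<sigma>. \<Sum>i<d. of_int (l i * (l i + int q - int (\<sigma> i))) * a (\<lambda>i. int (\<sigma> i)))"
    by (simp add: l_upd alt_sum)
  also have "\<dots> = alt d (\<lambda>\<sigma>. of_int (eig d q l - eig d q (rk d id)) * a (\<lambda>i. int (\<sigma> i)) +
      (\<Sum>i<d. of_int (int d - 1 - int (\<sigma> i)) * a ((\<lambda>i. int (\<sigma> i))(i := int (\<sigma> i) + 1))))"
  proof (rule alt_cong)
    fix \<sigma> assume s: "\<sigma> permutes {..<d}"
    have "(\<Sum>i<d. of_int (l i * (l i + int q - int (\<sigma> i))) * a (\<lambda>i. int (\<sigma> i))) =
      of_int (\<Sum>i<d. l i * (l i + int q - int (\<sigma> i))) * a (\<lambda>i. int (\<sigma> i))"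
      by (simp add: sum_distrib_right)
    also have "(\<Sum>i<d. l i * (l i + int q - int (\<sigma> i))) =
      eig d q l - eig d q (rk d \<sigma>) + (\<Sum>i<d. (int d - 1 - int (\<sigma> i)) * (l i + int q - int (\<sigma> i)))
      - int q * (\<Sum>i<d. int d - 1 - 2 * int (\<sigma> i))"
      unfolding eig_def sum_distrib_left sum.distrib[symmetric] sum_subtractf[symmetric]
      by (intro sum.cong) (auto simp: rk_def algebra_simps)
    \<comment> \<open>The values of a permutation of \<open>0, ..., d - 1\<close> have mean
      \<open>(d - 1) / 2\<close>.\<close>
    also have "(\<Sum>i<d. int d - 1 - 2 * int (\<sigma> i)) = 0"
    proof -
      have "(\<Sum>i<d. int d - 1 - 2 * int (\<sigma> i)) = (\<Sum>i<d. int d - 1 - 2 * int i)"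
        using sum.permute[OF s, of "\<lambda>j. int d - 1 - 2 * int j"] by (simp add: o_def)
      also have "\<dots> = 0" by (induction d) (auto simp: sum.distrib algebra_simps sum_subtractf sum_distrib_left[symmetric])
      finally show ?thesis .
    qed
    moreover have "(\<Sum>i<d. of_int (int d - 1 - int (\<sigma> i)) * a ((\<lambda>i. int (\<sigma> i))(i := int (\<sigma> i) + 1))) =
        of_int (\<Sum>i<d. (int d - 1 - int (\<sigma> i)) * (l i + int q - int (\<sigma> i))) * a (\<lambda>i. int (\<sigma> i))"
      unfolding of_int_sum sum_distrib_right
    proof (intro sum.cong refl)
      fix i assume "i \<in> {..<d}"
      thus "of_int (int d - 1 - int (\<sigma> i)) * a ((\<lambda>i. int (\<sigma> i))(i := int (\<sigma> i) + 1)) =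
        of_int ((int d - 1 - int (\<sigma> i)) * (l i + int q - int (\<sigma> i))) * a (\<lambda>i. int (\<sigma> i))"
        using a_upd[of i "\<lambda>i. int (\<sigma> i)"] by simp
    qed
    ultimately show "(\<Sum>i<d. of_int (l i * (l i + int q - int (\<sigma> i))) * a (\<lambda>i. int (\<sigma> i))) =
      of_int (eig d q l - eig d q (rk d id)) * a (\<lambda>i. int (\<sigma> i)) +
      (\<Sum>i<d. of_int (int d - 1 - int (\<sigma> i)) * a ((\<lambda>i. int (\<sigma> i))(i := int (\<sigma> i) + 1)))"
      by (simp only: eig_rk[OF s] distrib_right of_int_add of_int_diff mult_zero_right diff_zero)
  qed
  also have "\<dots> = of_int (eig d q l - eig d q (rk d id)) * FS d q l"
    by (simp only: alt_add alt_mult collide FS add_0_right)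
  finally show ?thesis .
qed

text \<open>\<open>\<phi> K\<close> is the coefficient of \<open>t\<^sup>K\<close> in a formal power series \<open>\<Phi>\<close>, and \<open>P i j\<close> are the coefficients of
  \<open>(D\<^sub>i \<Phi> - D\<^sub>j \<Phi>) / (t\<^sub>i - t\<^sub>j)\<close> for \<open>D\<^sub>i = t\<^sub>i \<partial>\<^sub>i\<close>. The last assumption is Muirhead's system
  \<open>D\<^sub>i\<^sup>2 \<Phi> + q D\<^sub>i \<Phi> + (\<Sum>j\<noteq>i. t\<^sub>i (D\<^sub>i \<Phi> - D\<^sub>j \<Phi>) / (t\<^sub>i - t\<^sub>j)) = t\<^sub>i \<Phi>\<close> for the Bessel function of
  a matrix with eigenvalues \<open>t\<^sub>i\<close>.\<close>
locale muirhead_system =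
  fixes d q :: nat and \<phi> :: "(nat \<Rightarrow> int) \<Rightarrow> complex" and P :: "nat \<Rightarrow> nat \<Rightarrow> (nat \<Rightarrow> int) \<Rightarrow> complex"
  assumes \<phi>_neg: "vanishes_neg d \<phi>"
    and P_neg: "i < d \<Longrightarrow> j < d \<Longrightarrow> vanishes_neg d (P i j)"
    and \<phi>_sym: "\<pi> permutes {..<d} \<Longrightarrow> \<phi> (K \<circ> \<pi>) = \<phi> K"
    and \<phi>_0: "\<phi> (\<lambda>_. 0) = 1"
    and P_diff: "i < d \<Longrightarrow> j < d \<Longrightarrow> i \<noteq> j \<Longrightarrow>
      P i j (K(i := K i - 1)) - P i j (K(j := K j - 1)) = of_int (K i - K j) * \<phi> K"
    and \<phi>_rec: "i < d \<Longrightarrow> \<phi> (K(i := K i - 1)) =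
      of_int (K i * K i + int q * K i) * \<phi> K + (\<Sum>j\<in>{..<d}-{i}. P i j (K(i := K i - 1)))"
begin

text \<open>The coefficient of \<open>t^l\<close> in the product of the Vandermonde determinant and
  \<open>\<Phi>\<close>.\<close>

definition F :: "(nat \<Rightarrow> int) \<Rightarrow> complex" where
  "F l = alt d (\<lambda>\<sigma>. \<phi> (\<lambda>i. l i - rk d \<sigma> i))"

lemma F_neg: "vanishes_neg d F"
  unfolding vanishes_neg_def F_def
proof (intro allI impI)
  fix K :: "nat \<Rightarrow> int" and i assume i: "i < d" "K i < 0"
  have "\<phi> (\<lambda>i. K i - rk d \<sigma> i) = 0" for \<sigma>
    using i by (intro vanishes_negD[OF \<phi>_neg, of i]) (auto simp: rk_def)
  thus "alt d (\<lambda>\<sigma>. \<phi> (\<lambda>i. K i - rk d \<sigma> i)) = 0"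
    by (simp add: alt_def)
qed

lemma F_antisym:
  assumes "\<pi> permutes {..<d}"
  shows "F (l \<circ> \<pi>) = of_int (sign \<pi>) * F l"
proof -
  have "F (l \<circ> \<pi>) = alt d (\<lambda>\<sigma>. \<phi> (\<lambda>i. l i - rk d (\<sigma> \<circ> inv_into UNIV \<pi>) i))"
    unfolding F_def
  proof (rule alt_cong)
    fix \<sigma>
    have "(\<lambda>i. (l \<circ> \<pi>) i - rk d \<sigma> i) = (\<lambda>i. l i - rk d (\<sigma> \<circ> inv_into UNIV \<pi>) i) \<circ> \<pi>"
      using permutes_inverses(2)[OF assms] permutes_less_nat[OF assms] by (auto simp: rk_def)
    thus "\<phi> (\<lambda>i. (l \<circ> \<pi>) i - rk d \<sigma> i) = \<phi> (\<lambda>i. l i - rk d (\<sigma> \<circ> inv_into UNIV \<pi>) i)"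
      by (simp only: \<phi>_sym[OF assms])
  qed
  also have "\<dots> = of_int (sign (inv_into UNIV \<pi>)) * F l"
    unfolding F_def by (rule alt_compose_right[OF permutes_inv[OF assms]])
  finally show ?thesis
    by (simp add: sign_inverse permutes_imp_permutation[OF finite_lessThan assms])
qed

text \<open>A permutation other than the identity has some \<open>\<sigma> i > i\<close>, which
  makes an index negative; only the constant term of \<open>\<Phi>\<close> remains.\<close>

lemma F_rk_id: "F (rk d id) = 1"
proof -
  have "F (rk d id) = \<phi> (\<lambda>i. rk d id i - rk d id i)"
    unfolding F_def
  proof (rule alt_single)
    fix \<sigma> assume s: "\<sigma> permutes {..<d}" "\<sigma> \<noteq> id"
    then obtain i where "i < d" "i < \<sigma> i"
      using permutes_natset_le[of \<sigma> "{..<d}"] by (meson lessThan_iff not_le)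
    thus "\<phi> (\<lambda>i. rk d id i - rk d \<sigma> i) = 0"
      by (intro vanishes_negD[OF \<phi>_neg, of i]) (auto simp: rk_def)
  qed
  thus ?thesis by (simp add: \<phi>_0)
qed

lemma P_shift_neg:
  assumes "i < d" "j < d"
  shows "vanishes_neg d (\<lambda>K. P i j (K(i := K i - 1)))"
  unfolding vanishes_neg_def
  using vanishes_negD[OF P_neg[OF assms]] by (metis diff_less_eq fun_upd_apply less_add_one less_trans)

lemma \<phi>_mult_neg: "vanishes_neg d (\<lambda>K. c K * \<phi> K)"
  using vanishes_negD[OF \<phi>_neg] by (auto simp: vanishes_neg_def)

text \<open>By \<open>P_diff\<close>, multiplying \<open>P i j\<close> by \<open>t i - t j\<close>
  gives the difference of the Euler derivatives of \<open>\<Phi>\<close>; at distinct points one may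
  divide.\<close>

lemma ev_P:
  assumes t: "inj_on t {..<d}" and ij: "i < d" "j < d" "i \<noteq> j"
  shows "ev d t (P i j) (z - 1) =
    (ev d t (\<lambda>K. of_int (K i) * \<phi> K) z - ev d t (\<lambda>K. of_int (K j) * \<phi> K) z) / (t i - t j)"
proof -
  have "t i * ev d t (P i j) (z - 1) - t j * ev d t (P i j) (z - 1) =
        ev d t (\<lambda>K. P i j (K(i := K i - 1)) - P i j (K(j := K j - 1))) z"
    using ij by (simp add: ev_diff ev_shift[OF P_neg])
  also have "\<dots> = ev d t (\<lambda>K. of_int (K i) * \<phi> K - of_int (K j) * \<phi> K) z"
    by (simp only: P_diff[OF ij] of_int_diff left_diff_distrib)
  finally have "(t i - t j) * ev d t (P i j) (z - 1) =
     ev d t (\<lambda>K. of_int (K i) * \<phi> K) z - ev d t (\<lambda>K. of_int (K j) * \<phi> K) z"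
    by (simp add: ev_diff algebra_simps)
  moreover have "t i \<noteq> t j" using t ij by (auto dest: inj_onD)
  ultimately show ?thesis by (simp add: field_simps)
qed

text \<open>The coefficients of \<open>V (\<Sum>i\<noteq>j. t\<^sub>i P\<^sub>i\<^sub>j) = \<Sum>i. (2 D\<^sub>i V - (d - 1) V) D\<^sub>i \<Phi>\<close> for the Vandermonde determinant
  \<open>V\<close>, which holds since \<open>D\<^sub>i V = V (\<Sum>j\<noteq>i. t\<^sub>i / (t\<^sub>i - t\<^sub>j))\<close>.\<close>
lemma alt_P:
  assumes "set_mset Y \<subseteq> {..<d}"
  shows "alt d (\<lambda>\<sigma>. \<Sum>i<d. \<Sum>j\<in>{..<d}-{i}. P i j ((\<lambda>s. cnt Y s - rk d \<sigma> s)(i := cnt Y i - rk d \<sigma> i - 1))) =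
    alt d (\<lambda>\<sigma>. \<Sum>i<d. of_int ((2 * int (\<sigma> i) - (int d - 1)) * (cnt Y i - rk d \<sigma> i)) * \<phi> (\<lambda>s. cnt Y s - rk d \<sigma> s))"
proof -
  define u where "u = (\<lambda>K. \<Sum>i<d. \<Sum>j\<in>{..<d}-{i}. P i j (K(i := K i - 1)))"
  define v where "v = (\<lambda>i K. of_int (K i) * \<phi> K)"
  \<comment> \<open>\<open>C l\<close> is the coefficient of \<open>t^l\<close> in the difference of
    the two sides. It vanishes once the homogeneous part is zero at all tuples of distinct points,
    and there the quotients are available.\<close>
  define C where "C = (\<lambda>l. alt d (\<lambda>\<sigma>. 1 * u (\<lambda>i. l i - rk d \<sigma> i)) -
    (\<Sum>i<d. alt d (\<lambda>\<sigma>. (2 * of_nat (\<sigma> i) - (of_nat d - 1)) * v i (\<lambda>i. l i - rk d \<sigma> i))))"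
  have u_neg: "vanishes_neg d u"
    using vanishes_negD[OF P_shift_neg] unfolding u_def vanishes_neg_def by (intro allI impI sum.neutral ballI) auto
  have v_neg: "vanishes_neg d (v i)" for i
    unfolding v_def by (rule \<phi>_mult_neg)
  have "C (cnt Y) = 0"
  proof (rule polynomial_identity)
    show "Y \<in> multisets_of_size {..<d} (size Y)" using assms by (simp add: multisets_of_size_def)
    fix t :: "nat \<Rightarrow> complex" assume t: "inj_on t {..<d}"
    \<comment> \<open>The Vandermonde determinant is homogeneous of degree
      \<open>\<Sum>i<d. i\<close>, which leaves \<open>z\<close> for the factor from
      \<open>\<Phi>\<close>.\<close>
    define z where "z = int (size Y) - int (\<Sum>i<d. i)"
    let ?D = "\<lambda>i. ev d t (v i) z"
    have ne: "t i \<noteq> t j" if "i < d" "j < d" "j \<noteq> i" for i j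
      using that t by (auto dest: inj_onD)
    have "ev d t C (int (size Y)) =
      alt d (\<lambda>\<sigma>. 1 * (\<Prod>i<d. t i ^ \<sigma> i)) * ev d t u z -
      (\<Sum>i<d. alt d (\<lambda>\<sigma>. (2 * of_nat (\<sigma> i) - (of_nat d - 1)) * (\<Prod>i<d. t i ^ \<sigma> i)) * ?D i)"
      unfolding C_def by (simp only: ev_diff ev_sum ev_alt[OF u_neg] ev_alt[OF v_neg] z_def)
    also have "alt d (\<lambda>\<sigma>. 1 * (\<Prod>i<d. t i ^ \<sigma> i)) = vand d t" by (simp add: vand_def)
    also have "(\<lambda>i. alt d (\<lambda>\<sigma>. (2 * of_nat (\<sigma> i) - (of_nat d - 1)) * (\<Prod>i<d. t i ^ \<sigma> i))) =
      (\<lambda>i. 2 * dvand d i t - (of_nat d - 1) * vand d t)"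
      by (simp only: left_diff_distrib alt_diff mult.assoc alt_mult vand_def dvand_def)
    also have "ev d t u z = (\<Sum>i<d. \<Sum>j\<in>{..<d}-{i}. t i * ev d t (P i j) (z - 1))"
      unfolding u_def by (simp add: ev_sum ev_shift[OF P_neg])
    also have "\<dots> = (\<Sum>i<d. \<Sum>j\<in>{..<d}-{i}. t i / (t i - t j) * ?D i - t i / (t i - t j) * ?D j)"
      by (intro sum.cong refl) (auto simp: ev_P[OF t] v_def algebra_simps diff_divide_distrib)
    also have "\<dots> = (\<Sum>i<d. \<Sum>j\<in>{..<d}-{i}. t i / (t i - t j) * ?D i) - (\<Sum>i<d. \<Sum>j\<in>{..<d}-{i}. t i / (t i - t j) * ?D j)"
      by (simp add: sum_subtractf)
    \<comment> \<open>Renaming the indices collects the factors of each \<open>?D i\<close>, since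
      \<open>t i / (t i - t j) - t j / (t j - t i) = 2 * t i / (t i - t j) - 1\<close>.\<close>
    also have "(\<Sum>i<d. \<Sum>j\<in>{..<d}-{i}. t i / (t i - t j) * ?D j) = (\<Sum>j<d. \<Sum>i\<in>{..<d}-{j}. t i / (t i - t j) * ?D j)"
    proof -
      have 1: "(\<Sum>i<d. \<Sum>j\<in>{..<d}-{i}. g i j) = (\<Sum>i<d. \<Sum>j<d. if i = j then 0 else g i j)" for g :: "nat \<Rightarrow> nat \<Rightarrow> complex"
        by (intro sum.cong refl sum.mono_neutral_cong_left) auto
      have 2: "(\<Sum>j<d. \<Sum>i\<in>{..<d}-{j}. g i j) = (\<Sum>j<d. \<Sum>i<d. if i = j then 0 else g i j)" for g :: "nat \<Rightarrow> nat \<Rightarrow> complex"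
        by (intro sum.cong refl sum.mono_neutral_cong_left) auto
      show ?thesis by (rule trans[OF 1 trans[OF sum.swap 2[symmetric]]])
    qed
    also have "(\<Sum>i<d. \<Sum>j\<in>{..<d}-{i}. t i / (t i - t j) * ?D i) - \<dots> =
      (\<Sum>i<d. (2 * (\<Sum>j\<in>{..<d}-{i}. t i / (t i - t j)) - (of_nat d - 1)) * ?D i)"
      unfolding sum_subtractf[symmetric]
    proof (rule sum.cong, simp)
      fix i assume "i \<in> {..<d}"
      hence i: "i < d" by simp
      have 1: "of_nat d - 1 = (\<Sum>j\<in>{..<d}-{i}. 1 :: complex)"
        using i by (simp add: of_nat_diff)
      have "2 * (\<Sum>j\<in>{..<d}-{i}. t i / (t i - t j)) - (of_nat d - 1) =
         (\<Sum>j\<in>{..<d}-{i}. 2 * (t i / (t i - t j)) - 1)"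
        by (simp only: 1 sum_distrib_left sum_subtractf)
      also have "\<dots> = (\<Sum>j\<in>{..<d}-{i}. t i / (t i - t j) - t j / (t j - t i))"
      proof (rule sum.cong[OF refl])
        fix j assume "j \<in> {..<d}-{i}"
        with ne[of i j] i have "t i / (t i - t j) - t j / (t i - t j) = 1"
          by (simp flip: diff_divide_distrib)
        moreover have "t j / (t j - t i) = - (t j / (t i - t j))"
          by (metis minus_diff_eq minus_divide_right)
        moreover have "2 * a - 1 = a - c" if "a - b = 1" "c = - b" for a b c :: complex
          unfolding that(2) that(1)[symmetric] by simp
        ultimately show "2 * (t i / (t i - t j)) - 1 = t i / (t i - t j) - t j / (t j - t i)"
          by blast
      qed
      finally have "2 * (\<Sum>j\<in>{..<d}-{i}. t i / (t i - t j)) - (of_nat d - 1) =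
         (\<Sum>j\<in>{..<d}-{i}. t i / (t i - t j) - t j / (t j - t i))" .
      thus "(\<Sum>j\<in>{..<d}-{i}. t i / (t i - t j) * ?D i - t j / (t j - t i) * ?D i) =
         (2 * (\<Sum>j\<in>{..<d}-{i}. t i / (t i - t j)) - (of_nat d - 1)) * ?D i"
        by (simp only: sum_distrib_right[symmetric] left_diff_distrib[symmetric])
    qed
    also have "vand d t * \<dots> = (\<Sum>i<d. (2 * dvand d i t - (of_nat d - 1) * vand d t) * ?D i)"
      by (subst sum_distrib_left, intro sum.cong refl) (simp add: dvand_eq[OF t] algebra_simps)
    finally show "(\<Sum>X\<in>multisets_of_size {..<d} (size Y). C (cnt X) * (\<Prod>i<d. t i ^ count X i)) = 0"
      by (simp add: ev_def MI_of_nat)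
  qed
  thus ?thesis
    unfolding C_def u_def v_def by (simp add: alt_sum mult.assoc)
qed

text \<open>With \<open>K = l - \<sigma>\<close> one has \<open>K^2 + q K + (2 \<sigma> - (d - 1)) K
  = (l^2 + (q - d + 1) l) - (\<sigma>^2 + (q - d + 1) \<sigma>)\<close> in each coordinate, and the
  part with \<open>\<sigma>\<close> has the same sum for all permutations.\<close>

lemma F_rec:
  assumes "set_mset Y \<subseteq> {..<d}"
  shows "(\<Sum>i<d. F ((cnt Y)(i := cnt Y i - 1))) = of_int (eig d q (cnt Y) - eig d q (rk d id)) * F (cnt Y)"
proof -
  let ?K = "\<lambda>\<sigma> s. cnt Y s - rk d \<sigma> s"
  have "(\<Sum>i<d. F ((cnt Y)(i := cnt Y i - 1))) = alt d (\<lambda>\<sigma>. \<Sum>i<d. \<phi> ((?K \<sigma>)(i := ?K \<sigma> i - 1)))"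
    unfolding F_def alt_sum
    by (intro sum.cong refl alt_cong arg_cong[of _ _ \<phi>]) auto
  also have "\<dots> = alt d (\<lambda>\<sigma>. (\<Sum>i<d. of_int (?K \<sigma> i * ?K \<sigma> i + int q * ?K \<sigma> i) * \<phi> (?K \<sigma>)) +
     (\<Sum>i<d. \<Sum>j\<in>{..<d}-{i}. P i j ((?K \<sigma>)(i := ?K \<sigma> i - 1))))"
    unfolding sum.distrib[symmetric] by (intro alt_cong sum.cong refl) (rule \<phi>_rec, simp)
  also have "\<dots> = alt d (\<lambda>\<sigma>. (\<Sum>i<d. of_int (?K \<sigma> i * ?K \<sigma> i + int q * ?K \<sigma> i) * \<phi> (?K \<sigma>)) +
     (\<Sum>i<d. of_int ((2 * int (\<sigma> i) - (int d - 1)) * ?K \<sigma> i) * \<phi> (?K \<sigma>)))"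
    unfolding alt_add using alt_P[OF assms] by simp
  also have "\<dots> = alt d (\<lambda>\<sigma>. of_int (eig d q (cnt Y) - eig d q (rk d id)) * \<phi> (?K \<sigma>))"
  proof (rule alt_cong)
    fix \<sigma> assume s: "\<sigma> permutes {..<d}"
    have "(\<Sum>i<d. ?K \<sigma> i * ?K \<sigma> i + int q * ?K \<sigma> i) + (\<Sum>i<d. (2 * int (\<sigma> i) - (int d - 1)) * ?K \<sigma> i) =
      eig d q (cnt Y) - eig d q (rk d \<sigma>)"
      unfolding eig_def sum.distrib[symmetric] sum_subtractf[symmetric]
      by (intro sum.cong) (auto simp: rk_def algebra_simps)
    thus "(\<Sum>i<d. of_int (?K \<sigma> i * ?K \<sigma> i + int q * ?K \<sigma> i) * \<phi> (?K \<sigma>)) +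
     (\<Sum>i<d. of_int ((2 * int (\<sigma> i) - (int d - 1)) * ?K \<sigma> i) * \<phi> (?K \<sigma>)) =
     of_int (eig d q (cnt Y) - eig d q (rk d id)) * \<phi> (?K \<sigma>)"
      unfolding sum_distrib_right[symmetric] distrib_right[symmetric] of_int_sum[symmetric] of_int_add[symmetric]
      by (simp only: eig_rk[OF s])
  qed
  finally show ?thesis by (simp add: alt_mult F_def)
qed

lemma F_eq_FS:
  assumes "set_mset Y \<subseteq> {..<d}"
  shows "F (cnt Y) = (\<Prod>i<d. fact (q + i)) * FS d q (cnt Y)"
proof -
  define c where "c = (\<Prod>i<d. fact (q + i) :: complex)"
  have "F (cnt Y) - c * FS d q (cnt Y) = 0"
  proof (rule antisym_recurrence_zero[where g = "\<lambda>l. F l - c * FS d q l"])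
    show "vanishes_neg d (\<lambda>l. F l - c * FS d q l)"
      using F_neg FS_neg[of d q] by (simp add: vanishes_neg_def)
    show "F (rk d id) - c * FS d q (rk d id) = 0"
      by (simp add: F_rk_id FS_rk_id c_def flip: prod.distrib)
  qed (use assms in \<open>auto simp: F_antisym FS_antisym F_rec FS_rec sum_subtractf sum_distrib_left[symmetric] algebra_simps\<close>)
  thus ?thesis by (simp add: c_def)
qed

text \<open>At \<open>t = (1, ..., 1)\<close> the determinant \<open>V\<close> vanishes, so
  \<open>\<Phi>\<close> cannot be recovered by division. The weights \<open>w\<close> are the
  coefficient form of applying \<open>\<Prod>i. (1/i!) (d/dt_i)^i\<close> to \<open>V \<Phi>\<close>
  at that point: all derivatives must fall on \<open>V\<close>, which leaves \<open>\<Phi>\<close>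
  itself.\<close>

theorem diagonal_sum:
  "(\<Sum>X\<in>MI d m. \<phi> (cnt X)) = (\<Prod>i<d. fact (q + i) / fact i) *
     alt d (\<lambda>\<sigma>. \<Sum>X\<in>MI d m. \<Prod>i<d. rfact (cnt X i) * rfact (cnt X i + (int q + int i - int (\<sigma> i))))"
proof -
  define w where "w = (\<lambda>Y. \<Prod>i<d. (of_nat (count Y i) :: complex) gchoose i)"
  define \<Delta> where "\<Delta> = int (\<Sum>i<d. i)"
  have "(\<Sum>X\<in>MI d m. \<phi> (cnt X)) = (\<Sum>X\<in>MI d m. \<phi> (cnt X) * alt d (\<lambda>\<sigma>. \<Prod>i<d. (of_nat (count X i) + of_nat (\<sigma> i)) gchoose i))"
    by (simp add: alt_gbinomial)
  also have "\<dots> = alt d (\<lambda>\<sigma>. \<Sum>X\<in>MI d m. \<phi> (cnt X) * w (X + rkm d \<sigma>))"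
    unfolding alt_mult[symmetric] alt_sum[symmetric] w_def
    by (intro alt_cong sum.cong refl arg_cong2[of _ _ _ _ "(*)"] prod.cong) (auto simp: count_rkm)
  also have "\<dots> = alt d (\<lambda>\<sigma>. \<Sum>Y\<in>MI d (m + \<Delta>). \<phi> (\<lambda>i. cnt Y i - rk d \<sigma> i) * w Y)"
    using sum_MI_shift[OF \<phi>_neg set_rkm, where z = "m + \<Delta>"]
    by (intro alt_cong) (simp add: size_rkm \<Delta>_def cnt_rkm[symmetric])
  also have "\<dots> = (\<Sum>Y\<in>MI d (m + \<Delta>). F (cnt Y) * w Y)"
    by (simp only: alt_sum alt_mult_right F_def)
  also have "\<dots> = (\<Sum>Y\<in>MI d (m + \<Delta>). (\<Prod>i<d. fact (q + i)) * (FS d q (cnt Y) * w Y))"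
    by (intro sum.cong refl) (auto simp: MI_def F_eq_FS)
  also have "\<dots> = (\<Prod>i<d. fact (q + i)) * alt d (\<lambda>\<sigma>. \<Sum>Y\<in>MI d (m + \<Delta>).
      (\<Prod>i<d. rfact (cnt Y i) * rfact (cnt Y i + int q - int (\<sigma> i))) * w Y)"
    by (simp only: sum_distrib_left[symmetric] FS_def alt_sum alt_mult_right)
  also have "\<dots> = (\<Prod>i<d. fact (q + i)) * alt d (\<lambda>\<sigma>. (\<Prod>i<d. 1 / fact i) *
    (\<Sum>X\<in>MI d m. \<Prod>i<d. rfact (cnt X i) * rfact (cnt X i + (int q + int i - int (\<sigma> i)))))"
  proof (intro arg_cong2[of _ _ _ _ "(*)"] refl alt_cong)
    fix \<sigma> assume "\<sigma> permutes {..<d}"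
    define g where "g = (\<lambda>K. \<Prod>i<d. rfact (K i) * rfact (K i + (int q + int i - int (\<sigma> i))))"
    have g: "vanishes_neg d g"
      unfolding vanishes_neg_def g_def by (intro allI impI prod_zero) (auto intro!: bexI)
    \<comment> \<open>The weight lowers each exponent \<open>Y_i\<close> by \<open>i\<close>,
      because \<open>(Y_i choose i) / Y_i! = 1 / (i! (Y_i - i)!)\<close>. This turns
      \<open>q - \<sigma> i\<close> into \<open>q + i - \<sigma> i\<close>.\<close>
    have "(\<Prod>i<d. rfact (cnt Y i) * rfact (cnt Y i + int q - int (\<sigma> i))) * w Y =
       (\<Prod>i<d. 1 / fact i) * (g (\<lambda>i. cnt Y i - cnt (rkm d id) i) * 1)" for Y
    proof -
      have "rfact (cnt Y i) * rfact (cnt Y i + int q - int (\<sigma> i)) * (of_nat (count Y i) gchoose i) =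
        1 / fact i * (rfact (cnt Y i - int i) * rfact (cnt Y i + int q - int (\<sigma> i)))" for i
      proof -
        have "rfact (cnt Y i) * rfact (cnt Y i + int q - int (\<sigma> i)) * (of_nat (count Y i) gchoose i) =
          rfact (cnt Y i + int q - int (\<sigma> i)) * ((of_nat (count Y i) gchoose i) * rfact (cnt Y i))"
          by (simp only: mult_ac)
        thus ?thesis unfolding rfact_gbinomial by (simp add: mult_ac)
      qed
      thus ?thesis
        unfolding w_def g_def cnt_rkm mult_1_right prod.distrib[symmetric]
        by (intro prod.cong) (auto simp: rk_def count_rkm algebra_simps)
    qed
    hence "(\<Sum>Y\<in>MI d (m + \<Delta>). (\<Prod>i<d. rfact (cnt Y i) * rfact (cnt Y i + int q - int (\<sigma> i))) * w Y) =
      (\<Prod>i<d. 1 / fact i) * (\<Sum>Y\<in>MI d (m + \<Delta>). g (\<lambda>i. cnt Y i - cnt (rkm d id) i) * 1)"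
      by (simp only: sum_distrib_left)
    also have "\<dots> = (\<Prod>i<d. 1 / fact i) * (\<Sum>X\<in>MI d m. g (cnt X))"
      by (subst sum_MI_shift[OF g set_rkm]) (simp add: size_rkm[OF permutes_id] \<Delta>_def)
    finally show "(\<Sum>Y\<in>MI d (m + \<Delta>). (\<Prod>i<d. rfact (cnt Y i) * rfact (cnt Y i + int q - int (\<sigma> i))) * w Y) =
      (\<Prod>i<d. 1 / fact i) * (\<Sum>X\<in>MI d m. \<Prod>i<d. rfact (cnt X i) * rfact (cnt X i + (int q + int i - int (\<sigma> i))))"
      by (simp only: g_def)
  qed
  finally show ?thesis
    by (simp only: alt_mult mult.assoc[symmetric] prod.distrib[symmetric] mult_1_right times_divide_eq_right)
qed

end

section \<open>Vicious walks\<close>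

notation fps_nth (infixl "$." 75)

section \<open>Formal power series and Bessel functions\<close>

lemma alt_fps_nth: "alt d F $. N = alt d (\<lambda>\<sigma>. F \<sigma> $. N)" for F :: "_ \<Rightarrow> 'a::comm_ring_1 fps"
  by (simp add: alt_def fps_sum_nth)

lemma fps_deriv_prod:
  fixes f :: "'b \<Rightarrow> 'a::comm_ring_1 fps"
  assumes "finite A"
  shows "fps_deriv (\<Prod>i\<in>A. f i) = (\<Sum>i\<in>A. fps_deriv (f i) * (\<Prod>j\<in>A-{i}. f j))"
  using assms
proof (induction A)
  case (insert x A)
  have "(\<Sum>i\<in>A. fps_deriv (f i) * (\<Prod>j\<in>insert x A-{i}. f j)) = f x * (\<Sum>i\<in>A. fps_deriv (f i) * (\<Prod>j\<in>A-{i}. f j))"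
    unfolding sum_distrib_left
  proof (intro sum.cong refl)
    fix i assume "i \<in> A"
    with insert have "insert x A - {i} = insert x (A - {i})" "x \<notin> A - {i}" by auto
    with insert.hyps(1) show "fps_deriv (f i) * (\<Prod>j\<in>insert x A-{i}. f j) = f x * (fps_deriv (f i) * (\<Prod>j\<in>A-{i}. f j))"
      by (simp add: mult_ac)
  qed
  with insert show ?case by (simp add: mult_ac)
qed simp

lemma fps_compose_fps_X_square_nth:
  "(f oo fps_X ^ 2) $. n = (if even n then f $. (n div 2) else 0)" for f :: "'a::comm_ring_1 fps"
proof -
  have "(f oo fps_X ^ 2) $. n = (\<Sum>i = 0..n. if n = 2 * i then f $. i else 0)"
    unfolding fps_compose_nth
    by (intro sum.cong refl) (auto simp: fps_X_power_nth simp flip: power_mult)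
  also have "\<dots> = (if even n then f $. (n div 2) else 0)"
  proof (cases "even n")
    case True
    hence "(\<Sum>i = 0..n. if n = 2 * i then f $. i else 0) = (\<Sum>i\<in>{n div 2}. f $. i)"
      by (intro sum.mono_neutral_cong_right) auto
    with True show ?thesis by simp
  qed (auto intro!: sum.neutral)
  finally show ?thesis .
qed

text \<open>The modified Bessel function \<open>I\<^sub>k(2x)\<close>: the exponential generating function of the walks on the integers
  from the origin to \<open>k\<close>.\<close>
definition bessel :: "int \<Rightarrow> complex fps" where
  "bessel k = Abs_fps (\<lambda>N. if even (int N - k) then rfact ((int N - k) div 2) * rfact ((int N + k) div 2) else 0)"

text \<open>The series \<open>h_k\<close>. Negative \<open>k\<close> occurs when
  \<open>\<sigma> i > q + i\<close>; the coefficients below \<open>-k\<close> are then zero.\<close>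

definition hyp :: "int \<Rightarrow> complex fps" where
  "hyp k = Abs_fps (\<lambda>m. rfact (int m) * rfact (int m + k))"

lemma bessel_minus: "bessel (- k) = bessel k"
  by (simp add: bessel_def fps_eq_iff mult.commute)

lemma bessel_nth_0: "bessel k $. 0 = (if k = 0 then 1 else 0)"
proof (cases k "0::int" rule: linorder_cases)
  case less
  hence "k div 2 < 0" by simp
  thus ?thesis using less by (simp add: bessel_def)
next
  case greater
  hence "- k div 2 < 0" by simp
  thus ?thesis using greater by (simp add: bessel_def)
qed (simp add: bessel_def)

text \<open>The last step of a walk to \<open>k\<close> starts at \<open>k - 1\<close> or
  \<open>k + 1\<close>. On coefficients this is
  \<open>(a + b) / (a! b!) = 1 / ((a - 1)! b!) + 1 / (a! (b - 1)!)\<close>.\<close>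

lemma fps_deriv_bessel: "fps_deriv (bessel k) = bessel (k - 1) + bessel (k + 1)"
proof (rule fps_ext)
  fix N
  show "fps_deriv (bessel k) $. N = (bessel (k - 1) + bessel (k + 1)) $. N"
  proof (cases "even (int N + 1 - k)")
    case True
    \<comment> \<open>\<open>a\<close> and \<open>b = a + k\<close> count the left and right steps
      of a walk of length \<open>N + 1\<close> to \<open>k\<close>; where one of them is negative,
      \<open>rfact\<close> vanishes.\<close>
    then obtain a where a: "int N + 1 - k = 2 * a" by (elim evenE)
    define b where "b = a + k"
    have N: "int N = a + b - 1" and k: "k = b - a" using a by (auto simp: b_def)
    have "fps_deriv (bessel k) $. N = of_int (a + b) * (rfact a * rfact b)"
    proof -
      have "(of_nat (N + 1) :: complex) = of_int (a + b)"
        using N by (metis add.commute diff_add_cancel of_int_of_nat_eq of_nat_1 of_nat_add)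
      moreover have "int (N + 1) - k = 2 * a" "int (N + 1) + k = 2 * b" using N k by auto
      ultimately show ?thesis by (simp only: fps_deriv_nth bessel_def fps_nth_Abs_fps) simp
    qed
    also have "\<dots> = rfact (a - 1) * rfact b + rfact a * rfact (b - 1)"
      unfolding rfact_rec[symmetric] by (simp add: algebra_simps)
    also have "rfact a * rfact (b - 1) = bessel (k - 1) $. N"
    proof -
      have "int N - (k - 1) = 2 * a" "int N + (k - 1) = 2 * (b - 1)" using N k by auto
      thus ?thesis by (simp only: bessel_def fps_nth_Abs_fps) simp
    qed
    also have "rfact (a - 1) * rfact b = bessel (k + 1) $. N"
    proof -
      have "int N - (k + 1) = 2 * (a - 1)" "int N + (k + 1) = 2 * b" using N k by auto
      thus ?thesis by (simp only: bessel_def fps_nth_Abs_fps) simp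
    qed
    finally show ?thesis by simp
  next
    case False
    hence "odd (int (N + 1) - k)" "odd (int N - (k - 1))" "odd (int N - (k + 1))" by auto
    thus ?thesis by (simp only: fps_deriv_nth bessel_def fps_nth_Abs_fps fps_add_nth if_False) simp
  qed
qed

text \<open>The identity \<open>I_k(2x) = x^k h_k(x^2)\<close>, multiplied by \<open>x^n\<close> to
  avoid negative powers of \<open>x\<close>.\<close>

lemma fps_X_power_bessel:
  assumes "int n + k \<ge> 0"
  shows "fps_X ^ n * bessel k = fps_X ^ nat (int n + k) * (hyp k oo fps_X ^ 2)"
proof (rule fps_ext)
  fix N
  show "(fps_X ^ n * bessel k) $. N = (fps_X ^ nat (int n + k) * (hyp k oo fps_X ^ 2)) $. N"
  proof (cases "even (int N - int n - k)")
    case False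
    have "odd (N - nat (int n + k))" if "nat (int n + k) \<le> N"
    proof -
      have "int (N - nat (int n + k)) = int N - int n - k"
        using that assms by (subst of_nat_diff) auto
      with False have "odd (int (N - nat (int n + k)))" by metis
      thus ?thesis by presburger
    qed
    moreover have "odd (int (N - n) - k)" if "n \<le> N"
    proof -
      have "int (N - n) - k = int N - int n - k" using that by (subst of_nat_diff) auto
      with False show ?thesis by metis
    qed
    ultimately show ?thesis
      by (auto simp: fps_X_power_mult_nth fps_compose_fps_X_square_nth bessel_def)
  next
    case True
    then obtain a where a: "int N - int n - k = 2 * a" by (elim evenE)
    have "(fps_X ^ n * bessel k) $. N = rfact a * rfact (a + k)"
    proof (cases "N < n")
      case True
      hence "a < 0 \<or> a + k < 0" using a by linarith
      thus ?thesis using True by (auto simp: fps_X_power_mult_nth)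
    next
      case False
      hence "int (N - n) - k = 2 * a" "int (N - n) + k = 2 * (a + k)" using a by auto
      hence "bessel k $. (N - n) = rfact a * rfact (a + k)"
        by (simp only: bessel_def fps_nth_Abs_fps) simp
      with False show ?thesis by (simp add: fps_X_power_mult_nth)
    qed
    moreover have "(fps_X ^ nat (int n + k) * (hyp k oo fps_X ^ 2)) $. N = rfact a * rfact (a + k)"
    proof (cases "N < nat (int n + k)")
      case True
      hence "a < 0" using a by linarith
      thus ?thesis using True by (auto simp: fps_X_power_mult_nth)
    next
      case False
      hence "int (N - nat (int n + k)) = 2 * a" using a assms by (subst of_nat_diff) auto
      hence "N - nat (int n + k) = 2 * nat a" "a \<ge> 0" by auto
      with False show ?thesis by (simp add: fps_X_power_mult_nth fps_compose_fps_X_square_nth hyp_def rfact_def)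
    qed
    ultimately show ?thesis by simp
  qed
qed

text \<open>The Karlin--McGregor determinant. As exactly one particle moves per step, a walk of
  independent particles is a shuffle of single walks, so exponential generating functions
  multiply.\<close>

definition walk_gf :: "int list \<Rightarrow> int list \<Rightarrow> complex fps" where
  "walk_gf a b = alt (length a) (\<lambda>\<sigma>. \<Prod>i<length a. bessel (a ! i - b ! \<sigma> i))"

lemma in_W_nth_less: "in_W d a \<Longrightarrow> i < j \<Longrightarrow> j < d \<Longrightarrow> a ! j < a ! i"
  by (auto simp: in_W_def sorted_wrt_iff_nth_less)

text \<open>A permutation contributes only if \<open>a ! i = b ! \<sigma> i\<close> throughout. Both
  lists decrease strictly, so \<open>\<sigma>\<close> is increasing and hence the identity.\<close>

lemma walk_gf_nth_0:
  assumes a: "in_W d a" and b: "in_W d b"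
  shows "walk_gf a b $. 0 = (if a = b then 1 else 0)"
proof -
  have len: "length a = d" "length b = d" using a b by (auto simp: in_W_def)
  have *: "(\<Prod>i<d. bessel (a ! i - b ! \<sigma> i)) $. 0 = (\<Prod>i<d. if a ! i = b ! \<sigma> i then 1 else 0)" for \<sigma>
    by (simp add: fps_prod_nth' bessel_nth_0 multisets_of_size_0 if_distrib)
  have id: "\<sigma> = id" if s: "\<sigma> permutes {..<d}" and eq: "\<And>i. i < d \<Longrightarrow> a ! i = b ! \<sigma> i" for \<sigma>
  proof -
    have mono: "\<sigma> i < \<sigma> j" if "i < j" "j < d" for i j
    proof (rule ccontr)
      assume "\<not> \<sigma> i < \<sigma> j"
      moreover have "\<sigma> i \<noteq> \<sigma> j" using permutes_inj[OF s] that by (auto dest: injD)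
      ultimately have "b ! \<sigma> i < b ! \<sigma> j"
        using that permutes_less_nat[OF s] by (intro in_W_nth_less[OF b]) auto
      thus False using eq in_W_nth_less[OF a that] that by simp
    qed
    have "\<sigma> i \<ge> i" if "i < d" for i
      using that
    proof (induction i)
      case (Suc i)
      thus ?case using mono[of i "Suc i"] by simp
    qed simp
    thus ?thesis by (intro permutes_natset_ge[OF s]) auto
  qed
  have zero: "(\<Prod>i<d. if a ! i = b ! \<sigma> i then 1 else (0::complex)) = 0" if "\<exists>i<d. a ! i \<noteq> b ! \<sigma> i" for \<sigma>
    using that by (intro prod_zero) auto
  have "walk_gf a b $. 0 = alt d (\<lambda>\<sigma>. \<Prod>i<d. if a ! i = b ! \<sigma> i then 1 else 0)"
    by (simp add: walk_gf_def alt_fps_nth * len)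
  also have "\<dots> = (\<Prod>i<d. if a ! i = b ! id i then 1 else 0)"
    using id zero by (intro alt_single) blast
  also have "\<dots> = (if a = b then 1 else 0)"
    using len by (auto simp: list_eq_iff_nth_eq intro!: prod_zero)
  finally show ?thesis .
qed

text \<open>Exchanging the two coincident particles pairs permutations of opposite sign; this is the
  cancellation in the reflection principle.\<close>

lemma walk_gf_coincident:
  assumes "i < length a" "j < length a" "i \<noteq> j" "a ! i = a ! j"
  shows "walk_gf a b = 0"
proof (rule fps_ext, unfold walk_gf_def alt_fps_nth fps_zero_nth, rule alt_eq_0_right[OF assms(1-3)])
  fix N \<sigma>
  let ?d = "length a" and ?\<tau> = "Transposition.transpose i j"
  have \<tau>: "?\<tau> permutes {..<?d}" using assms by (intro permutes_swap_id) auto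
  have "(\<Prod>s<?d. bessel (a ! s - b ! \<sigma> s)) = (\<Prod>s<?d. bessel (a ! (?\<tau> s) - b ! \<sigma> (?\<tau> s)))"
    using prod.permute[OF \<tau>, of "\<lambda>s. bessel (a ! s - b ! \<sigma> s)"] by (simp add: o_def)
  also have "\<dots> = (\<Prod>s<?d. bessel (a ! s - b ! (\<sigma> \<circ> ?\<tau>) s))"
    using assms(4) by (intro prod.cong refl) (auto simp: Transposition.transpose_def)
  finally show "(\<Prod>s<?d. bessel (a ! s - b ! (\<sigma> \<circ> ?\<tau>) s)) $. N = (\<Prod>s<?d. bessel (a ! s - b ! \<sigma> s)) $. N" by simp
qed

text \<open>Differentiation removes the first step. All unconstrained moves appear, also those that
  make two particles collide.\<close>

lemma fps_deriv_walk_gf: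
  "fps_deriv (walk_gf a b) = (\<Sum>(i, s)\<in>{..<length a} \<times> {1, -1}. walk_gf (a[i := a ! i + s]) b)"
proof -
  let ?d = "length a"
  have upd: "walk_gf (a[i := a ! i + s]) b =
    alt ?d (\<lambda>\<sigma>. bessel (a ! i + s - b ! \<sigma> i) * (\<Prod>j\<in>{..<?d}-{i}. bessel (a ! j - b ! \<sigma> j)))" if "i < ?d" for i s
    unfolding walk_gf_def length_list_update
  proof (rule alt_cong)
    fix \<sigma>
    have "(\<Prod>j\<in>{..<?d}-{i}. bessel (a[i := a ! i + s] ! j - b ! \<sigma> j)) = (\<Prod>j\<in>{..<?d}-{i}. bessel (a ! j - b ! \<sigma> j))"
      by (intro prod.cong) auto
    with that show "(\<Prod>j<?d. bessel (a[i := a ! i + s] ! j - b ! \<sigma> j)) =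
      bessel (a ! i + s - b ! \<sigma> i) * (\<Prod>j\<in>{..<?d}-{i}. bessel (a ! j - b ! \<sigma> j))"
      by (subst prod.remove[of _ i]) auto
  qed
  have "fps_deriv (walk_gf a b) = alt ?d (\<lambda>\<sigma>. fps_deriv (\<Prod>i<?d. bessel (a ! i - b ! \<sigma> i)))"
    by (simp add: walk_gf_def alt_def fps_deriv_sum)
  also have "\<dots> = alt ?d (\<lambda>\<sigma>. \<Sum>i<?d. bessel (a ! i + 1 - b ! \<sigma> i) * (\<Prod>j\<in>{..<?d}-{i}. bessel (a ! j - b ! \<sigma> j)) +
      bessel (a ! i + -1 - b ! \<sigma> i) * (\<Prod>j\<in>{..<?d}-{i}. bessel (a ! j - b ! \<sigma> j)))"
    by (simp add: fps_deriv_prod fps_deriv_bessel algebra_simps)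
  also have "\<dots> = (\<Sum>i<?d. walk_gf (a[i := a ! i + 1]) b + walk_gf (a[i := a ! i + -1]) b)"
    by (simp only: alt_sum alt_add) (intro sum.cong refl, simp only: upd lessThan_iff)
  also have "\<dots> = (\<Sum>(i, s)\<in>{..<?d} \<times> {1, -1}. walk_gf (a[i := a ! i + s]) b)"
    by (simp add: sum.cartesian_product[symmetric])
  finally show ?thesis .
qed

section \<open>Counting walks by their first step\<close>

lemma step_iff:
  "step c c' \<longleftrightarrow> (\<exists>i<length c. \<exists>s\<in>{1, -1}. c' = c[i := c ! i + s])"
proof
  assume "step c c'"
  hence len: "length c' = length c" and sum: "(\<Sum>i<length c. (c ! i - c' ! i)\<^sup>2) = 1"
    by (auto simp: step_def)
  then obtain i where i: "i < length c" "(c ! i - c' ! i)\<^sup>2 \<noteq> 0"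
    by (metis (no_types, lifting) lessThan_iff sum.neutral zero_neq_one)
  have split: "(c ! i - c' ! i)\<^sup>2 + (\<Sum>j\<in>{..<length c}-{i}. (c ! j - c' ! j)\<^sup>2) = 1"
    using sum i(1) by (subst (asm) sum.remove[of _ i]) auto
  have ge: "(\<Sum>j\<in>{..<length c}-{i}. (c ! j - c' ! j)\<^sup>2) \<ge> 0" by (intro sum_nonneg) auto
  have "(c ! i - c' ! i)\<^sup>2 > 0" using i(2) by (simp add: order_less_le)
  with split ge have one: "(c ! i - c' ! i)\<^sup>2 = 1" and zero: "(\<Sum>j\<in>{..<length c}-{i}. (c ! j - c' ! j)\<^sup>2) = 0"
    by linarith+
  from zero have "\<forall>j\<in>{..<length c}-{i}. (c ! j - c' ! j)\<^sup>2 = 0"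
    by (subst (asm) sum_nonneg_eq_0_iff) auto
  hence "c' = c[i := c ! i + (c' ! i - c ! i)]"
    using len i(1) by (intro nth_equalityI) (auto simp: nth_list_update)
  moreover have "c' ! i - c ! i \<in> {1, -1}" using one by (auto simp: power2_eq_1_iff)
  ultimately show "\<exists>i<length c. \<exists>s\<in>{1, -1}. c' = c[i := c ! i + s]" using i(1) by blast
next
  assume "\<exists>i<length c. \<exists>s\<in>{1, -1}. c' = c[i := c ! i + s]"
  then obtain i s where i: "i < length c" "s \<in> {1, -1}" "c' = c[i := c ! i + s]" by blast
  have "(\<Sum>j<length c. (c ! j - c' ! j)\<^sup>2) = (\<Sum>j\<in>{i}. 1)"
    using i by (intro sum.mono_neutral_cong_right) auto
  thus "step c c'" using i by (simp add: step_def)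
qed

lemma walks_0: "in_W d a \<Longrightarrow> walks d 0 a b = (if a = b then {[a]} else {})"
  by (auto simp: walks_def length_Suc_conv)

lemma walks_Suc:
  assumes "in_W d a"
  shows "walks d (Suc N) a b = (\<Union>a'\<in>{a'. in_W d a' \<and> step a a'}. (#) a ` walks d N a' b)"
proof (intro equalityI subsetI)
  fix w assume w: "w \<in> walks d (Suc N) a b"
  then obtain v where v: "w = a # v" by (cases w) (auto simp: walks_def)
  have "v \<in> walks d N (v ! 0) b" "in_W d (v ! 0)" "step a (v ! 0)"
    using w unfolding v walks_def by (auto simp: nth_Cons split: nat.splits)
  with v show "w \<in> (\<Union>a'\<in>{a'. in_W d a' \<and> step a a'}. (#) a ` walks d N a' b)" by blast
next
  fix w assume "w \<in> (\<Union>a'\<in>{a'. in_W d a' \<and> step a a'}. (#) a ` walks d N a' b)"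
  then obtain a' v where "in_W d a'" "step a a'" "v \<in> walks d N a' b" "w = a # v" by blast
  with assms show "w \<in> walks d (Suc N) a b"
    by (auto simp: walks_def nth_Cons split: nat.splits)
qed

lemma list_update_inj:
  assumes "a[i := a ! i + s] = a[j := a ! j + r]" "i < length a" "j < length a" "s \<noteq> 0" "r \<noteq> (0::int)"
  shows "i = j \<and> s = r"
proof -
  have "a[i := a ! i + s] ! i = a[j := a ! j + r] ! i" using assms(1) by simp
  with assms(2-) have "i = j" by (cases "i = j") auto
  with assms show ?thesis by (metis add_left_cancel nth_list_update_eq)
qed

text \<open>Both sides satisfy the same recursion in the first step, because the forbidden moves
  lead to coincident particles, where \<open>walk_gf\<close> is zero. Finiteness is carried along
  for the cardinality of the disjoint union.\<close>

theorem card_walks: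
  assumes "in_W d a" "in_W d b"
  shows "finite (walks d N a b) \<and> of_nat (card (walks d N a b)) = fact N * walk_gf a b $. N"
  using assms(1)
proof (induction N arbitrary: a)
  case 0
  thus ?case using walk_gf_nth_0[OF 0 assms(2)] by (simp add: walks_0)
next
  case (Suc N)
  define S where "S = {a'. in_W d a' \<and> step a a'}"
  define T where "T = {..<length a} \<times> {1, -1 :: int}"
  define u where "u = (\<lambda>(i, s). a[i := a ! i + s])"
  have inj: "inj_on u T"
    by (rule inj_onI) (auto simp: u_def T_def dest: list_update_inj)
  have S: "S = {a' \<in> u ` T. in_W d a'}"
    unfolding S_def u_def T_def step_iff by force
  have finT: "finite T" by (simp add: T_def)
  have finS: "finite S" using S finT by simp
  \<comment> \<open>A single coordinate moves by one unit, so a strictly decreasing pair can become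
    equal but never reversed.\<close>
  have zero: "walk_gf a' b $. N = 0" if "a' \<in> u ` T - S" for a'
  proof -
    from that obtain i s where st: "i < length a" "s \<in> {1, -1}" "a' = a[i := a ! i + s]"
      by (auto simp: u_def T_def)
    have notW: "\<not> in_W d a'" using that S by auto
    have len: "length a = d" "length a' = d" using Suc.prems st by (auto simp: in_W_def)
    from notW len obtain j k where jk: "j < k" "k < d" "\<not> a' ! j > a' ! k"
      by (auto simp: in_W_def sorted_wrt_iff_nth_less)
    have "a ! k < a ! j" using in_W_nth_less[OF Suc.prems] jk by auto
    hence "a' ! j = a' ! k" using jk st len by (auto simp: nth_list_update split: if_splits)
    thus ?thesis using walk_gf_coincident[of j a' k b] jk len by simp
  qed
  have IH: "finite (walks d N a' b)" "of_nat (card (walks d N a' b)) = fact N * walk_gf a' b $. N" if "a' \<in> S" for a'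
    using Suc.IH[of a'] that by (auto simp: S_def)
  have W: "walks d (Suc N) a b = (\<Union>a'\<in>S. (#) a ` walks d N a' b)"
    unfolding S_def by (rule walks_Suc[OF Suc.prems])
  have "card (walks d (Suc N) a b) = (\<Sum>a'\<in>S. card ((#) a ` walks d N a' b))"
    unfolding W
  proof (rule card_UN_disjoint[OF finS])
    show "\<forall>a'\<in>S. finite ((#) a ` walks d N a' b)" using IH by auto
    show "\<forall>i\<in>S. \<forall>j\<in>S. i \<noteq> j \<longrightarrow> (#) a ` walks d N i b \<inter> (#) a ` walks d N j b = {}"
      by (auto simp: walks_def)
  qed
  also have "\<dots> = (\<Sum>a'\<in>S. card (walks d N a' b))"
    by (intro sum.cong refl card_image) (auto simp: inj_on_def)
  finally have "of_nat (card (walks d (Suc N) a b)) = (\<Sum>a'\<in>S. fact N * walk_gf a' b $. N)"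
    by (simp add: IH)
  also have "\<dots> = (\<Sum>a'\<in>u ` T. fact N * walk_gf a' b $. N)"
    using zero finT S by (intro sum.mono_neutral_left) auto
  also have "\<dots> = fact N * (\<Sum>p\<in>T. walk_gf (u p) b $. N)"
    by (simp add: sum.reindex[OF inj] sum_distrib_left)
  also have "(\<Sum>p\<in>T. walk_gf (u p) b $. N) = fps_deriv (walk_gf a b) $. N"
    unfolding fps_deriv_walk_gf T_def[symmetric] fps_sum_nth u_def by (intro sum.cong) auto
  finally show ?case using IH finS by (simp add: W algebra_simps)
qed

lemma length_rho [simp]: "length (rho d) = d"
  by (simp add: rho_def)

lemma nth_rho: "i < d \<Longrightarrow> rho d ! i = int d - int i"
  by (simp add: rho_def rev_nth of_nat_diff del: upt_Suc)

theorem Z_generating_function: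
  "of_nat (Z d N q) / fact N =
    (if d * q \<le> N \<and> even (N - d * q) then
       alt d (\<lambda>\<sigma>. \<Sum>X\<in>multisets_of_size {..<d} ((N - d * q) div 2).
         \<Prod>i<d. rfact (cnt X i) * rfact (cnt X i + (int q + int i - int (\<sigma> i))))
     else 0)"
proof -
  let ?b = "map (\<lambda>a. a + int q) (rho d)"
  define H where "H = alt d (\<lambda>\<sigma>. \<Prod>i<d. hyp (int q + int i - int (\<sigma> i)))"
  have W: "in_W d (rho d)" "in_W d ?b"
    by (auto simp: in_W_def sorted_wrt_iff_nth_less nth_rho)
  have "of_nat (Z d N q) / fact N = walk_gf (rho d) ?b $. N"
    using card_walks[OF W, of N] by (simp add: Z_def)
  also have "walk_gf (rho d) ?b = alt d (\<lambda>\<sigma>. \<Prod>i<d. bessel (int q + int i - int (\<sigma> i)))"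
    unfolding walk_gf_def length_rho
  proof (intro alt_cong prod.cong refl)
    fix \<sigma> i assume "\<sigma> permutes {..<d}" "i \<in> {..<d}"
    hence "rho d ! i - ?b ! \<sigma> i = - (int q + int i - int (\<sigma> i))"
      by (simp add: nth_rho permutes_less_nat)
    thus "bessel (rho d ! i - ?b ! \<sigma> i) = bessel (int q + int i - int (\<sigma> i))"
      by (simp only: bessel_minus)
  qed
  also have "\<dots> = fps_X ^ (d * q) * (H oo fps_X ^ 2)"
  proof -
    \<comment> \<open>The index \<open>q + i - \<sigma> i\<close> may be negative but exceeds
      \<open>- d\<close>, so a factor \<open>fps_X ^ d\<close> in each row makes all exponents
      nonnegative. Their product is cancelled at the end.\<close>
    have "fps_X ^ (d * d) * alt d (\<lambda>\<sigma>. \<Prod>i<d. bessel (int q + int i - int (\<sigma> i))) =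
      alt d (\<lambda>\<sigma>. \<Prod>i<d. fps_X ^ d * bessel (int q + int i - int (\<sigma> i)))"
      by (simp add: alt_mult prod.distrib power_mult)
    also have "\<dots> = alt d (\<lambda>\<sigma>. fps_X ^ (d * d + d * q) * ((\<Prod>i<d. hyp (int q + int i - int (\<sigma> i))) oo fps_X ^ 2))"
    proof (rule alt_cong)
      fix \<sigma> assume s: "\<sigma> permutes {..<d}"
      have "(\<Prod>i<d. fps_X ^ d * bessel (int q + int i - int (\<sigma> i))) =
        (\<Prod>i<d. fps_X ^ nat (int d + (int q + int i - int (\<sigma> i))) * (hyp (int q + int i - int (\<sigma> i)) oo fps_X ^ 2))"
      proof (intro prod.cong refl fps_X_power_bessel)
        fix i assume "i \<in> {..<d}"
        hence "\<sigma> i < d" using s by (simp add: permutes_less_nat)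
        thus "0 \<le> int d + (int q + int i - int (\<sigma> i))" by simp
      qed
      also have "\<dots> = fps_X ^ (\<Sum>i<d. nat (int d + (int q + int i - int (\<sigma> i)))) *
         ((\<Prod>i<d. hyp (int q + int i - int (\<sigma> i))) oo fps_X ^ 2)"
        by (simp add: prod.distrib power_sum fps_compose_prod_distrib)
      \<comment> \<open>The differences \<open>i - \<sigma> i\<close> sum to zero, so the power of
        \<open>fps_X\<close> is the same for every permutation and leaves the alternating
        sum.\<close>
      also have "(\<Sum>i<d. nat (int d + (int q + int i - int (\<sigma> i)))) = d * d + d * q"
      proof -
        have "int (\<Sum>i<d. nat (int d + (int q + int i - int (\<sigma> i)))) = (\<Sum>i<d. int d + (int q + int i - int (\<sigma> i)))"
          unfolding of_nat_sum
        proof (intro sum.cong refl)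
          fix i assume "i \<in> {..<d}"
          hence "\<sigma> i < d" using s by (simp add: permutes_less_nat)
          thus "int (nat (int d + (int q + int i - int (\<sigma> i)))) = int d + (int q + int i - int (\<sigma> i))" by simp
        qed
        also have "\<dots> = int (d * d + d * q)"
          using sum.permute[OF s, of int] by (simp add: sum.distrib sum_subtractf o_def)
        finally show ?thesis by linarith
      qed
      finally show "(\<Prod>i<d. fps_X ^ d * bessel (int q + int i - int (\<sigma> i))) =
        fps_X ^ (d * d + d * q) * ((\<Prod>i<d. hyp (int q + int i - int (\<sigma> i))) oo fps_X ^ 2)" .
    qed
    also have "\<dots> = fps_X ^ (d * d) * (fps_X ^ (d * q) * (H oo fps_X ^ 2))"
    proof -
      have "H oo fps_X ^ 2 = alt d (\<lambda>\<sigma>. (\<Prod>i<d. hyp (int q + int i - int (\<sigma> i))) oo fps_X ^ 2)"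
        unfolding H_def alt_def fps_compose_sum_distrib
        by (intro sum.cong refl) (auto simp: sign_def fps_compose_uminus)
      thus ?thesis by (simp add: alt_mult power_add mult.assoc)
    qed
    finally show ?thesis by simp
  qed
  also have "\<dots> $. N = (if d * q \<le> N \<and> even (N - d * q) then H $. ((N - d * q) div 2) else 0)"
    by (auto simp only: fps_X_power_mult_nth fps_compose_fps_X_square_nth not_less split: if_splits)
  also have "H $. ((N - d * q) div 2) = alt d (\<lambda>\<sigma>. \<Sum>X\<in>multisets_of_size {..<d} ((N - d * q) div 2).
         \<Prod>i<d. rfact (cnt X i) * rfact (cnt X i + (int q + int i - int (\<sigma> i))))"
    by (simp only: H_def alt_fps_nth fps_prod_nth' hyp_def fps_nth_Abs_fps finite_lessThan)
  finally show ?thesis .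
qed

section \<open>Invariance of the Haar measure\<close>

lemma cnj_measurable: "cnj \<in> borel_measurable borel"
  by (intro borel_measurable_continuous_onI continuous_intros)

lemma entry_measurable: "(\<lambda>A. A ij) \<in> borel_measurable (mat_space n)"
proof (cases "ij \<in> idx n")
  case True
  thus ?thesis
    using measurable_component_singleton[OF True, of "\<lambda>_. borel :: complex measure"] by (simp add: mat_space_def)
next
  case False
  have "(\<lambda>A. A ij) \<in> borel_measurable (mat_space n) \<longleftrightarrow> (\<lambda>A. undefined :: complex) \<in> borel_measurable (mat_space n)"
  proof (rule measurable_cong)
    fix w :: cmat assume "w \<in> space (mat_space n)"
    hence "w \<in> idx n \<rightarrow>\<^sub>E UNIV" by (simp add: mat_space_def space_PiM)
    thus "w ij = undefined" using False by (rule PiE_arb)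
  qed
  thus ?thesis by simp
qed

lemma space_mat_space: "space (mat_space n) = idx n \<rightarrow>\<^sub>E UNIV"
  by (simp add: mat_space_def space_PiM)

lemma mem_idx [simp]: "(i, j) \<in> idx n \<longleftrightarrow> i < n \<and> j < n"
  by (simp add: idx_def)

lemma mmult_entry: "i < n \<Longrightarrow> j < n \<Longrightarrow> mmult n A B (i, j) = (\<Sum>k<n. A (i, k) * B (k, j))"
  by (simp add: mmult_def)

lemma madj_entry: "i < n \<Longrightarrow> j < n \<Longrightarrow> madj n A (i, j) = cnj (A (j, i))"
  by (simp add: madj_def)

lemma mmult_measurable: "mmult n V \<in> measurable (mat_space n) (mat_space n)"
proof -
  have "(\<lambda>B. restrict (\<lambda>ij. \<Sum>k<n. V (fst ij, k) * B (k, snd ij)) (idx n)) \<in> measurable (mat_space n) (PiM (idx n) (\<lambda>_. borel))"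
    by (intro measurable_restrict borel_measurable_sum borel_measurable_times borel_measurable_const entry_measurable)
  thus ?thesis by (simp add: case_prod_unfold mmult_def[abs_def] mat_space_def[symmetric])
qed

lemma madj_measurable: "madj n \<in> measurable (mat_space n) (mat_space n)"
proof -
  have "(\<lambda>B. restrict (\<lambda>ij. cnj (B (snd ij, fst ij))) (idx n)) \<in> measurable (mat_space n) (PiM (idx n) (\<lambda>_. borel))"
    by (intro measurable_restrict measurable_compose[OF entry_measurable cnj_measurable])
  thus ?thesis by (simp add: case_prod_unfold madj_def[abs_def] mat_space_def[symmetric])
qed

lemma mmult_madj_measurable:
  "(\<lambda>(W, U). mmult n (madj n W) U) \<in> measurable (mat_space n \<Otimes>\<^sub>M mat_space n) (mat_space n)"
proof -
  have "(\<lambda>WU. restrict (\<lambda>ij. \<Sum>k<n. cnj (fst WU (k, fst ij)) * snd WU (k, snd ij)) (idx n))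
    \<in> measurable (mat_space n \<Otimes>\<^sub>M mat_space n) (PiM (idx n) (\<lambda>_. borel))"
    by (intro measurable_restrict borel_measurable_sum borel_measurable_times
        measurable_compose[OF measurable_compose[OF measurable_fst entry_measurable] cnj_measurable]
        measurable_compose[OF measurable_snd entry_measurable])
  moreover have "mmult n (madj n W) U = restrict (\<lambda>ij. \<Sum>k<n. cnj (W (k, fst ij)) * U (k, snd ij)) (idx n)" for W U
    unfolding mmult_def by (intro restrict_ext) (auto intro!: sum.cong simp: madj_entry)
  ultimately show ?thesis by (simp add: case_prod_unfold mat_space_def[symmetric])
qed

lemma unitary_iff:
  "unitary n A \<longleftrightarrow> A \<in> space (mat_space n) \<and>
    (\<forall>i<n. \<forall>j<n. (\<Sum>k<n. cnj (A (k, i)) * A (k, j)) = (if i = j then 1 else 0))"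
proof -
  have "mmult n (madj n A) A = mone n \<longleftrightarrow>
    (\<forall>ij\<in>idx n. (case ij of (i, j) \<Rightarrow> \<Sum>k<n. madj n A (i, k) * A (k, j)) = (case ij of (i, j) \<Rightarrow> if i = j then 1 else 0))"
    unfolding mmult_def mone_def by (metis (no_types, lifting) restrict_apply' restrict_ext)
  also have "\<dots> \<longleftrightarrow> (\<forall>i<n. \<forall>j<n. (\<Sum>k<n. cnj (A (k, i)) * A (k, j)) = (if i = j then 1 else 0))"
  proof -
    have "(\<Sum>k<n. madj n A (i, k) * A (k, j)) = (\<Sum>k<n. cnj (A (k, i)) * A (k, j))" if "i < n" for i j
      using that by (intro sum.cong) (auto simp: madj_entry)
    thus ?thesis by (auto simp: idx_def)
  qed
  finally show ?thesis by (simp add: unitary_def)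
qed

lemma unitary_columns:
  "unitary n A \<Longrightarrow> i < n \<Longrightarrow> j < n \<Longrightarrow> (\<Sum>k<n. cnj (A (k, i)) * A (k, j)) = (if i = j then 1 else 0)"
  by (simp add: unitary_iff)

text \<open>A left inverse of a square matrix is also a right inverse.\<close>

lemma unitary_rows:
  assumes "unitary n A" "i < n" "j < n"
  shows "(\<Sum>k<n. A (i, k) * cnj (A (j, k))) = (if i = j then 1 else 0)"
proof -
  define M where "M = Matrix.mat n n A"
  define M' where "M' = Matrix.mat n n (\<lambda>(i, j). cnj (A (j, i)))"
  have "M' * M = 1\<^sub>m n"
    using unitary_columns[OF assms(1)]
    by (intro eq_matI) (auto simp: M_def M'_def scalar_prod_def atLeast0LessThan)
  hence "M * M' = 1\<^sub>m n"
    by (intro mat_mult_left_right_inverse[of M' n M]) (auto simp: M_def M'_def)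
  hence "(M * M') $$ (i, j) = 1\<^sub>m n $$ (i, j)" by simp
  with assms(2,3) show ?thesis
    by (simp add: M_def M'_def scalar_prod_def atLeast0LessThan)
qed

lemma unitary_madj:
  assumes "unitary n A"
  shows "unitary n (madj n A)"
  unfolding unitary_iff
proof (intro conjI allI impI)
  show "madj n A \<in> space (mat_space n)"
    by (simp add: space_mat_space madj_def)
  fix i j assume "i < n" "j < n"
  thus "(\<Sum>k<n. cnj (madj n A (k, i)) * madj n A (k, j)) = (if i = j then 1 else 0)"
    using unitary_rows[OF assms, of i j] by (simp add: madj_entry)
qed

lemma unitary_norm_le_1:
  assumes "unitary n A" "i < n" "j < n"
  shows "norm (A (i, j)) \<le> 1"
proof -
  have "(\<Sum>k<n. complex_of_real ((norm (A (k, j)))\<^sup>2)) = 1"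
    using unitary_columns[OF assms(1,3,3)] by (simp add: complex_norm_square mult.commute del: of_real_power)
  hence "complex_of_real (\<Sum>k<n. (norm (A (k, j)))\<^sup>2) = 1" by simp
  hence "(\<Sum>k<n. (norm (A (k, j)))\<^sup>2) = 1" by (simp only: of_real_eq_1_iff)
  moreover have "(norm (A (i, j)))\<^sup>2 \<le> (\<Sum>k<n. (norm (A (k, j)))\<^sup>2)"
    using assms(2) by (intro member_le_sum) auto
  ultimately show ?thesis using abs_square_le_1[of "norm (A (i, j))"] by simp
qed

lemma madj_mmult: "madj n (mmult n (madj n W) U) = mmult n (madj n U) W"
proof
  fix ij show "madj n (mmult n (madj n W) U) ij = mmult n (madj n U) W ij"
  proof (cases "ij \<in> idx n")
    case True
    then obtain i j where "ij = (i, j)" "i < n" "j < n" by (cases ij) auto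
    thus ?thesis by (auto simp: madj_entry mmult_entry mult.commute intro!: sum.cong)
  qed (simp add: madj_def mmult_def)
qed

text \<open>The bound is imposed on unitary matrices only, which carry the whole measure;
  polynomials in the entries qualify although they are unbounded elsewhere.\<close>

definition bounded_fun :: "nat \<Rightarrow> (cmat \<Rightarrow> complex) \<Rightarrow> bool" where
  "bounded_fun n f \<longleftrightarrow> f \<in> borel_measurable (mat_space n) \<and> (\<exists>C. \<forall>A. unitary n A \<longrightarrow> norm (f A) \<le> C)"

lemma bounded_fun_measurable: "bounded_fun n f \<Longrightarrow> f \<in> borel_measurable (mat_space n)"
  by (simp add: bounded_fun_def)

lemma bounded_fun_const: "bounded_fun n (\<lambda>_. c)"
  by (auto simp: bounded_fun_def)

lemma bounded_fun_entry: "i < n \<Longrightarrow> j < n \<Longrightarrow> bounded_fun n (\<lambda>A. A (i, j))"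
  unfolding bounded_fun_def using unitary_norm_le_1 entry_measurable by blast

lemma bounded_fun_cnj: "bounded_fun n f \<Longrightarrow> bounded_fun n (\<lambda>A. cnj (f A))"
  using measurable_compose[OF _ cnj_measurable, of f "mat_space n"] by (auto simp: bounded_fun_def)

lemma bounded_fun_add:
  assumes "bounded_fun n f" "bounded_fun n g"
  shows "bounded_fun n (\<lambda>A. f A + g A)"
proof -
  from assms obtain C D where "\<And>A. unitary n A \<Longrightarrow> norm (f A) \<le> C" "\<And>A. unitary n A \<Longrightarrow> norm (g A) \<le> D"
    by (auto simp: bounded_fun_def)
  hence "\<forall>A. unitary n A \<longrightarrow> norm (f A + g A) \<le> C + D" by (auto intro: norm_triangle_mono)
  thus ?thesis using assms by (auto simp: bounded_fun_def intro!: borel_measurable_add)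
qed

lemma bounded_fun_mult:
  assumes "bounded_fun n f" "bounded_fun n g"
  shows "bounded_fun n (\<lambda>A. f A * g A)"
proof -
  from assms obtain C D where "\<And>A. unitary n A \<Longrightarrow> norm (f A) \<le> C" "\<And>A. unitary n A \<Longrightarrow> norm (g A) \<le> D"
    by (auto simp: bounded_fun_def)
  hence "\<forall>A. unitary n A \<longrightarrow> norm (f A * g A) \<le> C * D"
    by (auto simp: norm_mult intro!: mult_mono order_trans[OF norm_ge_zero])
  thus ?thesis using assms by (auto simp: bounded_fun_def intro!: borel_measurable_times)
qed

lemma bounded_fun_power: "bounded_fun n f \<Longrightarrow> bounded_fun n (\<lambda>A. f A ^ k)"
  by (induction k) (auto intro: bounded_fun_const bounded_fun_mult)

lemma bounded_fun_prod: "(\<And>i. i \<in> I \<Longrightarrow> bounded_fun n (f i)) \<Longrightarrow> bounded_fun n (\<lambda>A. \<Prod>i\<in>I. f i A)"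
  by (induction I rule: infinite_finite_induct) (auto intro: bounded_fun_const bounded_fun_mult)

lemma bounded_fun_sum: "(\<And>i. i \<in> I \<Longrightarrow> bounded_fun n (f i)) \<Longrightarrow> bounded_fun n (\<lambda>A. \<Sum>i\<in>I. f i A)"
  by (induction I rule: infinite_finite_induct) (auto intro: bounded_fun_const bounded_fun_add)

lemma bounded_fun_diff: "bounded_fun n f \<Longrightarrow> bounded_fun n g \<Longrightarrow> bounded_fun n (\<lambda>A. f A - g A)"
  using bounded_fun_add[OF _ bounded_fun_mult[OF bounded_fun_const[of n "-1"]], of f g] by simp

lemmas bounded_fun_intros = bounded_fun_const bounded_fun_entry bounded_fun_cnj bounded_fun_add
  bounded_fun_diff bounded_fun_mult bounded_fun_power bounded_fun_prod bounded_fun_sum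

locale haar_unitary =
  fixes n :: nat and \<mu> :: "cmat measure"
  assumes haar: "is_haar_unitary n \<mu>"
begin

sublocale prob_space \<mu>
  using haar by (simp add: is_haar_unitary_def)

lemma sets_eq [measurable_cong]: "sets \<mu> = sets (mat_space n)"
  using haar by (simp add: is_haar_unitary_def)

lemma AE_unitary: "AE A in \<mu>. unitary n A"
  using haar by (simp add: is_haar_unitary_def)

lemma measurable_eq: "measurable \<mu> N = measurable (mat_space n) N"
  by (rule measurable_cong_sets[OF sets_eq refl])

abbreviation E :: "(cmat \<Rightarrow> complex) \<Rightarrow> complex" where
  "E f \<equiv> integral\<^sup>L \<mu> f"

lemma bounded_integrable: "bounded_fun n f \<Longrightarrow> integrable \<mu> f"
  using AE_unitary unfolding bounded_fun_def
  by (elim conjE exE, intro integrable_const_bound) (auto simp: measurable_eq)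

lemma E_cong:
  assumes "bounded_fun n f" "bounded_fun n g" "\<And>A. unitary n A \<Longrightarrow> f A = g A"
  shows "E f = E g"
proof (rule integral_cong_AE)
  show "AE A in \<mu>. f A = g A" using AE_unitary assms(3) by auto
qed (use assms(1,2) in \<open>auto simp: bounded_fun_def measurable_eq\<close>)

lemma E_mmult:
  assumes "f \<in> borel_measurable (mat_space n)" "unitary n V"
  shows "E (\<lambda>A. f (mmult n V A)) = E f"
proof -
  have "distr \<mu> (mat_space n) (mmult n V) = \<mu>"
    using haar assms(2) by (simp add: is_haar_unitary_def)
  hence "E f = integral\<^sup>L (distr \<mu> (mat_space n) (mmult n V)) f" by simp
  also have "\<dots> = E (\<lambda>A. f (mmult n V A))"
    using assms(1) mmult_measurable by (intro integral_distr) (simp_all add: measurable_eq)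
  finally show ?thesis ..
qed

text \<open>Average \<open>f (W\<^sup>* U)\<close> over independent \<open>U\<close> and \<open>W\<close> in both orders.\<close>
lemma E_madj:
  assumes f: "bounded_fun n f"
  shows "E (\<lambda>A. f (madj n A)) = E f"
proof -
  have f_meas: "f \<in> borel_measurable (mat_space n)" using f by (rule bounded_fun_measurable)
  obtain C where C: "\<And>A. unitary n A \<Longrightarrow> norm (f A) \<le> C" using f by (auto simp: bounded_fun_def)
  \<comment> \<open>The truncation \<open>g\<close> agrees with \<open>f\<close> on unitary matrices
    and is bounded everywhere, which yields integrability on the product space for Fubini's
    theorem.\<close>
  define g where "g = (\<lambda>A. if norm (f A) \<le> C then f A else 0)"
  have g_meas: "g \<in> borel_measurable (mat_space n)"
    unfolding g_def using f_meas by measurable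
  have g_le: "norm (g A) \<le> \<bar>C\<bar>" for A by (auto simp: g_def)
  have gf: "g A = f A" if "unitary n A" for A using C[OF that] by (simp add: g_def)
  have g_adj: "(\<lambda>A. g (madj n A)) \<in> borel_measurable (mat_space n)"
    by (rule measurable_compose[OF madj_measurable g_meas])
  have Eg: "E f = E g" "E (\<lambda>A. f (madj n A)) = E (\<lambda>A. g (madj n A))"
    using AE_unitary gf f_meas g_meas g_adj measurable_compose[OF madj_measurable f_meas]
    by (auto intro!: integral_cong_AE simp: measurable_eq unitary_madj)
  interpret P: pair_prob_space \<mu> \<mu> by unfold_locales
  have "(\<lambda>(W, U). g (mmult n (madj n W) U)) \<in> borel_measurable (\<mu> \<Otimes>\<^sub>M \<mu>)"
    using measurable_compose[OF mmult_madj_measurable g_meas]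
    by (simp add: case_prod_unfold measurable_cong_sets[OF sets_pair_measure_cong[OF sets_eq sets_eq] refl])
  hence int: "integrable (\<mu> \<Otimes>\<^sub>M \<mu>) (\<lambda>(W, U). g (mmult n (madj n W) U))"
    by (intro P.P.integrable_const_bound[of _ "\<bar>C\<bar>"]) (auto simp: g_le)
  have "E g = (\<integral>W. (\<integral>U. g (mmult n (madj n W) U) \<partial>\<mu>) \<partial>\<mu>)"
  proof -
    have "(\<integral>W. (\<integral>U. g (mmult n (madj n W) U) \<partial>\<mu>) \<partial>\<mu>) = (\<integral>W. E g \<partial>\<mu>)"
    proof (rule integral_cong_AE)
      show "(\<lambda>W. \<integral>U. g (mmult n (madj n W) U) \<partial>\<mu>) \<in> borel_measurable \<mu>"
        using borel_measurable_integrable[OF int] by (rule borel_measurable_lebesgue_integral)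
      show "AE W in \<mu>. (\<integral>U. g (mmult n (madj n W) U) \<partial>\<mu>) = E g"
        using AE_unitary by eventually_elim (simp add: E_mmult g_meas unitary_madj)
    qed simp
    thus ?thesis by (simp add: prob_space)
  qed
  also have "\<dots> = (\<integral>U. (\<integral>W. g (mmult n (madj n W) U) \<partial>\<mu>) \<partial>\<mu>)"
    using P.Fubini_integral[OF int] by simp
  also have "\<dots> = (\<integral>U. E (\<lambda>A. g (madj n A)) \<partial>\<mu>)"
  proof (rule integral_cong_AE)
    show "(\<lambda>U. \<integral>W. g (mmult n (madj n W) U) \<partial>\<mu>) \<in> borel_measurable \<mu>"
      using borel_measurable_integrable[OF P.integrable_product_swap[OF int]]
      by (intro borel_measurable_lebesgue_integral) (simp add: case_prod_unfold)
    show "AE U in \<mu>. (\<integral>W. g (mmult n (madj n W) U) \<partial>\<mu>) = E (\<lambda>A. g (madj n A))"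
      using AE_unitary
    proof eventually_elim
      fix U assume U: "unitary n U"
      \<comment> \<open>In this form \<open>W\<close> is multiplied from the left by a fixed unitary
        matrix, so left invariance applies to the inner integral over \<open>W\<close> as
        well.\<close>
      have "mmult n (madj n W) U = madj n (mmult n (madj n U) W)" for W
        by (simp add: madj_mmult)
      thus "(\<integral>W. g (mmult n (madj n W) U) \<partial>\<mu>) = E (\<lambda>A. g (madj n A))"
        using E_mmult[OF g_adj unitary_madj[OF U]] by simp
    qed
  qed simp
  finally show ?thesis by (simp add: Eg prob_space)
qed

end

section \<open>Schwinger--Dyson equations\<close>

definition diag_mat_of :: "nat \<Rightarrow> (nat \<Rightarrow> complex) \<Rightarrow> cmat" where
  "diag_mat_of n v = restrict (\<lambda>(i, j). if i = j then v i else 0) (idx n)"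

lemma unitary_diag:
  assumes "\<And>i. norm (v i) = 1"
  shows "unitary n (diag_mat_of n v)"
  unfolding unitary_iff
proof (intro conjI allI impI)
  show "diag_mat_of n v \<in> space (mat_space n)" by (simp add: space_mat_space diag_mat_of_def)
  fix i j assume ij: "i < n" "j < n"
  have "(\<Sum>k<n. cnj (diag_mat_of n v (k, i)) * diag_mat_of n v (k, j)) =
    (\<Sum>k<n. if k = i then (if i = j then cnj (v i) * v i else 0) else 0)"
    using ij by (intro sum.cong) (auto simp: diag_mat_of_def)
  also have "\<dots> = (if i = j then 1 else 0)"
    using ij assms by (simp add: complex_norm_square[symmetric] mult.commute)
  finally show "(\<Sum>k<n. cnj (diag_mat_of n v (k, i)) * diag_mat_of n v (k, j)) = (if i = j then 1 else 0)" .
qed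

lemma mmult_diag: "i < n \<Longrightarrow> j < n \<Longrightarrow> mmult n (diag_mat_of n v) A (i, j) = v i * A (i, j)"
proof -
  assume ij: "i < n" "j < n"
  have "(\<Sum>k<n. diag_mat_of n v (i, k) * A (k, j)) = (\<Sum>k<n. if k = i then v i * A (i, j) else 0)"
    using ij by (intro sum.cong) (auto simp: diag_mat_of_def)
  thus ?thesis using ij by (simp add: mmult_entry)
qed

definition perm_mat :: "nat \<Rightarrow> (nat \<Rightarrow> nat) \<Rightarrow> cmat" where
  "perm_mat n \<pi> = restrict (\<lambda>(i, j). if j = \<pi> i then 1 else 0) (idx n)"

lemma unitary_perm:
  assumes "\<pi> permutes {..<n}"
  shows "unitary n (perm_mat n \<pi>)"
  unfolding unitary_iff
proof (intro conjI allI impI)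
  show "perm_mat n \<pi> \<in> space (mat_space n)" by (simp add: space_mat_space perm_mat_def)
  fix i j assume ij: "i < n" "j < n"
  let ?f = "\<lambda>k. if k = i then (if i = j then 1 else 0 :: complex) else 0"
  have "(\<Sum>k<n. cnj (perm_mat n \<pi> (k, i)) * perm_mat n \<pi> (k, j)) = (\<Sum>k<n. ?f (\<pi> k))"
    using ij by (intro sum.cong) (auto simp: perm_mat_def)
  also have "\<dots> = (\<Sum>k<n. ?f k)"
    using sum.permute[OF assms, of ?f] by (simp add: o_def)
  also have "\<dots> = (if i = j then 1 else 0)"
    using ij by simp
  finally show "(\<Sum>k<n. cnj (perm_mat n \<pi> (k, i)) * perm_mat n \<pi> (k, j)) = (if i = j then 1 else 0)" .
qed

lemma mmult_perm:
  assumes "\<pi> permutes {..<n}" "i < n" "j < n"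
  shows "mmult n (perm_mat n \<pi>) A (i, j) = A (\<pi> i, j)"
proof -
  have "(\<Sum>k<n. perm_mat n \<pi> (i, k) * A (k, j)) = (\<Sum>k<n. if k = \<pi> i then A (\<pi> i, j) else 0)"
    using assms by (intro sum.cong) (auto simp: perm_mat_def)
  also have "\<dots> = A (\<pi> i, j)" using assms by (simp add: permutes_less_nat)
  finally show ?thesis using assms by (simp add: mmult_entry)
qed

text \<open>A rotation in the plane of coordinates \<open>i\<close> and \<open>j\<close> with phase
  \<open>e\<close>. Its generator at \<open>\<theta> = 0\<close> is skew-Hermitian, with entries
  \<open>e\<close> at \<open>(i, j)\<close> and \<open>- cnj e\<close> at
  \<open>(j, i)\<close>.\<close>

definition rot_mat :: "nat \<Rightarrow> nat \<Rightarrow> nat \<Rightarrow> complex \<Rightarrow> real \<Rightarrow> cmat" where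
  "rot_mat n i j e \<theta> = restrict (\<lambda>(a, b).
     if a = i \<and> b = j then e * of_real (sin \<theta>) else if a = j \<and> b = i then - cnj e * of_real (sin \<theta>)
     else if a = b then (if a = i \<or> a = j then of_real (cos \<theta>) else 1) else 0) (idx n)"

lemma sum_two:
  fixes f :: "nat \<Rightarrow> complex"
  assumes "i < n" "j < n" "i \<noteq> j" "\<And>k. k < n \<Longrightarrow> k \<noteq> i \<Longrightarrow> k \<noteq> j \<Longrightarrow> f k = 0"
  shows "(\<Sum>k<n. f k) = f i + f j"
proof -
  have "(\<Sum>k<n. f k) = (\<Sum>k\<in>{i, j}. f k)"
    using assms by (intro sum.mono_neutral_right) auto
  thus ?thesis using assms by simp
qed

lemma unitary_rot:
  assumes "i < n" "j < n" "i \<noteq> j" "norm e = 1"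
  shows "unitary n (rot_mat n i j e \<theta>)"
  unfolding unitary_iff
proof (intro conjI allI impI)
  let ?R = "rot_mat n i j e \<theta>"
  show "?R \<in> space (mat_space n)" by (simp add: space_mat_space rot_mat_def)
  fix a b assume ab: "a < n" "b < n"
  have e: "cnj e * e = 1" using assms(4) by (simp add: complex_norm_square[symmetric] mult.commute)
  define c s where "c = complex_of_real (cos \<theta>)" and "s = complex_of_real (sin \<theta>)"
  have real: "cnj c = c" "cnj s = s" by (simp_all add: c_def s_def)
  have "c * c + s * s = 1"
    unfolding c_def s_def by (metis of_real_1 of_real_add of_real_mult power2_eq_square sin_cos_squared_add2)
  moreover have "(e * s) * (cnj e * s) = (cnj e * e) * (s * s)" by (simp only: mult_ac)
  ultimately have cs: "c * c + (e * s) * (cnj e * s) = 1" by (simp only: e mult_1)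
  have R: "?R (i, i) = c" "?R (j, j) = c" "?R (i, j) = e * s" "?R (j, i) = - cnj e * s"
    using assms by (simp_all add: rot_mat_def c_def s_def)
  show "(\<Sum>k<n. cnj (?R (k, a)) * ?R (k, b)) = (if a = b then 1 else 0)"
  proof (cases "a = i \<or> a = j")
    case False
    hence "(\<Sum>k<n. cnj (?R (k, a)) * ?R (k, b)) = (\<Sum>k<n. if k = a then (if a = b then 1 else 0) else 0)"
      using ab assms by (intro sum.cong) (auto simp: rot_mat_def)
    thus ?thesis using ab by simp
  next
    case True
    have "(\<Sum>k<n. cnj (?R (k, a)) * ?R (k, b)) = cnj (?R (i, a)) * ?R (i, b) + cnj (?R (j, a)) * ?R (j, b)"
      using ab assms True by (intro sum_two) (auto simp: rot_mat_def)
    also have "\<dots> = (if a = b then 1 else 0)"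
    proof -
      have zero: "?R (i, b) = 0" "?R (j, b) = 0" if "b \<noteq> i" "b \<noteq> j"
        using that ab assms by (simp_all add: rot_mat_def)
      have "cnj c * c + cnj (- cnj e * s) * (- cnj e * s) = 1"
        "cnj (e * s) * (e * s) + cnj c * c = 1"
        using cs by (simp_all only: complex_cnj_mult complex_cnj_minus complex_cnj_cnj real mult_minus_left mult_minus_right minus_minus)
          (simp_all only: mult_ac add_ac)
      moreover have "cnj c * (e * s) + cnj (- cnj e * s) * c = 0" "cnj (e * s) * c + cnj c * (- cnj e * s) = 0"
        by (simp_all add: real)
      ultimately show ?thesis
        using True assms(3) zero
        by (cases "b = i"; cases "b = j") (auto simp only: R mult_zero_right add_0_right if_True if_False simp_thms split: if_splits)
    qed
    finally show ?thesis .
  qed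
qed

lemma mmult_rot:
  assumes "i < n" "j < n" "i \<noteq> j" "c < n"
  shows "mmult n (rot_mat n i j e \<theta>) A (i, c) = of_real (cos \<theta>) * A (i, c) + e * of_real (sin \<theta>) * A (j, c)"
    and "mmult n (rot_mat n i j e \<theta>) A (j, c) = of_real (cos \<theta>) * A (j, c) - cnj e * of_real (sin \<theta>) * A (i, c)"
    and "a < n \<Longrightarrow> a \<noteq> i \<Longrightarrow> a \<noteq> j \<Longrightarrow> mmult n (rot_mat n i j e \<theta>) A (a, c) = A (a, c)"
proof -
  let ?R = "rot_mat n i j e \<theta>"
  have "(\<Sum>k<n. ?R (i, k) * A (k, c)) = ?R (i, i) * A (i, c) + ?R (i, j) * A (j, c)"
    using assms by (intro sum_two) (auto simp: rot_mat_def)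
  thus "mmult n ?R A (i, c) = of_real (cos \<theta>) * A (i, c) + e * of_real (sin \<theta>) * A (j, c)"
    using assms by (simp add: mmult_entry rot_mat_def)
  have "(\<Sum>k<n. ?R (j, k) * A (k, c)) = ?R (j, j) * A (j, c) + ?R (j, i) * A (i, c)"
    using assms by (subst add.commute, intro sum_two) (auto simp: rot_mat_def)
  thus "mmult n ?R A (j, c) = of_real (cos \<theta>) * A (j, c) - cnj e * of_real (sin \<theta>) * A (i, c)"
    using assms by (simp add: mmult_entry rot_mat_def)
  assume a: "a < n" "a \<noteq> i" "a \<noteq> j"
  have "(\<Sum>k<n. ?R (a, k) * A (k, c)) = (\<Sum>k<n. if k = a then A (a, c) else 0)"
    using assms a by (intro sum.cong) (auto simp: rot_mat_def)
  thus "mmult n ?R A (a, c) = A (a, c)" using assms a by (simp add: mmult_entry)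
qed

text \<open>\<open>Gf \<epsilon> A = G0 A + \<epsilon> G1 A + O(\<epsilon>\<^sup>2)\<close> uniformly in the unitary matrix \<open>A\<close>.\<close>
definition expands :: "nat \<Rightarrow> (real \<Rightarrow> cmat \<Rightarrow> complex) \<Rightarrow> (cmat \<Rightarrow> complex) \<Rightarrow> (cmat \<Rightarrow> complex) \<Rightarrow> bool" where
  "expands n Gf G0 G1 \<longleftrightarrow> (\<exists>B. \<forall>A \<epsilon>. unitary n A \<longrightarrow> 0 \<le> \<epsilon> \<longrightarrow> \<epsilon> \<le> 1 \<longrightarrow>
     norm (G0 A) \<le> B \<and> norm (G1 A) \<le> B \<and> norm (Gf \<epsilon> A - G0 A - of_real \<epsilon> * G1 A) \<le> B * \<epsilon>\<^sup>2)"

lemma expands_const: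
  assumes "bounded_fun n f"
  shows "expands n (\<lambda>_. f) f (\<lambda>_. 0)"
proof -
  from assms obtain C where C: "\<And>A. unitary n A \<Longrightarrow> norm (f A) \<le> C" by (auto simp: bounded_fun_def)
  hence "C \<ge> 0" if "unitary n A" for A using that norm_ge_zero order_trans by blast
  thus ?thesis unfolding expands_def using C by (intro exI[of _ C]) auto
qed

lemma expands_cnj: "expands n Gf G0 G1 \<Longrightarrow> expands n (\<lambda>\<epsilon> A. cnj (Gf \<epsilon> A)) (\<lambda>A. cnj (G0 A)) (\<lambda>A. cnj (G1 A))"
proof -
  have "cnj (Gf \<epsilon> A) - cnj (G0 A) - of_real \<epsilon> * cnj (G1 A) = cnj (Gf \<epsilon> A - G0 A - of_real \<epsilon> * G1 A)" for \<epsilon> A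
    by simp
  hence "norm (cnj (Gf \<epsilon> A) - cnj (G0 A) - of_real \<epsilon> * cnj (G1 A)) = norm (Gf \<epsilon> A - G0 A - of_real \<epsilon> * G1 A)" for \<epsilon> A
    by (metis complex_mod_cnj)
  thus "expands n Gf G0 G1 \<Longrightarrow> ?thesis" unfolding expands_def by simp
qed

lemma expands_mult:
  assumes "expands n Gf G0 G1" "expands n H H0 H1"
  shows "expands n (\<lambda>\<epsilon> A. Gf \<epsilon> A * H \<epsilon> A) (\<lambda>A. G0 A * H0 A) (\<lambda>A. G1 A * H0 A + G0 A * H1 A)"
proof -
  obtain B where B: "\<And>A \<epsilon>. unitary n A \<Longrightarrow> 0 \<le> \<epsilon> \<Longrightarrow> \<epsilon> \<le> 1 \<Longrightarrow>
     norm (G0 A) \<le> B \<and> norm (G1 A) \<le> B \<and> norm (Gf \<epsilon> A - G0 A - of_real \<epsilon> * G1 A) \<le> B * \<epsilon>\<^sup>2"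
    using assms(1) by (auto simp: expands_def)
  obtain C where C: "\<And>A \<epsilon>. unitary n A \<Longrightarrow> 0 \<le> \<epsilon> \<Longrightarrow> \<epsilon> \<le> 1 \<Longrightarrow>
     norm (H0 A) \<le> C \<and> norm (H1 A) \<le> C \<and> norm (H \<epsilon> A - H0 A - of_real \<epsilon> * H1 A) \<le> C * \<epsilon>\<^sup>2"
    using assms(2) by (auto simp: expands_def)
  \<comment> \<open>The constant 6 counts the error terms of the product:
    \<open>\<epsilon>\<^sup>2 * G1 * H1\<close> and five products with a remainder \<open>r\<close>
    or \<open>s\<close>. Each is at most \<open>B * C * \<epsilon>\<^sup>2\<close> because
    \<open>\<epsilon> \<le> 1\<close>.\<close>
  have *: "norm (G0 A * H0 A) \<le> 6 * (B * C) \<and> norm (G1 A * H0 A + G0 A * H1 A) \<le> 6 * (B * C) \<and>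
     norm (Gf \<epsilon> A * H \<epsilon> A - G0 A * H0 A - of_real \<epsilon> * (G1 A * H0 A + G0 A * H1 A)) \<le> 6 * (B * C) * \<epsilon>\<^sup>2"
    if A: "unitary n A" and \<epsilon>: "0 \<le> \<epsilon>" "\<epsilon> \<le> 1" for A \<epsilon>
  proof -
    define r where "r = Gf \<epsilon> A - G0 A - of_real \<epsilon> * G1 A"
    define s where "s = H \<epsilon> A - H0 A - of_real \<epsilon> * H1 A"
    have Gf: "norm (G0 A) \<le> B" "norm (G1 A) \<le> B" "norm r \<le> B * \<epsilon>\<^sup>2" using B[OF A \<epsilon>] by (auto simp: r_def)
    have H: "norm (H0 A) \<le> C" "norm (H1 A) \<le> C" "norm s \<le> C * \<epsilon>\<^sup>2" using C[OF A \<epsilon>] by (auto simp: s_def)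
    have nn: "B \<ge> 0" "C \<ge> 0" using Gf(1) H(1) norm_ge_zero order_trans by blast+
    hence BC: "B * C \<ge> 0" by simp
    have e2: "\<epsilon>\<^sup>2 \<le> 1" using \<epsilon> by (simp add: power_le_one)
    have m: "norm (x * y) \<le> a * b" if "norm x \<le> a" "norm y \<le> b" for x y :: complex and a b
      using that unfolding norm_mult by (intro mult_mono) (auto intro: order_trans[OF norm_ge_zero])
    have split: "Gf \<epsilon> A * H \<epsilon> A - G0 A * H0 A - of_real \<epsilon> * (G1 A * H0 A + G0 A * H1 A) =
      of_real (\<epsilon>\<^sup>2) * (G1 A * H1 A) + r * H0 A + (of_real \<epsilon> * r) * H1 A + (G0 A * s + (of_real \<epsilon> * G1 A) * s + r * s)"
      unfolding r_def s_def by (simp add: algebra_simps power2_eq_square)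
    have r': "norm (of_real \<epsilon> * r) \<le> B * \<epsilon>\<^sup>2"
      using Gf(3) \<epsilon> mult_mono[of \<epsilon> 1 "norm r" "B * \<epsilon>\<^sup>2"] nn by (simp add: norm_mult)
    have g': "norm (of_real \<epsilon> * G1 A) \<le> B"
      using Gf(2) \<epsilon> mult_mono[of \<epsilon> 1 "norm (G1 A)" B] nn by (simp add: norm_mult)
    have r1: "norm r \<le> B" using Gf(3) mult_left_mono[OF e2 nn(1)] by simp
    have "norm (of_real (\<epsilon>\<^sup>2) * (G1 A * H1 A)) \<le> \<epsilon>\<^sup>2 * (B * C)"
      by (intro m Gf H) (metis abs_power2 norm_of_real order_refl)
    moreover have "norm (r * H0 A) \<le> B * \<epsilon>\<^sup>2 * C" by (intro m Gf H)
    moreover have "norm ((of_real \<epsilon> * r) * H1 A) \<le> B * \<epsilon>\<^sup>2 * C" by (intro m r' H)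
    moreover have "norm (G0 A * s) \<le> B * (C * \<epsilon>\<^sup>2)" by (intro m Gf H)
    moreover have "norm ((of_real \<epsilon> * G1 A) * s) \<le> B * (C * \<epsilon>\<^sup>2)" by (intro m g' H)
    moreover have "norm (r * s) \<le> B * (C * \<epsilon>\<^sup>2)" by (intro m r1 H)
    ultimately have "norm (Gf \<epsilon> A * H \<epsilon> A - G0 A * H0 A - of_real \<epsilon> * (G1 A * H0 A + G0 A * H1 A)) \<le>
      (\<epsilon>\<^sup>2 * (B * C) + B * \<epsilon>\<^sup>2 * C + B * \<epsilon>\<^sup>2 * C) + (B * (C * \<epsilon>\<^sup>2) + B * (C * \<epsilon>\<^sup>2) + B * (C * \<epsilon>\<^sup>2))"
      unfolding split by (intro norm_triangle_mono)
    also have "\<dots> = 6 * (B * C) * \<epsilon>\<^sup>2" by simp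
    finally have 3: "norm (Gf \<epsilon> A * H \<epsilon> A - G0 A * H0 A - of_real \<epsilon> * (G1 A * H0 A + G0 A * H1 A)) \<le> 6 * (B * C) * \<epsilon>\<^sup>2" .
    have "norm (G0 A * H0 A) \<le> B * C" "norm (G1 A * H0 A + G0 A * H1 A) \<le> B * C + B * C"
      by (intro norm_triangle_mono m Gf H)+
    with BC 3 show ?thesis by linarith
  qed
  show ?thesis unfolding expands_def using * by (intro exI[of _ "6 * (B * C)"]) blast
qed

lemma expands_power:
  assumes "expands n Gf G0 G1"
  shows "expands n (\<lambda>\<epsilon> A. Gf \<epsilon> A ^ k) (\<lambda>A. G0 A ^ k) (\<lambda>A. of_nat k * G0 A ^ (k - 1) * G1 A)"
proof (induction k)
  case 0
  show ?case using expands_const[OF bounded_fun_const, of n 1] by simp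
next
  case (Suc k)
  have "(\<lambda>A. G1 A * G0 A ^ k + G0 A * (of_nat k * G0 A ^ (k - 1) * G1 A)) = (\<lambda>A. of_nat (Suc k) * G0 A ^ (Suc k - 1) * G1 A)"
    by (cases k) (auto simp: algebra_simps)
  thus ?case using expands_mult[OF assms Suc] by simp
qed

text \<open>Real and imaginary parts of the second-order Taylor remainder of
  \<open>iexp\<close>.\<close>

lemma sin_cos_approx:
  fixes \<epsilon> :: real
  shows "\<bar>cos \<epsilon> - 1\<bar> \<le> \<epsilon>\<^sup>2" "\<bar>sin \<epsilon> - \<epsilon>\<bar> \<le> \<epsilon>\<^sup>2"
proof -
  have "\<bar>\<epsilon>\<bar> ^ Suc 1 / fact (Suc 1) \<le> \<epsilon>\<^sup>2"
    by (simp add: power2_eq_square)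
  moreover have "(\<Sum>k\<le>1. (\<i> * complex_of_real \<epsilon>) ^ k / fact k) = 1 + \<i> * \<epsilon>"
    by simp
  ultimately have *: "cmod (iexp \<epsilon> - (1 + \<i> * \<epsilon>)) \<le> \<epsilon>\<^sup>2"
    using iexp_approx1[of \<epsilon> 1] by (metis order_trans)
  have "Re (iexp \<epsilon> - (1 + \<i> * \<epsilon>)) = cos \<epsilon> - 1" "Im (iexp \<epsilon> - (1 + \<i> * \<epsilon>)) = sin \<epsilon> - \<epsilon>"
    by (simp_all add: Re_exp Im_exp)
  thus "\<bar>cos \<epsilon> - 1\<bar> \<le> \<epsilon>\<^sup>2" "\<bar>sin \<epsilon> - \<epsilon>\<bar> \<le> \<epsilon>\<^sup>2"
    using abs_Re_le_cmod[of "iexp \<epsilon> - (1 + \<i> * \<epsilon>)"] abs_Im_le_cmod[of "iexp \<epsilon> - (1 + \<i> * \<epsilon>)"] * by linarith+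
qed

lemma expands_rot:
  assumes "i < n" "j < n" "c < n" "norm e = 1"
  shows "expands n (\<lambda>\<theta> A. of_real (cos \<theta>) * A (i, c) + e * of_real (sin \<theta>) * A (j, c)) (\<lambda>A. A (i, c)) (\<lambda>A. e * A (j, c))"
  unfolding expands_def
proof (intro exI[of _ "2::real"] allI impI conjI)
  fix A :: cmat and \<epsilon> :: real assume A: "unitary n A" and \<epsilon>: "0 \<le> \<epsilon>" "\<epsilon> \<le> 1"
  have le: "norm (A (i, c)) \<le> 1" "norm (A (j, c)) \<le> 1" using A assms by (auto intro: unitary_norm_le_1)
  thus "norm (A (i, c)) \<le> 2" "norm (e * A (j, c)) \<le> 2" using assms by (auto simp: norm_mult)
  have "of_real (cos \<epsilon>) * A (i, c) + e * of_real (sin \<epsilon>) * A (j, c) - A (i, c) - of_real \<epsilon> * (e * A (j, c)) =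
    of_real (cos \<epsilon> - 1) * A (i, c) + of_real (sin \<epsilon> - \<epsilon>) * (e * A (j, c))"
    by (simp add: algebra_simps)
  also have "norm \<dots> \<le> \<epsilon>\<^sup>2 * 1 + \<epsilon>\<^sup>2 * 1"
  proof (rule norm_triangle_mono)
    show "norm (of_real (cos \<epsilon> - 1) * A (i, c)) \<le> \<epsilon>\<^sup>2 * 1"
      unfolding norm_mult norm_of_real using sin_cos_approx(1) le(1) by (intro mult_mono) auto
    show "norm (of_real (sin \<epsilon> - \<epsilon>) * (e * A (j, c))) \<le> \<epsilon>\<^sup>2 * 1"
      unfolding norm_mult norm_of_real assms(4) mult_1 using sin_cos_approx(2) le(2) by (intro mult_mono) auto
  qed
  finally show "norm (of_real (cos \<epsilon>) * A (i, c) + e * of_real (sin \<epsilon>) * A (j, c) - A (i, c) - of_real \<epsilon> * (e * A (j, c))) \<le> 2 * \<epsilon>\<^sup>2"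
    by simp
qed

context haar_unitary
begin

text \<open>Invariance makes \<open>\<epsilon> * E G1\<close> of order
  \<open>\<epsilon>\<^sup>2\<close>. The uniform error bound replaces differentiation under the
  integral sign.\<close>

lemma E_first_order:
  assumes exp: "expands n Gf G0 G1" and bdd: "bounded_fun n G0" "bounded_fun n G1" "\<And>\<epsilon>. bounded_fun n (Gf \<epsilon>)"
    and inv: "\<And>\<epsilon>. E (Gf \<epsilon>) = E G0"
  shows "E G1 = 0"
proof -
  obtain B where B: "\<And>A \<epsilon>. unitary n A \<Longrightarrow> 0 \<le> \<epsilon> \<Longrightarrow> \<epsilon> \<le> 1 \<Longrightarrow>
     norm (Gf \<epsilon> A - G0 A - of_real \<epsilon> * G1 A) \<le> B * \<epsilon>\<^sup>2"
    using exp by (auto simp: expands_def)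
  note int = bounded_integrable[OF bdd(1)] bounded_integrable[OF bdd(2)] bounded_integrable[OF bdd(3)]
  have le: "norm (E G1) \<le> B * \<epsilon>" if \<epsilon>: "0 < \<epsilon>" "\<epsilon> \<le> 1" for \<epsilon> :: real
  proof -
    have "E (\<lambda>A. Gf \<epsilon> A - G0 A - of_real \<epsilon> * G1 A) = - of_real \<epsilon> * E G1"
      using int by (simp add: inv)
    hence "\<epsilon> * norm (E G1) = norm (E (\<lambda>A. Gf \<epsilon> A - G0 A - of_real \<epsilon> * G1 A))"
      using \<epsilon> by (simp add: norm_mult)
    also have "\<dots> \<le> B * \<epsilon>\<^sup>2"
    proof (rule order_trans[OF integral_norm_bound])
      show "(\<integral>A. norm (Gf \<epsilon> A - G0 A - of_real \<epsilon> * G1 A) \<partial>\<mu>) \<le> B * \<epsilon>\<^sup>2"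
      proof (rule integral_le_const)
        show "integrable \<mu> (\<lambda>A. norm (Gf \<epsilon> A - G0 A - of_real \<epsilon> * G1 A))"
          using int by (intro integrable_norm Bochner_Integration.integrable_diff integrable_mult_right)
        show "AE A in \<mu>. norm (Gf \<epsilon> A - G0 A - of_real \<epsilon> * G1 A) \<le> B * \<epsilon>\<^sup>2"
          using AE_unitary B \<epsilon> by auto
      qed
    qed
    also have "\<dots> = \<epsilon> * (B * \<epsilon>)" by (simp add: power2_eq_square)
    finally show ?thesis using \<epsilon> by simp
  qed
  have "((\<lambda>\<epsilon>. B * \<epsilon>) \<longlongrightarrow> B * 0) (at_right 0)" by (intro tendsto_intros)
  moreover have "eventually (\<lambda>\<epsilon>. norm (E G1) \<le> B * \<epsilon>) (at_right 0)"
    by (rule eventually_mono[OF eventually_at_right_real[of 0 1]]) (auto intro: le)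
  ultimately have "norm (E G1) \<le> B * 0"
    by (intro tendsto_lowerbound[of "\<lambda>\<epsilon>. B * \<epsilon>"]) (auto simp: trivial_limit_at_right_real)
  thus ?thesis by simp
qed

text \<open>The Schwinger--Dyson equation for \<open>cnj p * W u\<^sup>m\<^sup>+\<^sup>1 v\<^sup>k cnj (u\<^sup>m v\<^sup>k)\<close> with \<open>u, v\<close> the diagonal and \<open>p, s\<close>
  the off-diagonal entries in the rows and columns \<open>i, j\<close>. The generator of the rotation is complexified
  by combining the phases \<open>1\<close> and \<open>\<i>\<close>.\<close>
lemma schwinger_dyson:
  assumes ij: "i < n" "j < n" "i \<noteq> j" and W: "bounded_fun n W"
    and inv: "\<And>e \<theta> A. W (mmult n (rot_mat n i j e \<theta>) A) = W A"
  shows "E (\<lambda>A. W A * (A (i,i) * cnj (A (i,i))) ^ Suc m * (A (j,j) * cnj (A (j,j))) ^ k) =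
    of_nat (Suc m) * E (\<lambda>A. W A * (A (j,i) * cnj (A (j,i))) * (A (i,i) * cnj (A (i,i))) ^ m * (A (j,j) * cnj (A (j,j))) ^ k) -
    of_nat k * E (\<lambda>A. W A * (cnj (A (j,i)) * cnj (A (i,j))) * (A (i,i) * A (j,j)) *
      (A (i,i) * cnj (A (i,i))) ^ m * (A (j,j) * cnj (A (j,j))) ^ (k - 1))"
proof -
  define u v p s :: "cmat \<Rightarrow> complex" where "u = (\<lambda>A. A (i,i))" and "v = (\<lambda>A. A (j,j))" and "p = (\<lambda>A. A (j,i))" and "s = (\<lambda>A. A (i,j))"
  note defs = u_def v_def p_def s_def
  have bdd: "bounded_fun n u" "bounded_fun n v" "bounded_fun n p" "bounded_fun n s"
    unfolding defs using ij by (auto intro: bounded_fun_entry)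
  define g where "g = (\<lambda>A. W A * (cnj (p A) * (u A ^ Suc m * (v A ^ k * (cnj (u A) ^ m * cnj (v A) ^ k)))))"
  \<comment> \<open>Written exactly as the product rules \<open>expands_mult\<close> and
    \<open>expands_power\<close> generate it, including the zero derivative of
    \<open>W\<close>.\<close>
  define g1 where "g1 = (\<lambda>e A. 0 * (cnj (p A) * (u A ^ Suc m * (v A ^ k * (cnj (u A) ^ m * cnj (v A) ^ k)))) + W A * (
     cnj ((- cnj e) * u A) * (u A ^ Suc m * (v A ^ k * (cnj (u A) ^ m * cnj (v A) ^ k))) + cnj (p A) * (
     (of_nat (Suc m) * u A ^ (Suc m - 1) * (e * p A)) * (v A ^ k * (cnj (u A) ^ m * cnj (v A) ^ k)) + u A ^ Suc m * (
     (of_nat k * v A ^ (k - 1) * ((- cnj e) * s A)) * (cnj (u A) ^ m * cnj (v A) ^ k) + v A ^ k * (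
     (of_nat m * cnj (u A) ^ (m - 1) * cnj (e * p A)) * cnj (v A) ^ k + cnj (u A) ^ m *
     (of_nat k * cnj (v A) ^ (k - 1) * cnj ((- cnj e) * s A)))))))"
  have g_bdd: "bounded_fun n g" unfolding g_def by (intro bounded_fun_intros W bdd)
  have g1_bdd: "bounded_fun n (g1 e)" for e unfolding g1_def by (intro bounded_fun_intros W bdd)
  have g1_0: "E (g1 e) = 0" if e: "norm e = 1" for e
  proof (rule E_first_order)
    define ui where "ui = (\<lambda>\<theta> A. of_real (cos \<theta>) * A (i, i) + e * of_real (sin \<theta>) * A (j, i :: nat) :: complex)"
    define vj where "vj = (\<lambda>\<theta> A. of_real (cos \<theta>) * A (j, j) + (- cnj e) * of_real (sin \<theta>) * A (i, j :: nat) :: complex)"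
    define pj where "pj = (\<lambda>\<theta> A. of_real (cos \<theta>) * A (j, i) + (- cnj e) * of_real (sin \<theta>) * A (i, i :: nat) :: complex)"
    define Gf where "Gf = (\<lambda>\<theta> A. W A * (cnj (pj \<theta> A) * (ui \<theta> A ^ Suc m * (vj \<theta> A ^ k * (cnj (ui \<theta> A) ^ m * cnj (vj \<theta> A) ^ k)))))"
    have x: "expands n ui u (\<lambda>A. e * p A)" "expands n vj v (\<lambda>A. (- cnj e) * s A)" "expands n pj p (\<lambda>A. (- cnj e) * u A)"
      unfolding ui_def vj_def pj_def defs using ij e
      expands_rot[of i n j i e] expands_rot[of j n i j "- cnj e"] expands_rot[of j n i i "- cnj e"] by simp_all
    show "expands n Gf g (g1 e)"
      unfolding Gf_def g_def g1_def by (intro expands_mult expands_power expands_cnj expands_const x W)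
    show "bounded_fun n g" "bounded_fun n (g1 e)" by (rule g_bdd g1_bdd)+
    show "bounded_fun n (Gf \<theta>)" for \<theta>
      unfolding Gf_def ui_def vj_def pj_def using ij by (intro bounded_fun_intros W) auto
    show "E (Gf \<theta>) = E g" for \<theta>
    proof -
      have "Gf \<theta> A = g (mmult n (rot_mat n i j e \<theta>) A)" for A
        unfolding Gf_def g_def defs ui_def vj_def pj_def inv using ij by (simp add: mmult_rot)
      hence "Gf \<theta> = (\<lambda>A. g (mmult n (rot_mat n i j e \<theta>) A))" by (rule ext)
      hence "E (Gf \<theta>) = E (\<lambda>A. g (mmult n (rot_mat n i j e \<theta>) A))" by (simp only:)
      also have "\<dots> = E g"
        using ij e by (intro E_mmult bounded_fun_measurable g_bdd unitary_rot) auto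
      finally show ?thesis .
    qed
  qed
  let ?M = "\<lambda>A. W A * (u A * cnj (u A)) ^ Suc m * (v A * cnj (v A)) ^ k"
  let ?R = "\<lambda>A. W A * (p A * cnj (p A)) * (u A * cnj (u A)) ^ m * (v A * cnj (v A)) ^ k"
  let ?Q = "\<lambda>A. W A * (cnj (p A) * cnj (s A)) * (u A * v A) * (u A * cnj (u A)) ^ m * (v A * cnj (v A)) ^ (k - 1)"
  have bM: "bounded_fun n ?M" "bounded_fun n ?R" "bounded_fun n ?Q"
    by (intro bounded_fun_intros W bdd)+
  \<comment> \<open>The derivative has the form \<open>e * \<alpha> + cnj e * \<beta>\<close>, and
    this combination of the phases 1 and \<open>\<i>\<close> leaves \<open>2 * \<alpha>\<close>. The
    case \<open>k = 0\<close> is separated because of the exponent \<open>k - 1\<close>.\<close>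
  have "g1 1 A - \<i> * g1 \<i> A = 2 * (of_nat (Suc m) * ?R A - ?M A - of_nat k * ?Q A)" for A
  proof (cases k)
    case 0
    show ?thesis unfolding g1_def 0 by (simp add: power_mult_distrib algebra_simps)
  next
    case (Suc k')
    show ?thesis unfolding g1_def Suc by (simp add: power_mult_distrib algebra_simps)
  qed
  hence "E (\<lambda>A. 2 * (of_nat (Suc m) * ?R A - ?M A - of_nat k * ?Q A)) = E (\<lambda>A. g1 1 A - \<i> * g1 \<i> A)"
    by simp
  also have "\<dots> = 0"
    using bounded_integrable[OF g1_bdd] g1_0[of 1] g1_0[of "\<i>"] by simp
  finally have zero: "E (\<lambda>A. 2 * (of_nat (Suc m) * ?R A - ?M A - of_nat k * ?Q A)) = 0" .
  have lin: "E M = of_nat (Suc m) * E R - of_nat k * E Q"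
    if "integrable \<mu> M" "integrable \<mu> R" "integrable \<mu> Q"
      "E (\<lambda>A. 2 * (of_nat (Suc m) * R A - M A - of_nat k * Q A)) = 0" for M R Q :: "cmat \<Rightarrow> complex"
  proof -
    have "2 * (of_nat (Suc m) * E R - E M - of_nat k * E Q) = 0"
      using that by (simp del: of_nat_Suc)
    moreover have "y = x - z" if "2 * (x - y - z) = 0" for x y z :: complex
    proof -
      have "x - y - z = 0" using that by (metis mult_eq_0_iff zero_neq_numeral)
      hence "z = x - y" by (simp only: right_minus_eq)
      thus ?thesis by simp
    qed
    ultimately show ?thesis by blast
  qed
  show ?thesis
    using lin[OF bM(1)[THEN bounded_integrable] bM(2)[THEN bounded_integrable] bM(3)[THEN bounded_integrable] zero]
    unfolding defs .
qed

end

section \<open>Moments of the diagonal entries\<close>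

definition sqn :: "nat \<Rightarrow> cmat \<Rightarrow> complex" where
  "sqn s A = A (s, s) * cnj (A (s, s))"

definition mon :: "nat \<Rightarrow> (nat \<Rightarrow> nat) \<Rightarrow> cmat \<Rightarrow> complex" where
  "mon d K A = (\<Prod>s<d. sqn s A ^ K s)"

lemma bounded_fun_sqn: "s < n \<Longrightarrow> bounded_fun n (sqn s)"
  unfolding sqn_def[abs_def] by (intro bounded_fun_intros)

lemma bounded_fun_mon: "d \<le> n \<Longrightarrow> bounded_fun n (mon d K)"
  unfolding mon_def[abs_def] by (intro bounded_fun_intros bounded_fun_sqn) auto

lemma mon_remove: "i < d \<Longrightarrow> mon d K A = (\<Prod>s\<in>{..<d}-{i}. sqn s A ^ K s) * sqn i A ^ K i"
  unfolding mon_def by (subst prod.remove[of _ i]) (auto simp: mult.commute)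

lemma mon_remove2:
  "i < d \<Longrightarrow> j < d \<Longrightarrow> i \<noteq> j \<Longrightarrow>
    mon d K A = (\<Prod>s\<in>{..<d}-{i,j}. sqn s A ^ K s) * sqn i A ^ K i * sqn j A ^ K j"
proof -
  assume ij: "i < d" "j < d" "i \<noteq> j"
  have "(\<Prod>s\<in>{..<d}-{i}. sqn s A ^ K s) = sqn j A ^ K j * (\<Prod>s\<in>{..<d}-{i}-{j}. sqn s A ^ K s)"
    using ij by (intro prod.remove) auto
  moreover have "{..<d}-{i}-{j} = {..<d}-{i,j}" by auto
  ultimately show ?thesis using ij by (simp add: mon_remove[of i] mult_ac)
qed

lemma mon_upd_Suc: "i < d \<Longrightarrow> mon d (K(i := Suc (K i))) A = sqn i A * mon d K A"
proof -
  assume i: "i < d"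
  have "(\<Prod>s\<in>{..<d}-{i}. sqn s A ^ (K(i := Suc (K i))) s) = (\<Prod>s\<in>{..<d}-{i}. sqn s A ^ K s)"
    by (intro prod.cong) auto
  thus ?thesis using i by (simp add: mon_remove)
qed

context haar_unitary
begin

definition mom :: "nat \<Rightarrow> (nat \<Rightarrow> nat) \<Rightarrow> complex" where
  "mom d K = E (mon d K)"

definition off :: "nat \<Rightarrow> nat \<Rightarrow> nat \<Rightarrow> (nat \<Rightarrow> nat) \<Rightarrow> complex" where
  "off d i j K = E (\<lambda>A. A (i, j) * cnj (A (i, j)) * mon d K A)"

lemma mom_0: "mom d (\<lambda>_. 0) = 1"
  by (simp add: mom_def mon_def[abs_def] prob_space)

text \<open>Taking adjoints exchanges the positions \<open>(i, j)\<close> and \<open>(j, i)\<close>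
  and preserves the moduli of the diagonal entries.\<close>

lemma off_commute:
  assumes "d \<le> n" "i < n" "j < n"
  shows "off d i j K = off d j i K"
proof -
  define f where "f = (\<lambda>A :: cmat. A (j, i) * cnj (A (j, i)) * mon d K A)"
  have "bounded_fun n f"
    unfolding f_def using assms by (intro bounded_fun_intros bounded_fun_mon)
  hence "E f = E (\<lambda>A. f (madj n A))" by (rule E_madj[symmetric])
  also have "(\<lambda>A. f (madj n A)) = (\<lambda>A. A (i, j) * cnj (A (i, j)) * mon d K A)"
  proof
    fix A
    have "mon d K (madj n A) = mon d K A"
      unfolding mon_def using assms(1) by (intro prod.cong) (auto simp: sqn_def madj_entry mult.commute)
    thus "f (madj n A) = A (i, j) * cnj (A (i, j)) * mon d K A"
      using assms by (simp add: f_def madj_entry mult.commute)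
  qed
  finally show ?thesis by (simp add: off_def f_def)
qed

text \<open>Rows and columns have to be permuted together, while the Haar property concerns left
  multiplication. Permuting rows, taking the adjoint and permuting rows again moves the entry at
  \<open>(\<pi> s, \<pi> s)\<close> to \<open>(s, s)\<close>, up to conjugation.\<close>

lemma mom_permute:
  assumes d: "d \<le> n" and \<pi>: "\<pi> permutes {..<d}"
  shows "mom d (K \<circ> \<pi>) = mom d K"
proof -
  have \<pi>n: "\<pi> permutes {..<n}" using d by (intro permutes_subset[OF \<pi>]) auto
  let ?p = "mmult n (perm_mat n \<pi>)"
  define h where "h = mon d (K \<circ> \<pi>)"
  have h: "h \<in> borel_measurable (mat_space n)"
    unfolding h_def by (intro bounded_fun_measurable bounded_fun_mon d)
  have h1: "bounded_fun n (\<lambda>A. h (?p A))"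
  proof -
    have "(\<lambda>A. h (?p A)) = (\<lambda>A. \<Prod>s<d. (A (\<pi> s, s) * cnj (A (\<pi> s, s))) ^ K (\<pi> s))"
      unfolding h_def mon_def sqn_def using d \<pi>n by (intro ext prod.cong) (auto simp: mmult_perm)
    moreover have "bounded_fun n \<dots>"
      using d permutes_less_nat[OF \<pi>n] by (intro bounded_fun_intros) auto
    ultimately show ?thesis by simp
  qed
  have h2: "(\<lambda>A. h (?p (madj n A))) \<in> borel_measurable (mat_space n)"
    by (intro measurable_compose[OF madj_measurable] bounded_fun_measurable h1)
  have "E h = E (\<lambda>A. h (?p A))"
    by (rule E_mmult[OF h unitary_perm[OF \<pi>n], symmetric])
  also have "\<dots> = E (\<lambda>A. h (?p (madj n A)))"
    by (rule E_madj[OF h1, symmetric])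
  also have "\<dots> = E (\<lambda>A. h (?p (madj n (?p A))))"
    by (rule E_mmult[OF h2 unitary_perm[OF \<pi>n], symmetric])
  also have "(\<lambda>A. h (?p (madj n (?p A)))) = mon d K"
  proof
    fix A
    have "h (?p (madj n (?p A))) = (\<Prod>s<d. sqn (\<pi> s) A ^ K (\<pi> s))"
      unfolding h_def mon_def sqn_def using d permutes_less_nat[OF \<pi>n]
      by (intro prod.cong) (auto simp: mmult_perm[OF \<pi>n] madj_entry mult.commute)
    also have "\<dots> = mon d K A"
      unfolding mon_def using prod.permute[OF \<pi>, of "\<lambda>s. sqn s A ^ K s"] by (simp add: o_def)
    finally show "h (?p (madj n (?p A))) = mon d K A" .
  qed
  finally show ?thesis by (simp add: mom_def h_def)
qed

text \<open>The term of the Schwinger--Dyson equation that is not a moment of moduli. The exponents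
  are lowered at both \<open>i\<close> and \<open>j\<close> to make the symmetry in these indices
  apparent.\<close>

definition cross :: "nat \<Rightarrow> nat \<Rightarrow> nat \<Rightarrow> (nat \<Rightarrow> nat) \<Rightarrow> complex" where
  "cross d i j K = E (\<lambda>A. (\<Prod>s\<in>{..<d}-{i,j}. sqn s A ^ K s) * (cnj (A (j,i)) * cnj (A (i,j))) * (A (i,i) * A (j,j)) *
      sqn i A ^ (K i - 1) * sqn j A ^ (K j - 1))"

lemma cross_commute: "cross d i j K = cross d j i K"
  unfolding cross_def by (intro arg_cong[of _ _ E] ext) (simp add: mult_ac insert_commute)

lemma bounded_fun_sqn_prod: "S \<subseteq> {..<n} \<Longrightarrow> bounded_fun n (\<lambda>A. \<Prod>s\<in>S. sqn s A ^ K s)"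
  by (intro bounded_fun_intros bounded_fun_sqn) auto

lemma sqn_prod_rot:
  assumes "S \<subseteq> {..<n} - {i, j}" "i < n" "j < n" "i \<noteq> j"
  shows "(\<Prod>s\<in>S. sqn s (mmult n (rot_mat n i j e \<theta>) A) ^ K s) = (\<Prod>s\<in>S. sqn s A ^ K s)"
proof (intro prod.cong refl)
  fix s assume "s \<in> S"
  with assms(1) have "s < n" "s \<noteq> i" "s \<noteq> j" by auto
  thus "sqn s (mmult n (rot_mat n i j e \<theta>) A) ^ K s = sqn s A ^ K s"
    using mmult_rot(3)[OF assms(2-4), of s s] by (simp add: sqn_def)
qed

lemma mom_eq_off_cross:
  assumes d: "d \<le> n" and ij: "i < d" "j < d" "i \<noteq> j" and K: "K i = Suc m"
  shows "mom d K = of_nat (K i) * off d j i (K(i := m)) - of_nat (K j) * cross d i j K"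
proof -
  define W where "W = (\<lambda>A. \<Prod>s\<in>{..<d}-{i,j}. sqn s A ^ K s)"
  have mon1: "mon d K = (\<lambda>A. W A * (A (i,i) * cnj (A (i,i))) ^ Suc m * (A (j,j) * cnj (A (j,j))) ^ K j)"
    using ij K by (auto simp: W_def mon_remove2 sqn_def)
  have W': "(\<Prod>s\<in>{..<d}-{i,j}. sqn s A ^ (K(i := m)) s) = W A" for A
    unfolding W_def by (intro prod.cong) auto
  have mon2: "(\<lambda>A. A (j, i) * cnj (A (j, i)) * mon d (K(i := m)) A) =
     (\<lambda>A. W A * (A (j,i) * cnj (A (j,i))) * (A (i,i) * cnj (A (i,i))) ^ m * (A (j,j) * cnj (A (j,j))) ^ K j)"
  proof
    fix A
    have "mon d (K(i := m)) A = W A * sqn i A ^ m * sqn j A ^ K j"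
      using ij(3) by (simp only: mon_remove2[OF ij] W') simp
    thus "A (j, i) * cnj (A (j, i)) * mon d (K(i := m)) A =
      W A * (A (j,i) * cnj (A (j,i))) * (A (i,i) * cnj (A (i,i))) ^ m * (A (j,j) * cnj (A (j,j))) ^ K j"
      by (simp add: sqn_def mult_ac)
  qed
  have cr: "cross d i j K = E (\<lambda>A. W A * (cnj (A (j,i)) * cnj (A (i,j))) * (A (i,i) * A (j,j)) *
      (A (i,i) * cnj (A (i,i))) ^ m * (A (j,j) * cnj (A (j,j))) ^ (K j - 1))"
    unfolding cross_def W_def sqn_def K by simp
  show ?thesis
    unfolding mom_def off_def mon1 mon2 cr K
  proof (rule schwinger_dyson)
    show "bounded_fun n W" unfolding W_def using d by (intro bounded_fun_sqn_prod) auto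
    show "W (mmult n (rot_mat n i j e \<theta>) A) = W A" for e \<theta> A
      unfolding W_def using d ij by (intro sqn_prod_rot) auto
  qed (use d ij in auto)
qed

text \<open>\<open>K i\<close> times the equation for \<open>(i, j)\<close> and \<open>K j\<close>
  times the one for \<open>(j, i)\<close> contain the same multiple \<open>K i * K j\<close> of
  \<open>cross\<close>, which cancels in the difference.\<close>

lemma mom_diff:
  assumes d: "d \<le> n" and ij: "i < d" "j < d" "i \<noteq> j"
  shows "(of_nat (K i) - of_nat (K j)) * mom d K =
    (of_nat (K i))\<^sup>2 * off d i j (K(i := K i - 1)) - (of_nat (K j))\<^sup>2 * off d i j (K(j := K j - 1))"
proof -
  have sym: "off d j i K = off d i j K" for K using d ij by (intro off_commute) auto
  have 1: "of_nat (K i) * mom d K = (of_nat (K i))\<^sup>2 * off d i j (K(i := K i - 1)) - of_nat (K i) * of_nat (K j) * cross d i j K"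
    if "i < d" "j < d" "i \<noteq> j" for i j
  proof (cases "K i")
    case (Suc m)
    have "off d j i (K(i := m)) = off d i j (K(i := K i - 1))"
      using d that Suc off_commute[of d i j] by simp
    hence eq: "mom d K = of_nat (K i) * off d i j (K(i := K i - 1)) - of_nat (K j) * cross d i j K"
      using mom_eq_off_cross[where K = K, OF d that Suc] by simp
    show ?thesis by (subst eq) (simp add: power2_eq_square right_diff_distrib mult.assoc)
  qed simp
  show ?thesis
    by (simp only: left_diff_distrib 1[OF ij] 1[OF ij(2,1) ij(3)[symmetric]] sym cross_commute[of d j i])
       (simp add: mult_ac)
qed

text \<open>For \<open>j \<ge> d\<close> the monomial contains no power of the entry
  \<open>(j, j)\<close>, so the Schwinger--Dyson equation is used with \<open>k = 0\<close> and
  loses its cross term.\<close>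

lemma mom_eq_off_outside:
  assumes "d \<le> j" "j < n" "i < d" and K: "K i = Suc m"
  shows "mom d K = of_nat (K i) * off d j i (K(i := m))"
proof -
  define W where "W = (\<lambda>A. \<Prod>s\<in>{..<d}-{i}. sqn s A ^ K s)"
  have mon1: "mon d K = (\<lambda>A. W A * (A (i,i) * cnj (A (i,i))) ^ Suc m * (A (j,j) * cnj (A (j,j))) ^ 0)"
    using assms by (auto simp: W_def mon_remove sqn_def)
  have W': "(\<Prod>s\<in>{..<d}-{i}. sqn s A ^ (K(i := m)) s) = W A" for A
    unfolding W_def by (intro prod.cong) auto
  have mon2: "(\<lambda>A. A (j, i) * cnj (A (j, i)) * mon d (K(i := m)) A) =
     (\<lambda>A. W A * (A (j,i) * cnj (A (j,i))) * (A (i,i) * cnj (A (i,i))) ^ m * (A (j,j) * cnj (A (j,j))) ^ 0)"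
  proof
    fix A
    have "mon d (K(i := m)) A = W A * sqn i A ^ m"
      by (simp only: mon_remove[OF assms(3)] W') simp
    thus "A (j, i) * cnj (A (j, i)) * mon d (K(i := m)) A =
      W A * (A (j,i) * cnj (A (j,i))) * (A (i,i) * cnj (A (i,i))) ^ m * (A (j,j) * cnj (A (j,j))) ^ 0"
      by (simp add: sqn_def mult_ac)
  qed
  have "mom d K = of_nat (Suc m) * E (\<lambda>A. W A * (A (j,i) * cnj (A (j,i))) * (A (i,i) * cnj (A (i,i))) ^ m * (A (j,j) * cnj (A (j,j))) ^ 0) -
    of_nat 0 * E (\<lambda>A. W A * (cnj (A (j,i)) * cnj (A (i,j))) * (A (i,i) * A (j,j)) *
      (A (i,i) * cnj (A (i,i))) ^ m * (A (j,j) * cnj (A (j,j))) ^ (0 - 1))"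
    unfolding mom_def mon1
  proof (rule schwinger_dyson)
    show "bounded_fun n W" unfolding W_def using assms by (intro bounded_fun_sqn_prod) auto
    show "W (mmult n (rot_mat n i j e \<theta>) A) = W A" for e \<theta> A
      unfolding W_def using assms by (intro sqn_prod_rot) auto
  qed (use assms in auto)
  thus ?thesis by (simp only: off_def mon2 K of_nat_0 mult_zero_left diff_zero)
qed

lemma mom_eq_sum_off:
  assumes "d \<le> n" "i < n"
  shows "mom d K = (\<Sum>j<n. off d j i K)"
proof -
  have b: "bounded_fun n (\<lambda>A. A (j, i) * cnj (A (j, i)) * mon d K A)" if "j < n" for j
    using that assms by (intro bounded_fun_intros bounded_fun_mon)
  have "mom d K = E (\<lambda>A. \<Sum>j<n. A (j, i) * cnj (A (j, i)) * mon d K A)"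
    unfolding mom_def
  proof (rule E_cong)
    fix A assume "unitary n A"
    hence "(\<Sum>j<n. A (j, i) * cnj (A (j, i))) = 1"
      using unitary_columns[of n A i i] assms by (simp add: mult.commute)
    thus "mon d K A = (\<Sum>j<n. A (j, i) * cnj (A (j, i)) * mon d K A)"
      by (simp add: sum_distrib_right[symmetric])
  qed (use assms b in \<open>auto intro: bounded_fun_mon bounded_fun_sum\<close>)
  also have "\<dots> = (\<Sum>j<n. off d j i K)"
    unfolding off_def using b by (intro Bochner_Integration.integral_sum bounded_integrable) auto
  finally show ?thesis .
qed

lemma off_diag: "i < d \<Longrightarrow> off d i i K = mom d (K(i := Suc (K i)))"
  unfolding off_def mom_def by (intro arg_cong[of _ _ E] ext) (simp add: mon_upd_Suc sqn_def)

section \<open>Weighted moments as a solution of Muirhead's system\<close>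

definition rsq :: "nat \<Rightarrow> (nat \<Rightarrow> int) \<Rightarrow> complex" where
  "rsq d K = (\<Prod>s<d. (rfact (K s))\<^sup>2)"

definition phi :: "nat \<Rightarrow> (nat \<Rightarrow> int) \<Rightarrow> complex" where
  "phi d K = rsq d K * mom d (\<lambda>s. nat (K s))"

definition phi_off :: "nat \<Rightarrow> nat \<Rightarrow> nat \<Rightarrow> (nat \<Rightarrow> int) \<Rightarrow> complex" where
  "phi_off d i j K = rsq d K * off d i j (\<lambda>s. nat (K s))"

lemma rsq_eq_0: "i < d \<Longrightarrow> K i < 0 \<Longrightarrow> rsq d K = 0"
  unfolding rsq_def by (rule prod_zero) (auto intro!: bexI[of _ i])

lemma rsq_upd: "i < d \<Longrightarrow> rsq d (K(i := K i - 1)) = (of_int (K i))\<^sup>2 * rsq d K"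
proof -
  assume i: "i < d"
  have "(\<Prod>s\<in>{..<d}-{i}. (rfact ((K(i := K i - 1)) s))\<^sup>2) = (\<Prod>s\<in>{..<d}-{i}. (rfact (K s))\<^sup>2)"
    by (intro prod.cong) auto
  thus ?thesis
    using i unfolding rsq_def
    by (simp add: prod.remove[of "{..<d}" i] rfact_rec[symmetric] power_mult_distrib mult_ac)
qed

lemma nat_upd: "(\<lambda>s. nat ((K(i := K i - 1)) s)) = (\<lambda>s. nat (K s))(i := nat (K i) - 1)"
  by (auto simp: fun_eq_iff nat_diff_distrib')

lemma muirhead_phi:
  assumes n: "n = d + q"
  shows "muirhead_system d q (phi d) (phi_off d)"
proof
  have d: "d \<le> n" using n by simp
  show "vanishes_neg d (phi d)" "vanishes_neg d (phi_off d i j)" for i j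
    by (auto simp: vanishes_neg_def phi_def phi_off_def rsq_eq_0)
  show "phi d (K \<circ> \<pi>) = phi d K" if "\<pi> permutes {..<d}" for \<pi> K
  proof -
    have "rsq d (K \<circ> \<pi>) = rsq d K"
      unfolding rsq_def using prod.permute[OF that, of "\<lambda>s. (rfact (K s))\<^sup>2"] by (simp add: o_def)
    moreover have "mom d (\<lambda>s. nat ((K \<circ> \<pi>) s)) = mom d (\<lambda>s. nat (K s))"
      using mom_permute[OF d that, of "\<lambda>s. nat (K s)"] by (simp add: o_def)
    ultimately show ?thesis by (simp add: phi_def)
  qed
  show "phi d (\<lambda>_. 0) = 1" by (simp add: phi_def rsq_def mom_0)
  show "phi_off d i j (K(i := K i - 1)) - phi_off d i j (K(j := K j - 1)) = of_int (K i - K j) * phi d K"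
    if ij: "i < d" "j < d" "i \<noteq> j" for i j K
  proof (cases "rsq d K = 0")
    case True
    thus ?thesis using ij by (simp add: phi_off_def phi_def rsq_upd)
  next
    case False
    hence "K i \<ge> 0" "K j \<ge> 0" using ij rsq_eq_0[of _ d K] not_less by blast+
    hence "(of_int (K i) :: complex) = of_nat (nat (K i))" "(of_int (K j) :: complex) = of_nat (nat (K j))" by auto
    hence "phi_off d i j (K(i := K i - 1)) - phi_off d i j (K(j := K j - 1)) =
      rsq d K * ((of_nat (nat (K i)))\<^sup>2 * off d i j ((\<lambda>s. nat (K s))(i := nat (K i) - 1)) -
        (of_nat (nat (K j)))\<^sup>2 * off d i j ((\<lambda>s. nat (K s))(j := nat (K j) - 1)))"
      using ij by (simp only: phi_off_def rsq_upd nat_upd right_diff_distrib mult_ac)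
    also have "\<dots> = rsq d K * ((of_nat (nat (K i)) - of_nat (nat (K j))) * mom d (\<lambda>s. nat (K s)))"
      by (simp only: mom_diff[OF d ij, of "\<lambda>s. nat (K s)"])
    finally show ?thesis
      using \<open>of_int (K i) = _\<close> \<open>of_int (K j) = _\<close> by (simp only: phi_def of_int_diff mult_ac)
  qed
  show "phi d (K(i := K i - 1)) = of_int (K i * K i + int q * K i) * phi d K +
      (\<Sum>j\<in>{..<d}-{i}. phi_off d i j (K(i := K i - 1)))" if i: "i < d" for i K
  proof (cases "rsq d K = 0 \<or> K i = 0")
    \<comment> \<open>Lowering \<open>K i\<close> multiplies \<open>rsq\<close> by
      \<open>(K i)^2\<close>, so every term vanishes in this case.\<close>
    case True
    thus ?thesis using i by (auto simp: phi_off_def phi_def rsq_upd)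
  next
    case False
    hence "K i > 0" using i rsq_eq_0[of i d K] by force
    define k where "k = (\<lambda>s. nat (K s))"
    define m where "m = nat (K i) - 1"
    have ki: "k i = Suc m" and Ki: "of_int (K i) = (of_nat (Suc m) :: complex)"
      using \<open>K i > 0\<close> by (auto simp: k_def m_def)
    let ?k = "k(i := m)"
    have "mom d ?k = (\<Sum>j<n. off d j i ?k)"
      using i d by (intro mom_eq_sum_off) auto
    \<comment> \<open>The row \<open>j = i\<close> restores the exponent of \<open>k\<close>, the
      other rows below \<open>d\<close> give the terms \<open>P i j\<close>, and each of the
      \<open>q\<close> remaining rows gives \<open>mom d k / k i\<close>. Multiplication by
      \<open>(k i)^2\<close> then produces the coefficient
      \<open>K i * K i + q * K i\<close>.\<close>
    also have "\<dots> = off d i i ?k + (\<Sum>j\<in>{..<d}-{i}. off d j i ?k) + (\<Sum>j\<in>{d..<n}. off d j i ?k)"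
    proof -
      have "{..<n} = {..<d} \<union> {d..<n}" using d by auto
      hence "(\<Sum>j<n. off d j i ?k) = (\<Sum>j<d. off d j i ?k) + (\<Sum>j\<in>{d..<n}. off d j i ?k)"
        by (simp add: sum.union_disjoint ivl_disj_int)
      thus ?thesis using i by (simp add: sum.remove[of "{..<d}" i])
    qed
    also have "off d i i ?k = mom d k"
      using i ki by (simp add: off_diag fun_upd_idem)
    also have "(\<Sum>j\<in>{..<d}-{i}. off d j i ?k) = (\<Sum>j\<in>{..<d}-{i}. off d i j ?k)"
      using i d by (intro sum.cong off_commute) auto
    also have "(\<Sum>j\<in>{d..<n}. off d j i ?k) = (\<Sum>j\<in>{d..<n}. mom d k / of_nat (Suc m))"
    proof (intro sum.cong refl)
      fix j assume "j \<in> {d..<n}"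
      thus "off d j i ?k = mom d k / of_nat (Suc m)"
        using mom_eq_off_outside[where K = k, OF _ _ i ki, of j] i ki by (simp add: field_simps del: of_nat_Suc)
    qed
    also have "\<dots> = of_nat q * mom d k / of_nat (Suc m)" by (simp add: n)
    finally have "mom d ?k = mom d k + (\<Sum>j\<in>{..<d}-{i}. off d i j ?k) + of_nat q * mom d k / of_nat (Suc m)" .
    moreover have "c\<^sup>2 * a = (c\<^sup>2 + r * c) * b + c\<^sup>2 * s" if "a = b + s + r * b / c" "c \<noteq> 0" for a b c s r :: complex
    proof -
      have "a * c = (b + s) * c + r * b" using that by (simp add: field_simps)
      hence "(a * c) * c = ((b + s) * c + r * b) * c" by (simp only:)
      thus ?thesis by (simp add: power2_eq_square algebra_simps)
    qed
    ultimately have *: "(of_nat (Suc m))\<^sup>2 * mom d ?k = ((of_nat (Suc m))\<^sup>2 + of_nat q * of_nat (Suc m)) * mom d k +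
        (of_nat (Suc m))\<^sup>2 * (\<Sum>j\<in>{..<d}-{i}. off d i j ?k)"
      using of_nat_neq_0 by blast
    have upd: "(\<lambda>s. nat ((K(i := K i - 1)) s)) = ?k"
      unfolding nat_upd k_def m_def ..
    have "phi d (K(i := K i - 1)) = rsq d K * ((of_nat (Suc m))\<^sup>2 * mom d ?k)"
      unfolding phi_def upd rsq_upd[OF i] Ki by (simp only: mult_ac)
    also have "\<dots> = ((of_nat (Suc m))\<^sup>2 + of_nat q * of_nat (Suc m)) * (rsq d K * mom d k) +
        (\<Sum>j\<in>{..<d}-{i}. (of_nat (Suc m))\<^sup>2 * rsq d K * off d i j ?k)"
      unfolding * by (simp only: distrib_left sum_distrib_left[symmetric] mult_ac)
    also have "\<dots> = of_int (K i * K i + int q * K i) * phi d K + (\<Sum>j\<in>{..<d}-{i}. phi_off d i j (K(i := K i - 1)))"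
      unfolding phi_def phi_off_def upd rsq_upd[OF i] k_def[symmetric]
      by (simp only: of_int_add of_int_mult Ki of_int_of_nat_eq power2_eq_square)
    finally show ?thesis .
  qed
qed

lemma E_monomial_eq_0:
  assumes d: "d \<le> n" and s: "s < d" "k s \<noteq> l s"
  shows "E (\<lambda>A. \<Prod>i<d. A (i, i) ^ k i * cnj (A (i, i)) ^ l i) = 0"
proof -
  define f where "f = (\<lambda>A :: cmat. \<Prod>i<d. A (i, i) ^ k i * cnj (A (i, i)) ^ l i)"
  \<comment> \<open>Chosen so that the phase on row \<open>s\<close> multiplies the monomial by
    \<open>cis (\<alpha> * (k s - l s)) = cis pi = -1\<close>.\<close>
  define \<alpha> where "\<alpha> = pi / (real (k s) - real (l s))"
  define v where "v = (\<lambda>i. if i = s then cis \<alpha> else 1)"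
  have f: "bounded_fun n f" unfolding f_def using d by (intro bounded_fun_intros) auto
  have "\<alpha> * real (k s) - \<alpha> * real (l s) = pi"
    unfolding right_diff_distrib[symmetric] \<alpha>_def using s(2) by simp
  moreover have "cis \<alpha> ^ k s * cnj (cis \<alpha>) ^ l s = cis (\<alpha> * real (k s) - \<alpha> * real (l s))"
    by (simp only: cis_cnj Complex.DeMoivre cis_mult) (simp add: mult.commute)
  ultimately have "cis \<alpha> ^ k s * cnj (cis \<alpha>) ^ l s = -1" by simp
  hence v: "(\<Prod>i<d. v i ^ k i * cnj (v i) ^ l i) = -1"
    using s by (subst prod.remove[of _ s]) (auto simp: v_def)
  have "f (mmult n (diag_mat_of n v) A) = - f A" for A
  proof -
    have "f (mmult n (diag_mat_of n v) A) = (\<Prod>i<d. (v i ^ k i * cnj (v i) ^ l i) * (A (i, i) ^ k i * cnj (A (i, i)) ^ l i))"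
      unfolding f_def using d by (intro prod.cong) (auto simp: mmult_diag power_mult_distrib)
    also have "\<dots> = (\<Prod>i<d. v i ^ k i * cnj (v i) ^ l i) * f A"
      unfolding f_def by (rule prod.distrib)
    finally show ?thesis by (simp only: v) simp
  qed
  moreover have "E (\<lambda>A. f (mmult n (diag_mat_of n v) A)) = E f"
    by (rule E_mmult[OF bounded_fun_measurable[OF f] unitary_diag]) (simp add: v_def)
  ultimately have "E f = - E f" by simp
  thus ?thesis by (simp add: f_def)
qed

text \<open>The exponential of the trace is a product of exponentials; \<open>X\<close> and
  \<open>Y\<close> record the exponents of the diagonal entries and of their conjugates. Only
  \<open>X = Y\<close> survives integration, which excludes odd \<open>N\<close> and produces the
  weights \<open>1 / (k!)^2\<close> of \<open>phi\<close>.\<close>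

lemma E_trace_power:
  assumes d: "d \<le> n"
  shows "E (\<lambda>A. (\<Sum>i<d. A (i, i) + cnj (A (i, i))) ^ N / fact N) =
    (if even N then \<Sum>X\<in>multisets_of_size {..<d} (N div 2). phi d (cnt X) else 0)"
proof -
  define t where "t = (\<lambda>X Y (A :: cmat). (\<Prod>i<d. 1 / (fact (count X i) * fact (count Y i))) *
     (\<Prod>i<d. A (i, i) ^ count X i * cnj (A (i, i)) ^ count Y i))"
  let ?M = "multisets_of_size {..<d}"
  have fps_exp_sum: "fps_exp (\<Sum>i\<in>I. f i) = (\<Prod>i\<in>I. fps_exp (f i))" if "finite I" for I :: "nat set" and f :: "nat \<Rightarrow> complex"
    using that by induction (auto simp: fps_exp_add_mult)
  have expand: "(\<Sum>i<d. A (i, i) + cnj (A (i, i))) ^ N / fact N = (\<Sum>p = 0..N. \<Sum>X\<in>?M p. \<Sum>Y\<in>?M (N - p). t X Y A)" for A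
  proof -
    have "(\<Sum>i<d. A (i, i) + cnj (A (i, i))) ^ N / fact N = fps_nth (fps_exp (\<Sum>i<d. A (i, i) + cnj (A (i, i)))) N"
      by simp
    also have "fps_exp (\<Sum>i<d. A (i, i) + cnj (A (i, i))) = (\<Prod>i<d. fps_exp (A (i, i))) * (\<Prod>i<d. fps_exp (cnj (A (i, i))))"
      by (simp only: sum.distrib fps_exp_add_mult fps_exp_sum finite_lessThan)
    also have "fps_nth \<dots> N = (\<Sum>p = 0..N. (\<Sum>X\<in>?M p. \<Prod>i<d. A (i, i) ^ count X i / fact (count X i)) *
        (\<Sum>Y\<in>?M (N - p). \<Prod>i<d. cnj (A (i, i)) ^ count Y i / fact (count Y i)))"
      by (simp add: fps_mult_nth fps_prod_nth')
    also have "\<dots> = (\<Sum>p = 0..N. \<Sum>X\<in>?M p. \<Sum>Y\<in>?M (N - p). t X Y A)"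
      unfolding sum_product t_def prod.distrib[symmetric] by (intro sum.cong prod.cong refl) simp
    finally show ?thesis .
  qed
  have fin: "finite (?M p)" for p by (rule finite_multisets_of_size) simp
  have t: "bounded_fun n (t X Y)" for X Y
    unfolding t_def using d by (intro bounded_fun_intros) auto
  have Et: "E (t X Y) = (if X = Y then phi d (cnt X) else 0)" if "X \<in> ?M p" "Y \<in> ?M p'" for X Y p p'
  proof (cases "X = Y")
    case True
    have "t X X = (\<lambda>A. rsq d (cnt X) * mon d (count X) A)"
      unfolding t_def rsq_def mon_def sqn_def
      by (simp add: power_mult_distrib power2_eq_square prod_dividef)
    thus ?thesis using True by (simp add: phi_def mom_def)
  next
    case False
    then obtain s where s: "count X s \<noteq> count Y s" by (meson multiset_eqI)
    have "s < d"
    proof (rule ccontr)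
      assume "\<not> s < d"
      hence "s \<notin># X" "s \<notin># Y" using that by (auto simp: multisets_of_size_def)
      thus False using s by (simp add: not_in_iff)
    qed
    thus ?thesis using False E_monomial_eq_0[where k = "count X" and l = "count Y", OF d _ s] by (simp add: t_def)
  qed
  have "E (\<lambda>A. (\<Sum>i<d. A (i, i) + cnj (A (i, i))) ^ N / fact N) = (\<Sum>p = 0..N. \<Sum>X\<in>?M p. \<Sum>Y\<in>?M (N - p). E (t X Y))"
    unfolding expand using t by (simp add: Bochner_Integration.integral_sum integrable_sum bounded_integrable)
  also have "\<dots> = (\<Sum>p = 0..N. if p = N - p then \<Sum>X\<in>?M p. phi d (cnt X) else 0)"
  proof (rule sum.cong[OF refl])
    fix p assume "p \<in> {0..N}"
    have "(\<Sum>X\<in>?M p. \<Sum>Y\<in>?M (N - p). E (t X Y)) = (\<Sum>X\<in>?M p. \<Sum>Y\<in>?M (N - p). if X = Y then phi d (cnt X) else 0)"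
      by (intro sum.cong refl Et)
    also have "\<dots> = (\<Sum>X\<in>?M p. if X \<in> ?M (N - p) then phi d (cnt X) else 0)"
      by (intro sum.cong refl sum.delta' fin)
    also have "\<dots> = (\<Sum>X\<in>?M p. if p = N - p then phi d (cnt X) else 0)"
      by (intro sum.cong) (auto simp: multisets_of_size_def)
    finally show "(\<Sum>X\<in>?M p. \<Sum>Y\<in>?M (N - p). E (t X Y)) = (if p = N - p then \<Sum>X\<in>?M p. phi d (cnt X) else 0)"
      by simp
  qed
  also have "\<dots> = (if even N then \<Sum>X\<in>?M (N div 2). phi d (cnt X) else 0)"
  proof (cases "even N")
    case True
    have "(\<Sum>p = 0..N. if p = N - p then \<Sum>X\<in>?M p. phi d (cnt X) else 0) = (\<Sum>p\<in>{N div 2}. \<Sum>X\<in>?M p. phi d (cnt X))"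
      using True by (intro sum.mono_neutral_cong_right) auto
    thus ?thesis using True by simp
  next
    case False
    have "p \<noteq> N - p" if "p \<le> N" for p
    proof
      assume "p = N - p"
      with that have "N = 2 * p" by linarith
      with False show False by simp
    qed
    with False show ?thesis by (auto intro!: sum.neutral)
  qed
  finally show ?thesis .
qed

text \<open>The trace sum is bounded on unitary matrices, so an exponential series dominates the
  terms and summation commutes with expectation.\<close>

lemma E_exp_trace_sums:
  fixes x :: real
  assumes d: "d \<le> n"
  defines "S \<equiv> \<lambda>A :: cmat. \<Sum>i<d. A (i, i) + cnj (A (i, i))"
  shows "(\<lambda>N. of_real x ^ N * E (\<lambda>A. S A ^ N / fact N)) sums E (\<lambda>A. exp (of_real x * S A))"
proof -
  define f where "f = (\<lambda>N A. of_real x ^ N * (S A ^ N / fact N))"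
  have bS: "bounded_fun n S" unfolding S_def using d by (intro bounded_fun_intros) auto
  then obtain C where C: "\<And>A. unitary n A \<Longrightarrow> norm (S A) \<le> C" by (auto simp: bounded_fun_def)
  have "bounded_fun n (\<lambda>A. (of_real x ^ N * (1 / fact N)) * S A ^ N)" for N
    by (intro bounded_fun_intros bS)
  hence int: "integrable \<mu> (f N)" for N
    using bounded_integrable by (simp add: f_def)
  have f_le: "AE A in \<mu>. norm (f N A) \<le> (\<bar>x\<bar> * C) ^ N / fact N" for N
    using AE_unitary
  proof eventually_elim
    fix A assume "unitary n A"
    hence "(\<bar>x\<bar> * norm (S A)) ^ N \<le> (\<bar>x\<bar> * C) ^ N"
      using C by (intro power_mono mult_left_mono) auto
    thus "norm (f N A) \<le> (\<bar>x\<bar> * C) ^ N / fact N"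
      by (simp add: f_def norm_mult norm_divide norm_power power_mult_distrib divide_right_mono)
  qed
  have f_sums: "(\<lambda>N. f N A) sums exp (of_real x * S A)" for A
    using exp_converges[of "of_real x * S A"] by (simp add: f_def power_mult_distrib scaleR_conv_of_real field_simps)
  have exp_summable: "summable (\<lambda>N. (\<bar>x\<bar> * C) ^ N / fact N)"
    using summable_exp[of "\<bar>x\<bar> * C"] by (simp add: field_simps)
  have "(\<lambda>N. E (f N)) sums (\<integral>A. (\<Sum>N. f N A) \<partial>\<mu>)"
  proof (rule sums_integral[OF int])
    have "summable (\<lambda>N. norm (f N A))" for A
    proof -
      have "summable (\<lambda>N. norm (((of_real x * S A) ^ N) /\<^sub>R fact N))" by (rule summable_norm_exp)
      thus ?thesis by (simp add: f_def power_mult_distrib norm_mult norm_divide field_simps)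
    qed
    thus "AE A in \<mu>. summable (\<lambda>N. norm (f N A))" by simp
    show "summable (\<lambda>N. \<integral>A. norm (f N A) \<partial>\<mu>)"
    proof (rule summable_comparison_test'[OF exp_summable])
      fix N
      have "(\<integral>A. norm (f N A) \<partial>\<mu>) \<le> (\<bar>x\<bar> * C) ^ N / fact N"
        using f_le int by (intro integral_le_const integrable_norm) auto
      thus "norm (\<integral>A. norm (f N A) \<partial>\<mu>) \<le> (\<bar>x\<bar> * C) ^ N / fact N" by simp
    qed
  qed
  also have "(\<lambda>A. \<Sum>N. f N A) = (\<lambda>A. exp (of_real x * S A))"
    using f_sums by (simp add: sums_iff)
  finally show ?thesis by (simp add: f_def)
qed

end

theorem theorem1:
  fixes d q :: nat and \<mu> :: "cmat measure" and x :: real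
  assumes "d \<ge> 1"
    and "is_haar_unitary (d + q) \<mu>"
  shows "(\<lambda>N. of_nat (Z d N q) * (of_real x) ^ N / fact N) sums G d q \<mu> x"
proof -
  interpret haar_unitary "d + q" \<mu> by unfold_locales (rule assms(2))
  interpret muirhead_system d q "phi d" "phi_off d" by (rule muirhead_phi[OF refl])
  define S where "S = (\<lambda>A :: cmat. \<Sum>i<d. A (i, i) + cnj (A (i, i)))"
  define e where "e = (\<lambda>N. E (\<lambda>A. S A ^ N / fact N))"
  have H: "Hdq d q \<noteq> 0" by (simp add: Hdq_def)
  have S: "mtrace d (\<lambda>ij. P ij + madj d P ij) = S P" for P
    unfolding mtrace_def S_def by (intro sum.cong) (auto simp: madj_entry)
  have submat: "submat d \<in> measurable \<mu> (mat_space d)"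
  proof -
    have "(\<lambda>A. restrict A (idx d)) \<in> measurable (mat_space (d + q)) (PiM (idx d) (\<lambda>_. borel))"
      by (intro measurable_restrict entry_measurable)
    thus ?thesis by (simp add: measurable_eq submat_def[abs_def] mat_space_def[of d])
  qed
  have S_submat: "S (submat d A) = S A" for A
    unfolding S_def by (intro sum.cong) (auto simp: submat_def)
  have S_meas: "S \<in> borel_measurable (mat_space d)"
    unfolding S_def by (intro borel_measurable_sum borel_measurable_add entry_measurable measurable_compose[OF entry_measurable cnj_measurable])
  have "integral\<^sup>L (gamma d \<mu>) (\<lambda>P. exp (of_real x * S P)) = E (\<lambda>A. exp (of_real x * S (submat d A)))"
    unfolding gamma_def using S_meas by (intro integral_distr submat) measurable
  hence G: "G d q \<mu> x = of_real x ^ (d * q) / Hdq d q * E (\<lambda>A. exp (of_real x * S A))"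
    by (simp only: G_def S S_submat)
  \<comment> \<open>The moments and the walks lead to the same alternating sum, by
    \<open>diagonal_sum\<close> and \<open>Z_generating_function\<close>; the moment side carries
    the extra factor \<open>Hdq d q\<close>.\<close>
  have Z: "of_nat (Z d N q) / fact N = (if d * q \<le> N then e (N - d * q) / Hdq d q else 0)" for N
  proof (cases "d * q \<le> N \<and> even (N - d * q)")
    case True
    have "e (N - d * q) = Hdq d q * alt d (\<lambda>\<sigma>. \<Sum>X\<in>multisets_of_size {..<d} ((N - d * q) div 2).
         \<Prod>i<d. rfact (cnt X i) * rfact (cnt X i + (int q + int i - int (\<sigma> i))))"
      using True E_trace_power[of d "N - d * q"] diagonal_sum[of "int ((N - d * q) div 2)"]
      by (simp only: e_def S_def MI_of_nat Hdq_def le_add1 if_True)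
    thus ?thesis using True H by (simp only: Z_generating_function if_True) simp
  next
    case False
    thus ?thesis using E_trace_power[of d "N - d * q"]
      by (auto simp only: Z_generating_function e_def S_def le_add1 if_False div_0 split: if_splits)
  qed
  have "(\<lambda>N. of_real x ^ (d * q) / Hdq d q * (of_real x ^ N * e N)) sums G d q \<mu> x"
    unfolding G e_def S_def by (intro sums_mult E_exp_trace_sums) simp
  also have "(\<lambda>N. of_real x ^ (d * q) / Hdq d q * (of_real x ^ N * e N)) =
    (\<lambda>N. of_nat (Z d (N + d * q) q) * of_real x ^ (N + d * q) / fact (N + d * q))"
  proof
    fix N
    have "of_nat (Z d (N + d * q) q) * complex_of_real x ^ (N + d * q) / fact (N + d * q) =
      of_nat (Z d (N + d * q) q) / fact (N + d * q) * of_real x ^ (N + d * q)" by simp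
    also have "\<dots> = e N / Hdq d q * of_real x ^ (N + d * q)"
      by (subst Z) simp
    finally show "of_real x ^ (d * q) / Hdq d q * (of_real x ^ N * e N) =
      of_nat (Z d (N + d * q) q) * of_real x ^ (N + d * q) / fact (N + d * q)"
      by (simp add: power_add)
  qed
  finally show ?thesis
  \<comment> \<open>The prefactor \<open>x ^ (d * q)\<close> shifts the series, and the first
    \<open>d * q\<close> coefficients of the walk series are zero by \<open>Z\<close>.\<close>
  proof (subst (asm) sums_iff_shift)
    have "(\<Sum>i<d * q. of_nat (Z d i q) * complex_of_real x ^ i / fact i) = 0"
    proof (rule sum.neutral, rule ballI)
      fix i assume "i \<in> {..<d * q}"
      hence "of_nat (Z d i q) / (fact i :: complex) = 0" by (subst Z) simp
      thus "of_nat (Z d i q) * complex_of_real x ^ i / fact i = 0" by auto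
    qed
    thus "(\<lambda>N. of_nat (Z d N q) * of_real x ^ N / fact N) sums
        (G d q \<mu> x + (\<Sum>i<d * q. of_nat (Z d i q) * of_real x ^ i / fact i)) \<Longrightarrow> ?thesis"
      by simp
  qed
qed

end
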